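(* Let $R$ be a commutative ring and let $A$ be a cogroup in the category $\mathcal{A}$ of connected graded $R$-algebras. Then the inverse $\nu$ of $A$ and the antipode $\chi$ of the underlying Hopf algebra of $A$ coincide on the subcoalgebra $SA\subset A$, i.e. $\nu|_{SA}=\chi|_{SA}$.
   Context: $R$ is a commutative ring; graded modules are graded by the non-negative integers, and tensor products are over $R$ with the usual sign rule. A connected graded algebra is an associative unital graded $R$-algebra $B$ with $B_0=R$; these form the category $\mathcal{A}$, in which $R$ is a zero object. The categorical coproduct in $\mathcal{A}$ is denoted $\ast$ (free product). For $x\in A$, $x'$ and $x''$ denote the images of $x$ in $A\ast A$ under the canonical inclusions of $A$ as the first and second factor. A comonoid in $\mathcal{A}$ is an object $A$ with a coassociative, counital morphism $\Phi:A\to A\ast A$ in $\mathcal{A}$ (counital: the composites of $\Phi$ with the maps $A\ast A\to A$ given by the identity on one factor and the trivial map $A\to R\to A$ on the other are the identity). A cogroup in $\mathcal{A}$ is a comonoid having an inverse: a morphism $\nu:A\to A$ in $\mathcal{A}$ such that the composites of $\Phi$ with $(1_A,\nu),(\nu,1_A):A\ast A\to A$ are both the trivial map $A\to R\to A$. The underlying Hopf algebra of $A$ is the graded algebra $A$ with coproduct $\Delta$ the composite $A\xrightarrow{\Phi}A\ast A\to A\otimes A$, where the second map is the algebra homomorphism with $a'\mapsto a\otimes 1$, $a''\mapsto 1\otimes a$, and with counit the projection $A\to A_0=R$. Its antipode $\chi:A\to A$ is the inverse of $1_A$ under the convolution product $f\ast g=\mu\circ(f\otimes g)\circ\Delta$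 on degree-preserving $R$-linear maps $A\to A$ that are the identity in degree $0$ ($\mu$ the multiplication of $A$). $SA$ denotes Berstein's subcoalgebra of $A$: $SA=\{x\in A : \Phi(x)\in A'A''\}$, where $A'A''$ is the $R$-submodule of $A\ast A$ spanned by the products $a'b''$ with $a,b\in A$. (By Berstein's theorem, the inclusion of $\overline{SA}=\bigoplus_{n>0}(SA)_n$ induces an isomorphism of graded algebras from the tensor algebra $T(\overline{SA})$ onto $A$, and $SA$ is a subcoalgebra of the underlying coalgebra of $A$.) *)

theory Defs
  imports "HOL-Algebra.Module"
begin

section \<open>Graded algebras\<close>

record ('r, 'a) graded_alg = "('r, 'a) module" +
  grade :: "nat \<Rightarrow> 'a set"

text \<open>A family of homogeneous elements, almost all zero, with sum \<open>x\<close>.\<close>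

definition homogeneous_decomp ::
  "('r, 'a, 'm) graded_alg_scheme \<Rightarrow> 'a \<Rightarrow> (nat \<Rightarrow> 'a) \<Rightarrow> bool" where
  "homogeneous_decomp A x c \<longleftrightarrow>
     (\<forall>n. c n \<in> grade A n) \<and> finite {n. c n \<noteq> \<zero>\<^bsub>A\<^esub>} \<and>
     x = finsum A c {n. c n \<noteq> \<zero>\<^bsub>A\<^esub>}"

definition component :: "('r, 'a, 'm) graded_alg_scheme \<Rightarrow> 'a \<Rightarrow> nat \<Rightarrow> 'a" where
  "component A x = (THE c. homogeneous_decomp A x c)"

text \<open>
  The grading is an internal direct sum decomposition indexed by the natural numbers.
  Algebras are associative and unital, but not commutative, so the library locale
  \<^locale>\<open>algebra\<close> does not apply. The condition \<open>B\<^sub>0 = R\<close> says that the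
  unit map is a bijection from \<open>R\<close> onto the part of degree 0.
\<close>

locale connected_graded_algebra = module R A + ring A
  for R :: "('r, 'l) ring_scheme" and A :: "('r, 'a, 'm) graded_alg_scheme" +
  assumes smult_mult_left:
      "\<lbrakk>r \<in> carrier R; x \<in> carrier A; y \<in> carrier A\<rbrakk> \<Longrightarrow>
        (r \<odot>\<^bsub>A\<^esub> x) \<otimes>\<^bsub>A\<^esub> y = r \<odot>\<^bsub>A\<^esub> (x \<otimes>\<^bsub>A\<^esub> y)"
    and smult_mult_right:
      "\<lbrakk>r \<in> carrier R; x \<in> carrier A; y \<in> carrier A\<rbrakk> \<Longrightarrow>
        x \<otimes>\<^bsub>A\<^esub> (r \<odot>\<^bsub>A\<^esub> y) = r \<odot>\<^bsub>A\<^esub> (x \<otimes>\<^bsub>A\<^esub> y)"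
    and grade_submodule: "submodule (grade A n) R A"
    and grade_direct_sum: "x \<in> carrier A \<Longrightarrow> \<exists>!c. homogeneous_decomp A x c"
    and grade_mult:
      "\<lbrakk>x \<in> grade A m; y \<in> grade A n\<rbrakk> \<Longrightarrow> x \<otimes>\<^bsub>A\<^esub> y \<in> grade A (m + n)"
    and grade_one: "\<one>\<^bsub>A\<^esub> \<in> grade A 0"
    and connected: "bij_betw (\<lambda>r. r \<odot>\<^bsub>A\<^esub> \<one>\<^bsub>A\<^esub>) (carrier R) (grade A 0)"

text \<open>Morphisms; only their values on the carrier are relevant.\<close>

definition alg_hom ::
  "('r, 'l) ring_scheme \<Rightarrow> ('r, 'a, 'm) graded_alg_scheme \<Rightarrow> ('r, 'b, 'n) graded_alg_scheme \<Rightarrow>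
   ('a \<Rightarrow> 'b) set" where
  "alg_hom R A B =
     {f \<in> ring_hom A B.
        (\<forall>r \<in> carrier R. \<forall>x \<in> carrier A. f (r \<odot>\<^bsub>A\<^esub> x) = r \<odot>\<^bsub>B\<^esub> f x) \<and>
        (\<forall>n. f ` grade A n \<subseteq> grade B n)}"

definition augmentation ::
  "('r, 'l) ring_scheme \<Rightarrow> ('r, 'a, 'm) graded_alg_scheme \<Rightarrow> 'a \<Rightarrow> 'r" where
  "augmentation R A x =
     the_inv_into (carrier R) (\<lambda>r. r \<odot>\<^bsub>A\<^esub> \<one>\<^bsub>A\<^esub>) (component A x 0)"

definition trivial_map ::
  "('r, 'l) ring_scheme \<Rightarrow> ('r, 'a, 'm) graded_alg_scheme \<Rightarrow> ('r, 'b, 'n) graded_alg_scheme \<Rightarrow>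
   'a \<Rightarrow> 'b" where
  "trivial_map R A B x = augmentation R A x \<odot>\<^bsub>B\<^esub> \<one>\<^bsub>B\<^esub>"

definition span_of ::
  "('r, 'l) ring_scheme \<Rightarrow> ('r, 'a, 'm) module_scheme \<Rightarrow> 'a set \<Rightarrow> 'a set" where
  "span_of R M S = \<Inter>{H. submodule H R M \<and> S \<subseteq> H}"


section \<open>Free products\<close>

text \<open>
  The coproduct of \<open>B\<close> and \<open>C\<close> is presented by generators and relations: formal algebra
  expressions in the elements of \<open>B\<close> and \<open>C\<close>, modulo the smallest congruence which
  makes the expressions an associative unital \<open>R\<close>-algebra and both inclusions homomorphisms of
  unital \<open>R\<close>-algebras. The constants 0 and 1 are represented by those of \<open>B\<close>.
\<close>

datatype ('r, 'b, 'c) fp_term =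
    FLeft 'b
  | FRight 'c
  | FAdd "('r, 'b, 'c) fp_term" "('r, 'b, 'c) fp_term"
  | FMul "('r, 'b, 'c) fp_term" "('r, 'b, 'c) fp_term"
  | FScale 'r "('r, 'b, 'c) fp_term"

inductive_set fp_terms ::
  "('r, 'l) ring_scheme \<Rightarrow> ('r, 'b, 'm) graded_alg_scheme \<Rightarrow> ('r, 'c, 'n) graded_alg_scheme \<Rightarrow>
   ('r, 'b, 'c) fp_term set"
  for R B C where
    "b \<in> carrier B \<Longrightarrow> FLeft b \<in> fp_terms R B C"
  | "c \<in> carrier C \<Longrightarrow> FRight c \<in> fp_terms R B C"
  | "\<lbrakk>s \<in> fp_terms R B C; t \<in> fp_terms R B C\<rbrakk> \<Longrightarrow> FAdd s t \<in> fp_terms R B C"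
  | "\<lbrakk>s \<in> fp_terms R B C; t \<in> fp_terms R B C\<rbrakk> \<Longrightarrow> FMul s t \<in> fp_terms R B C"
  | "\<lbrakk>r \<in> carrier R; t \<in> fp_terms R B C\<rbrakk> \<Longrightarrow> FScale r t \<in> fp_terms R B C"

inductive_set fp_cong ::
  "('r, 'l) ring_scheme \<Rightarrow> ('r, 'b, 'm) graded_alg_scheme \<Rightarrow> ('r, 'c, 'n) graded_alg_scheme \<Rightarrow>
   (('r, 'b, 'c) fp_term \<times> ('r, 'b, 'c) fp_term) set"
  for R B C where
    refl: "t \<in> fp_terms R B C \<Longrightarrow> (t, t) \<in> fp_cong R B C"
  | sym: "(s, t) \<in> fp_cong R B C \<Longrightarrow> (t, s) \<in> fp_cong R B C"
  | trans: "\<lbrakk>(s, t) \<in> fp_cong R B C; (t, u) \<in> fp_cong R B C\<rbrakk> \<Longrightarrow> (s, u) \<in> fp_cong R B C"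
  | cong_add: "\<lbrakk>(s, s') \<in> fp_cong R B C; (t, t') \<in> fp_cong R B C\<rbrakk> \<Longrightarrow>
      (FAdd s t, FAdd s' t') \<in> fp_cong R B C"
  | cong_mul: "\<lbrakk>(s, s') \<in> fp_cong R B C; (t, t') \<in> fp_cong R B C\<rbrakk> \<Longrightarrow>
      (FMul s t, FMul s' t') \<in> fp_cong R B C"
  | cong_scale: "\<lbrakk>r \<in> carrier R; (t, t') \<in> fp_cong R B C\<rbrakk> \<Longrightarrow>
      (FScale r t, FScale r t') \<in> fp_cong R B C"
  | add_assoc: "\<lbrakk>s \<in> fp_terms R B C; t \<in> fp_terms R B C; u \<in> fp_terms R B C\<rbrakk> \<Longrightarrow>
      (FAdd (FAdd s t) u, FAdd s (FAdd t u)) \<in> fp_cong R B C"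
  | add_comm: "\<lbrakk>s \<in> fp_terms R B C; t \<in> fp_terms R B C\<rbrakk> \<Longrightarrow>
      (FAdd s t, FAdd t s) \<in> fp_cong R B C"
  | add_zero: "t \<in> fp_terms R B C \<Longrightarrow> (FAdd (FLeft \<zero>\<^bsub>B\<^esub>) t, t) \<in> fp_cong R B C"
  | add_neg: "t \<in> fp_terms R B C \<Longrightarrow>
      (FAdd (FScale (\<ominus>\<^bsub>R\<^esub> \<one>\<^bsub>R\<^esub>) t) t, FLeft \<zero>\<^bsub>B\<^esub>) \<in> fp_cong R B C"
  | scale_add_left: "\<lbrakk>r \<in> carrier R; r' \<in> carrier R; t \<in> fp_terms R B C\<rbrakk> \<Longrightarrow>
      (FScale (r \<oplus>\<^bsub>R\<^esub> r') t, FAdd (FScale r t) (FScale r' t)) \<in> fp_cong R B C"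
  | scale_add_right: "\<lbrakk>r \<in> carrier R; s \<in> fp_terms R B C; t \<in> fp_terms R B C\<rbrakk> \<Longrightarrow>
      (FScale r (FAdd s t), FAdd (FScale r s) (FScale r t)) \<in> fp_cong R B C"
  | scale_scale: "\<lbrakk>r \<in> carrier R; r' \<in> carrier R; t \<in> fp_terms R B C\<rbrakk> \<Longrightarrow>
      (FScale (r \<otimes>\<^bsub>R\<^esub> r') t, FScale r (FScale r' t)) \<in> fp_cong R B C"
  | scale_one: "t \<in> fp_terms R B C \<Longrightarrow> (FScale \<one>\<^bsub>R\<^esub> t, t) \<in> fp_cong R B C"
  | mul_assoc: "\<lbrakk>s \<in> fp_terms R B C; t \<in> fp_terms R B C; u \<in> fp_terms R B C\<rbrakk> \<Longrightarrow>
      (FMul (FMul s t) u, FMul s (FMul t u)) \<in> fp_cong R B C"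
  | mul_one_left: "t \<in> fp_terms R B C \<Longrightarrow> (FMul (FLeft \<one>\<^bsub>B\<^esub>) t, t) \<in> fp_cong R B C"
  | mul_one_right: "t \<in> fp_terms R B C \<Longrightarrow> (FMul t (FLeft \<one>\<^bsub>B\<^esub>), t) \<in> fp_cong R B C"
  | mul_add_left: "\<lbrakk>s \<in> fp_terms R B C; t \<in> fp_terms R B C; u \<in> fp_terms R B C\<rbrakk> \<Longrightarrow>
      (FMul (FAdd s t) u, FAdd (FMul s u) (FMul t u)) \<in> fp_cong R B C"
  | mul_add_right: "\<lbrakk>s \<in> fp_terms R B C; t \<in> fp_terms R B C; u \<in> fp_terms R B C\<rbrakk> \<Longrightarrow>
      (FMul s (FAdd t u), FAdd (FMul s t) (FMul s u)) \<in> fp_cong R B C"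
  | mul_scale_left: "\<lbrakk>r \<in> carrier R; s \<in> fp_terms R B C; t \<in> fp_terms R B C\<rbrakk> \<Longrightarrow>
      (FMul (FScale r s) t, FScale r (FMul s t)) \<in> fp_cong R B C"
  | mul_scale_right: "\<lbrakk>r \<in> carrier R; s \<in> fp_terms R B C; t \<in> fp_terms R B C\<rbrakk> \<Longrightarrow>
      (FMul s (FScale r t), FScale r (FMul s t)) \<in> fp_cong R B C"
  | left_add: "\<lbrakk>x \<in> carrier B; y \<in> carrier B\<rbrakk> \<Longrightarrow>
      (FLeft (x \<oplus>\<^bsub>B\<^esub> y), FAdd (FLeft x) (FLeft y)) \<in> fp_cong R B C"
  | left_mul: "\<lbrakk>x \<in> carrier B; y \<in> carrier B\<rbrakk> \<Longrightarrow>
      (FLeft (x \<otimes>\<^bsub>B\<^esub> y), FMul (FLeft x) (FLeft y)) \<in> fp_cong R B C"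
  | left_scale: "\<lbrakk>r \<in> carrier R; x \<in> carrier B\<rbrakk> \<Longrightarrow>
      (FLeft (r \<odot>\<^bsub>B\<^esub> x), FScale r (FLeft x)) \<in> fp_cong R B C"
  | right_add: "\<lbrakk>x \<in> carrier C; y \<in> carrier C\<rbrakk> \<Longrightarrow>
      (FRight (x \<oplus>\<^bsub>C\<^esub> y), FAdd (FRight x) (FRight y)) \<in> fp_cong R B C"
  | right_mul: "\<lbrakk>x \<in> carrier C; y \<in> carrier C\<rbrakk> \<Longrightarrow>
      (FRight (x \<otimes>\<^bsub>C\<^esub> y), FMul (FRight x) (FRight y)) \<in> fp_cong R B C"
  | right_scale: "\<lbrakk>r \<in> carrier R; x \<in> carrier C\<rbrakk> \<Longrightarrow>
      (FRight (r \<odot>\<^bsub>C\<^esub> x), FScale r (FRight x)) \<in> fp_cong R B C"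
  | right_one: "(FRight \<one>\<^bsub>C\<^esub>, FLeft \<one>\<^bsub>B\<^esub>) \<in> fp_cong R B C"

text \<open>Expressions all of whose monomials have total degree \<open>n\<close>.\<close>

inductive fp_homogeneous ::
  "('r, 'l) ring_scheme \<Rightarrow> ('r, 'b, 'm) graded_alg_scheme \<Rightarrow> ('r, 'c, 'n) graded_alg_scheme \<Rightarrow>
   nat \<Rightarrow> ('r, 'b, 'c) fp_term \<Rightarrow> bool"
  for R B C where
    "b \<in> grade B n \<Longrightarrow> fp_homogeneous R B C n (FLeft b)"
  | "c \<in> grade C n \<Longrightarrow> fp_homogeneous R B C n (FRight c)"
  | "\<lbrakk>fp_homogeneous R B C n s; fp_homogeneous R B C n t\<rbrakk> \<Longrightarrow>
      fp_homogeneous R B C n (FAdd s t)"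
  | "\<lbrakk>fp_homogeneous R B C m s; fp_homogeneous R B C n t\<rbrakk> \<Longrightarrow>
      fp_homogeneous R B C (m + n) (FMul s t)"
  | "\<lbrakk>r \<in> carrier R; fp_homogeneous R B C n t\<rbrakk> \<Longrightarrow> fp_homogeneous R B C n (FScale r t)"

definition free_product ::
  "('r, 'l) ring_scheme \<Rightarrow> ('r, 'b, 'm) graded_alg_scheme \<Rightarrow> ('r, 'c, 'n) graded_alg_scheme \<Rightarrow>
   ('r, ('r, 'b, 'c) fp_term set) graded_alg" where
  "free_product R B C =
     \<lparr>carrier = fp_terms R B C // fp_cong R B C,
      mult = (\<lambda>X Y. \<Union>s\<in>X. \<Union>t\<in>Y. fp_cong R B C `` {FMul s t}),
      one = fp_cong R B C `` {FLeft \<one>\<^bsub>B\<^esub>},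
      zero = fp_cong R B C `` {FLeft \<zero>\<^bsub>B\<^esub>},
      add = (\<lambda>X Y. \<Union>s\<in>X. \<Union>t\<in>Y. fp_cong R B C `` {FAdd s t}),
      smult = (\<lambda>r X. \<Union>t\<in>X. fp_cong R B C `` {FScale r t}),
      grade = (\<lambda>n. {fp_cong R B C `` {t} |t. fp_homogeneous R B C n t})\<rparr>"

definition fp_left ::
  "('r, 'l) ring_scheme \<Rightarrow> ('r, 'b, 'm) graded_alg_scheme \<Rightarrow> ('r, 'c, 'n) graded_alg_scheme \<Rightarrow>
   'b \<Rightarrow> ('r, 'b, 'c) fp_term set" where
  "fp_left R B C b = fp_cong R B C `` {FLeft b}"

definition fp_right ::
  "('r, 'l) ring_scheme \<Rightarrow> ('r, 'b, 'm) graded_alg_scheme \<Rightarrow> ('r, 'c, 'n) graded_alg_scheme \<Rightarrow>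
   'c \<Rightarrow> ('r, 'b, 'c) fp_term set" where
  "fp_right R B C c = fp_cong R B C `` {FRight c}"

primrec fp_eval ::
  "('r, 'd, 'k) module_scheme \<Rightarrow> ('b \<Rightarrow> 'd) \<Rightarrow> ('c \<Rightarrow> 'd) \<Rightarrow> ('r, 'b, 'c) fp_term \<Rightarrow> 'd" where
    "fp_eval D f g (FLeft b) = f b"
  | "fp_eval D f g (FRight c) = g c"
  | "fp_eval D f g (FAdd s t) = fp_eval D f g s \<oplus>\<^bsub>D\<^esub> fp_eval D f g t"
  | "fp_eval D f g (FMul s t) = fp_eval D f g s \<otimes>\<^bsub>D\<^esub> fp_eval D f g t"
  | "fp_eval D f g (FScale r t) = r \<odot>\<^bsub>D\<^esub> fp_eval D f g t"

text \<open>
  The morphism \<open>(f, g)\<close> out of the free product with components \<open>f\<close> and \<open>g\<close>. If these are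
  homomorphisms of unital algebras, the value does not depend on the representative.
\<close>

definition copair ::
  "('r, 'd, 'k) module_scheme \<Rightarrow> ('b \<Rightarrow> 'd) \<Rightarrow> ('c \<Rightarrow> 'd) \<Rightarrow>
   ('r, 'b, 'c) fp_term set \<Rightarrow> 'd" where
  "copair D f g X = fp_eval D f g (SOME t. t \<in> X)"

text \<open>The map induced by \<open>f\<close> and \<open>g\<close> into the free product of \<open>D\<close> and \<open>E\<close>.\<close>

definition fp_map ::
  "('r, 'l) ring_scheme \<Rightarrow> ('r, 'd, 'm) graded_alg_scheme \<Rightarrow> ('r, 'e, 'n) graded_alg_scheme \<Rightarrow>
   ('b \<Rightarrow> 'd) \<Rightarrow> ('c \<Rightarrow> 'e) \<Rightarrow> ('r, 'b, 'c) fp_term set \<Rightarrow> ('r, 'd, 'e) fp_term set" where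
  "fp_map R D E f g =
     copair (free_product R D E) (fp_left R D E \<circ> f) (fp_right R D E \<circ> g)"

definition fp_assoc ::
  "('r, 'l) ring_scheme \<Rightarrow> ('r, 'b, 'm) graded_alg_scheme \<Rightarrow> ('r, 'c, 'n) graded_alg_scheme \<Rightarrow>
   ('r, 'd, 'k) graded_alg_scheme \<Rightarrow>
   ('r, ('r, 'b, 'c) fp_term set, 'd) fp_term set \<Rightarrow>
   ('r, 'b, ('r, 'c, 'd) fp_term set) fp_term set" where
  "fp_assoc R B C D =
     (let CD = free_product R C D; BCD = free_product R B CD
      in copair BCD
           (copair BCD (fp_left R B CD) (fp_right R B CD \<circ> fp_left R C D))
           (fp_right R B CD \<circ> fp_right R C D))"


section \<open>Comonoids and cogroups\<close>

definition comonoid ::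
  "('r, 'l) ring_scheme \<Rightarrow> ('r, 'a, 'm) graded_alg_scheme \<Rightarrow>
   ('a \<Rightarrow> ('r, 'a, 'a) fp_term set) \<Rightarrow> bool" where
  "comonoid R A \<Phi> \<longleftrightarrow>
     connected_graded_algebra R A \<and>
     \<Phi> \<in> alg_hom R A (free_product R A A) \<and>
     (\<forall>x \<in> carrier A.
        fp_assoc R A A A (fp_map R (free_product R A A) A \<Phi> id (\<Phi> x)) =
        fp_map R A (free_product R A A) id \<Phi> (\<Phi> x)) \<and>
     (\<forall>x \<in> carrier A. copair A id (trivial_map R A A) (\<Phi> x) = x) \<and>
     (\<forall>x \<in> carrier A. copair A (trivial_map R A A) id (\<Phi> x) = x)"

definition comonoid_inverse ::
  "('r, 'l) ring_scheme \<Rightarrow> ('r, 'a, 'm) graded_alg_scheme \<Rightarrow>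
   ('a \<Rightarrow> ('r, 'a, 'a) fp_term set) \<Rightarrow> ('a \<Rightarrow> 'a) \<Rightarrow> bool" where
  "comonoid_inverse R A \<Phi> \<nu> \<longleftrightarrow>
     \<nu> \<in> alg_hom R A A \<and>
     (\<forall>x \<in> carrier A. copair A id \<nu> (\<Phi> x) = trivial_map R A A x) \<and>
     (\<forall>x \<in> carrier A. copair A \<nu> id (\<Phi> x) = trivial_map R A A x)"

definition cogroup ::
  "('r, 'l) ring_scheme \<Rightarrow> ('r, 'a, 'm) graded_alg_scheme \<Rightarrow>
   ('a \<Rightarrow> ('r, 'a, 'a) fp_term set) \<Rightarrow> bool" where
  "cogroup R A \<Phi> \<longleftrightarrow> comonoid R A \<Phi> \<and> (\<exists>\<nu>. comonoid_inverse R A \<Phi> \<nu>)"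

definition berstein_subcoalgebra ::
  "('r, 'l) ring_scheme \<Rightarrow> ('r, 'a, 'm) graded_alg_scheme \<Rightarrow>
   ('a \<Rightarrow> ('r, 'a, 'a) fp_term set) \<Rightarrow> 'a set" where
  "berstein_subcoalgebra R A \<Phi> =
     {x \<in> carrier A.
        \<Phi> x \<in> span_of R (free_product R A A)
          {fp_left R A A a \<otimes>\<^bsub>free_product R A A\<^esub> fp_right R A A b |a b.
             a \<in> carrier A \<and> b \<in> carrier A}}"


section \<open>Tensor products\<close>

text \<open>Formal nonempty sums of pure tensors, modulo the relations of the tensor product over \<open>R\<close>.\<close>

datatype ('b, 'c) tensor_term =
    TPure 'b 'c
  | TAdd "('b, 'c) tensor_term" "('b, 'c) tensor_term"

inductive_set tensor_terms ::
  "('r, 'b, 'm) module_scheme \<Rightarrow> ('r, 'c, 'n) module_scheme \<Rightarrow> ('b, 'c) tensor_term set"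
  for B C where
    "\<lbrakk>b \<in> carrier B; c \<in> carrier C\<rbrakk> \<Longrightarrow> TPure b c \<in> tensor_terms B C"
  | "\<lbrakk>s \<in> tensor_terms B C; t \<in> tensor_terms B C\<rbrakk> \<Longrightarrow> TAdd s t \<in> tensor_terms B C"

inductive_set tensor_cong ::
  "('r, 'l) ring_scheme \<Rightarrow> ('r, 'b, 'm) module_scheme \<Rightarrow> ('r, 'c, 'n) module_scheme \<Rightarrow>
   (('b, 'c) tensor_term \<times> ('b, 'c) tensor_term) set"
  for R B C where
    refl: "t \<in> tensor_terms B C \<Longrightarrow> (t, t) \<in> tensor_cong R B C"
  | sym: "(s, t) \<in> tensor_cong R B C \<Longrightarrow> (t, s) \<in> tensor_cong R B C"
  | trans: "\<lbrakk>(s, t) \<in> tensor_cong R B C; (t, u) \<in> tensor_cong R B C\<rbrakk> \<Longrightarrow>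
      (s, u) \<in> tensor_cong R B C"
  | cong_add: "\<lbrakk>(s, s') \<in> tensor_cong R B C; (t, t') \<in> tensor_cong R B C\<rbrakk> \<Longrightarrow>
      (TAdd s t, TAdd s' t') \<in> tensor_cong R B C"
  | add_assoc: "\<lbrakk>s \<in> tensor_terms B C; t \<in> tensor_terms B C; u \<in> tensor_terms B C\<rbrakk> \<Longrightarrow>
      (TAdd (TAdd s t) u, TAdd s (TAdd t u)) \<in> tensor_cong R B C"
  | add_comm: "\<lbrakk>s \<in> tensor_terms B C; t \<in> tensor_terms B C\<rbrakk> \<Longrightarrow>
      (TAdd s t, TAdd t s) \<in> tensor_cong R B C"
  | add_zero: "t \<in> tensor_terms B C \<Longrightarrow>
      (TAdd (TPure \<zero>\<^bsub>B\<^esub> \<zero>\<^bsub>C\<^esub>) t, t) \<in> tensor_cong R B C"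
  | pure_add_left: "\<lbrakk>b \<in> carrier B; b' \<in> carrier B; c \<in> carrier C\<rbrakk> \<Longrightarrow>
      (TPure (b \<oplus>\<^bsub>B\<^esub> b') c, TAdd (TPure b c) (TPure b' c)) \<in> tensor_cong R B C"
  | pure_add_right: "\<lbrakk>b \<in> carrier B; c \<in> carrier C; c' \<in> carrier C\<rbrakk> \<Longrightarrow>
      (TPure b (c \<oplus>\<^bsub>C\<^esub> c'), TAdd (TPure b c) (TPure b c')) \<in> tensor_cong R B C"
  | pure_scale: "\<lbrakk>r \<in> carrier R; b \<in> carrier B; c \<in> carrier C\<rbrakk> \<Longrightarrow>
      (TPure (r \<odot>\<^bsub>B\<^esub> b) c, TPure b (r \<odot>\<^bsub>C\<^esub> c)) \<in> tensor_cong R B C"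

inductive tensor_homogeneous ::
  "('r, 'b, 'm) graded_alg_scheme \<Rightarrow> ('r, 'c, 'n) graded_alg_scheme \<Rightarrow>
   nat \<Rightarrow> ('b, 'c) tensor_term \<Rightarrow> bool"
  for B C where
    "\<lbrakk>b \<in> grade B i; c \<in> grade C j\<rbrakk> \<Longrightarrow> tensor_homogeneous B C (i + j) (TPure b c)"
  | "\<lbrakk>tensor_homogeneous B C n s; tensor_homogeneous B C n t\<rbrakk> \<Longrightarrow>
      tensor_homogeneous B C n (TAdd s t)"

text \<open>The graded module; its multiplication and unit are supplied below.\<close>

definition tensor_module ::
  "('r, 'l) ring_scheme \<Rightarrow> ('r, 'b, 'm) graded_alg_scheme \<Rightarrow> ('r, 'c, 'n) graded_alg_scheme \<Rightarrow>
   ('r, ('b, 'c) tensor_term set) graded_alg" where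
  "tensor_module R B C =
     \<lparr>carrier = tensor_terms B C // tensor_cong R B C,
      mult = undefined,
      one = undefined,
      zero = tensor_cong R B C `` {TPure \<zero>\<^bsub>B\<^esub> \<zero>\<^bsub>C\<^esub>},
      add = (\<lambda>X Y. \<Union>s\<in>X. \<Union>t\<in>Y. tensor_cong R B C `` {TAdd s t}),
      smult = (\<lambda>r X. \<Union>t\<in>X. tensor_cong R B C `` {map_tensor_term (\<lambda>b. r \<odot>\<^bsub>B\<^esub> b) id t}),
      grade = (\<lambda>n. {tensor_cong R B C `` {t} |t. tensor_homogeneous B C n t})\<rparr>"

definition pure_tensor ::
  "('r, 'l) ring_scheme \<Rightarrow> ('r, 'b, 'm) graded_alg_scheme \<Rightarrow> ('r, 'c, 'n) graded_alg_scheme \<Rightarrow>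
   'b \<Rightarrow> 'c \<Rightarrow> ('b, 'c) tensor_term set" where
  "pure_tensor R B C b c = tensor_cong R B C `` {TPure b c}"

primrec tensor_eval ::
  "('d, 'k) ring_scheme \<Rightarrow> ('b \<Rightarrow> 'c \<Rightarrow> 'd) \<Rightarrow> ('b, 'c) tensor_term \<Rightarrow> 'd" where
    "tensor_eval M f (TPure b c) = f b c"
  | "tensor_eval M f (TAdd s t) = tensor_eval M f s \<oplus>\<^bsub>M\<^esub> tensor_eval M f t"

text \<open>
  The linear map induced by a bilinear map \<open>f\<close> into \<open>M\<close>; for such \<open>f\<close> the value does not
  depend on the representative.
\<close>

definition tensor_lift ::
  "('d, 'k) ring_scheme \<Rightarrow> ('b \<Rightarrow> 'c \<Rightarrow> 'd) \<Rightarrow> ('b, 'c) tensor_term set \<Rightarrow> 'd" where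
  "tensor_lift M f X = tensor_eval M f (SOME t. t \<in> X)"

text \<open>
  The product of two pure tensors \<open>b \<otimes> c\<close> and \<open>b' \<otimes> c'\<close>: the sum over all \<open>i\<close> and
  \<open>j\<close> of \<open>(-1)\<^bsup>ij\<^esup> b b'\<^sub>j \<otimes> c\<^sub>i c'\<close>, where \<open>c\<^sub>i\<close> and \<open>b'\<^sub>j\<close> are the homogeneous
  components.
\<close>

definition pure_tensor_mult ::
  "('r, 'l) ring_scheme \<Rightarrow> ('r, 'b, 'm) graded_alg_scheme \<Rightarrow> ('r, 'c, 'n) graded_alg_scheme \<Rightarrow>
   'b \<Rightarrow> 'c \<Rightarrow> 'b \<Rightarrow> 'c \<Rightarrow> ('b, 'c) tensor_term set" where
  "pure_tensor_mult R B C b c b' c' =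
     finsum (tensor_module R B C)
       (\<lambda>(i, j). ((\<ominus>\<^bsub>R\<^esub> \<one>\<^bsub>R\<^esub>) [^]\<^bsub>R\<^esub> (i * j)) \<odot>\<^bsub>tensor_module R B C\<^esub>
          pure_tensor R B C (b \<otimes>\<^bsub>B\<^esub> component B b' j) (component C c i \<otimes>\<^bsub>C\<^esub> c'))
       ({i. component C c i \<noteq> \<zero>\<^bsub>C\<^esub>} \<times> {j. component B b' j \<noteq> \<zero>\<^bsub>B\<^esub>})"

definition tensor_product ::
  "('r, 'l) ring_scheme \<Rightarrow> ('r, 'b, 'm) graded_alg_scheme \<Rightarrow> ('r, 'c, 'n) graded_alg_scheme \<Rightarrow>
   ('r, ('b, 'c) tensor_term set) graded_alg" where
  "tensor_product R B C =
     (tensor_module R B C)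
       \<lparr>mult := (\<lambda>X Y.
          tensor_lift (tensor_module R B C)
            (\<lambda>b c. tensor_lift (tensor_module R B C) (pure_tensor_mult R B C b c) Y) X),
        one := pure_tensor R B C \<one>\<^bsub>B\<^esub> \<one>\<^bsub>C\<^esub>\<rparr>"

definition tensor_map ::
  "('r, 'l) ring_scheme \<Rightarrow> ('r, 'd, 'm) graded_alg_scheme \<Rightarrow> ('r, 'e, 'n) graded_alg_scheme \<Rightarrow>
   ('b \<Rightarrow> 'd) \<Rightarrow> ('c \<Rightarrow> 'e) \<Rightarrow> ('b, 'c) tensor_term set \<Rightarrow> ('d, 'e) tensor_term set" where
  "tensor_map R D E f g =
     tensor_lift (tensor_product R D E) (\<lambda>b c. pure_tensor R D E (f b) (g c))"


section \<open>The underlying Hopf algebra and its antipode\<close>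

definition hopf_coproduct ::
  "('r, 'l) ring_scheme \<Rightarrow> ('r, 'a, 'm) graded_alg_scheme \<Rightarrow>
   ('a \<Rightarrow> ('r, 'a, 'a) fp_term set) \<Rightarrow> 'a \<Rightarrow> ('a, 'a) tensor_term set" where
  "hopf_coproduct R A \<Phi> =
     copair (tensor_product R A A)
       (\<lambda>a. pure_tensor R A A a \<one>\<^bsub>A\<^esub>) (\<lambda>a. pure_tensor R A A \<one>\<^bsub>A\<^esub> a) \<circ> \<Phi>"

text \<open>
  The convolution monoid of degree-preserving linear maps which are the identity in degree 0.
  Its elements are extensional functions, so that inverses in it are unique as HOL functions.
  The neutral element is the composite of the counit and the unit of \<open>A\<close>.
\<close>

definition convolution_monoid ::
  "('r, 'l) ring_scheme \<Rightarrow> ('r, 'a, 'm) graded_alg_scheme \<Rightarrow>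
   ('a \<Rightarrow> ('r, 'a, 'a) fp_term set) \<Rightarrow> ('a \<Rightarrow> 'a) monoid" where
  "convolution_monoid R A \<Phi> =
     \<lparr>carrier =
        {f \<in> carrier A \<rightarrow>\<^sub>E carrier A.
           (\<forall>x \<in> carrier A. \<forall>y \<in> carrier A. f (x \<oplus>\<^bsub>A\<^esub> y) = f x \<oplus>\<^bsub>A\<^esub> f y) \<and>
           (\<forall>r \<in> carrier R. \<forall>x \<in> carrier A. f (r \<odot>\<^bsub>A\<^esub> x) = r \<odot>\<^bsub>A\<^esub> f x) \<and>
           (\<forall>n. f ` grade A n \<subseteq> grade A n) \<and>
           (\<forall>x \<in> grade A 0. f x = x)},
      mult = (\<lambda>f g. \<lambda>x \<in> carrier A.
        tensor_lift A (\<lambda>a b. a \<otimes>\<^bsub>A\<^esub> b) (tensor_map R A A f g (hopf_coproduct R A \<Phi> x))),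
      one = (\<lambda>x \<in> carrier A. trivial_map R A A x)\<rparr>"

definition antipode ::
  "('r, 'l) ring_scheme \<Rightarrow> ('r, 'a, 'm) graded_alg_scheme \<Rightarrow>
   ('a \<Rightarrow> ('r, 'a, 'a) fp_term set) \<Rightarrow> 'a \<Rightarrow> 'a" where
  "antipode R A \<Phi> = inv\<^bsub>convolution_monoid R A \<Phi>\<^esub> (\<lambda>x \<in> carrier A. x)"

end

theory Submission
  imports Defs
begin

text \<open>
  Write \<open>\<eta>\<close> for the trivial map, \<open>\<epsilon>\<close> for the augmentation, \<open>\<Delta>\<close> for the coproduct of the
  underlying Hopf algebra, \<open>\<chi>\<close> for its antipode and \<open>\<star>\<close> for convolution. If
  \<open>\<Phi> x = \<Sum> a' b''\<close>, then \<open>\<Delta> x = \<Sum> a \<otimes> b\<close>, and evaluating the defining property of \<open>\<nu>\<close> on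
  such an \<open>x\<close> gives \<open>\<Sum> a \<nu>(b) = \<epsilon>(x) 1\<close>, which is a convolution identity. But
  this identity is known only for such \<open>x\<close>, whereas comparing \<open>\<nu>\<close> with \<open>\<chi>\<close> by cancellation would
  require it for the factors \<open>b\<close> as well.

  The key is an identity in \<open>A \<otimes> A\<close> that holds for every \<open>x\<close>. Coassociativity of \<open>\<Phi>\<close> says that
  the two iterated coproducts of \<open>x\<close> agree in \<open>A * A * A\<close>; apply to them the morphism into
  \<open>A \<otimes> A\<close> with components \<open>a \<otimes> 1\<close>, \<open>1 \<otimes> a\<close> and \<open>1 \<otimes> \<nu> a\<close>. On one side the last two components
  combine to \<open>\<epsilon>(a) (1 \<otimes> 1)\<close>, because \<open>\<nu>\<close> is an inverse, and the counit leaves \<open>x \<otimes> 1\<close>. On the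
  other side the first two components combine to \<open>\<Delta>\<close>. Hence the morphism out of \<open>A * A\<close> with
  components \<open>\<Delta> a\<close> and \<open>1 \<otimes> \<nu> a\<close> sends \<open>\<Phi> x\<close> to \<open>x \<otimes> 1\<close>
  (\<open>cogroup_inverse_coproduct\<close>).

  If now \<open>\<Phi> x = \<Sum> a' b''\<close>, this reads \<open>\<Sum> \<Delta>(a) (1 \<otimes> \<nu> b) = x \<otimes> 1\<close>. The linear map
  \<open>a \<otimes> b \<mapsto> \<chi>(a) b\<close> turns the right side into \<open>\<chi>(x)\<close> and the left side into
  \<open>\<Sum> (\<chi> \<star> id)(a) \<nu>(b) = \<Sum> \<epsilon>(a) \<nu>(b)\<close>, which is \<open>\<nu>(x)\<close> by the counit
  (\<open>inverse_eq_antipode\<close>).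

  The remaining work makes these evaluations legitimate. Morphisms out of a free product are well
  defined when the target is an associative unital algebra, so \<open>A \<otimes> A\<close> with the sign rule must be
  shown to be one (\<open>tensor_product_graded_algebra\<close>). That \<open>\<chi>\<close> inverts the identity requires the
  convolution monoid to be a group (\<open>convolution_group\<close>). Its associativity comes from evaluating
  the coassociativity of \<open>\<Phi>\<close> in \<open>(A \<otimes> A) \<otimes> A\<close> (\<open>convolution_assoc\<close>), and its inverses are
  constructed degree by degree (\<open>convolution_left_inverse\<close>).
\<close>


section \<open>Linear maps and unital algebras\<close>

definition linear_maps ::
  "('r, 'l) ring_scheme \<Rightarrow> ('r, 'a, 'm) module_scheme \<Rightarrow> ('r, 'b, 'n) module_scheme \<Rightarrow>
   ('a \<Rightarrow> 'b) set" where
  "linear_maps R M N =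
     {f \<in> carrier M \<rightarrow> carrier N.
        (\<forall>x \<in> carrier M. \<forall>y \<in> carrier M. f (x \<oplus>\<^bsub>M\<^esub> y) = f x \<oplus>\<^bsub>N\<^esub> f y) \<and>
        (\<forall>r \<in> carrier R. \<forall>x \<in> carrier M. f (r \<odot>\<^bsub>M\<^esub> x) = r \<odot>\<^bsub>N\<^esub> f x)}"

definition bilinear_maps ::
  "('r, 'l) ring_scheme \<Rightarrow> ('r, 'a, 'm) module_scheme \<Rightarrow> ('r, 'b, 'n) module_scheme \<Rightarrow>
   ('r, 'c, 'k) module_scheme \<Rightarrow> ('a \<Rightarrow> 'b \<Rightarrow> 'c) set" where
  "bilinear_maps R M N P =
     {f. (\<forall>x \<in> carrier M. f x \<in> linear_maps R N P) \<and>
         (\<forall>y \<in> carrier N. (\<lambda>x. f x y) \<in> linear_maps R M P)}"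

text \<open>
  Targets of morphisms out of a free product: associative unital algebras, without a grading. Free
  products themselves enter only as such algebras, together with their sets of homogeneous classes.
\<close>

locale unital_algebra = module R A + ring A
  for R :: "('r, 'l) ring_scheme" and A :: "('r, 'a, 'm) module_scheme" +
  assumes smult_mult_left:
      "\<lbrakk>r \<in> carrier R; x \<in> carrier A; y \<in> carrier A\<rbrakk> \<Longrightarrow>
        (r \<odot>\<^bsub>A\<^esub> x) \<otimes>\<^bsub>A\<^esub> y = r \<odot>\<^bsub>A\<^esub> (x \<otimes>\<^bsub>A\<^esub> y)"
    and smult_mult_right:
      "\<lbrakk>r \<in> carrier R; x \<in> carrier A; y \<in> carrier A\<rbrakk> \<Longrightarrow>
        x \<otimes>\<^bsub>A\<^esub> (r \<odot>\<^bsub>A\<^esub> y) = r \<odot>\<^bsub>A\<^esub> (x \<otimes>\<^bsub>A\<^esub> y)"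

definition unital_homs ::
  "('r, 'l) ring_scheme \<Rightarrow> ('r, 'a, 'm) module_scheme \<Rightarrow> ('r, 'b, 'n) module_scheme \<Rightarrow>
   ('a \<Rightarrow> 'b) set" where
  "unital_homs R A B =
     {f \<in> linear_maps R A B.
        (\<forall>x \<in> carrier A. \<forall>y \<in> carrier A. f (x \<otimes>\<^bsub>A\<^esub> y) = f x \<otimes>\<^bsub>B\<^esub> f y) \<and>
        f \<one>\<^bsub>A\<^esub> = \<one>\<^bsub>B\<^esub>}"

lemma linear_mapsI:
  assumes "\<And>x. x \<in> carrier M \<Longrightarrow> f x \<in> carrier N"
    and "\<And>x y. \<lbrakk>x \<in> carrier M; y \<in> carrier M\<rbrakk> \<Longrightarrow> f (x \<oplus>\<^bsub>M\<^esub> y) = f x \<oplus>\<^bsub>N\<^esub> f y"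
    and "\<And>r x. \<lbrakk>r \<in> carrier R; x \<in> carrier M\<rbrakk> \<Longrightarrow> f (r \<odot>\<^bsub>M\<^esub> x) = r \<odot>\<^bsub>N\<^esub> f x"
  shows "f \<in> linear_maps R M N"
  using assms by (auto simp: linear_maps_def)

lemma linear_mapsD:
  assumes "f \<in> linear_maps R M N"
  shows linear_closed: "x \<in> carrier M \<Longrightarrow> f x \<in> carrier N"
    and linear_add: "\<lbrakk>x \<in> carrier M; y \<in> carrier M\<rbrakk> \<Longrightarrow> f (x \<oplus>\<^bsub>M\<^esub> y) = f x \<oplus>\<^bsub>N\<^esub> f y"
    and linear_smult: "\<lbrakk>r \<in> carrier R; x \<in> carrier M\<rbrakk> \<Longrightarrow> f (r \<odot>\<^bsub>M\<^esub> x) = r \<odot>\<^bsub>N\<^esub> f x"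
  using assms by (auto simp: linear_maps_def)

lemma bilinear_mapsI:
  assumes "\<And>x. x \<in> carrier M \<Longrightarrow> f x \<in> linear_maps R N P"
    and "\<And>y. y \<in> carrier N \<Longrightarrow> (\<lambda>x. f x y) \<in> linear_maps R M P"
  shows "f \<in> bilinear_maps R M N P"
  using assms by (auto simp: bilinear_maps_def)

lemma bilinear_mapsD:
  assumes "f \<in> bilinear_maps R M N P"
  shows bilinear_left: "y \<in> carrier N \<Longrightarrow> (\<lambda>x. f x y) \<in> linear_maps R M P"
    and bilinear_right: "x \<in> carrier M \<Longrightarrow> f x \<in> linear_maps R N P"
  using assms by (auto simp: bilinear_maps_def)

lemma unital_homsD:
  assumes "f \<in> unital_homs R A B"
  shows hom_linear: "f \<in> linear_maps R A B"
    and hom_mult: "\<lbrakk>x \<in> carrier A; y \<in> carrier A\<rbrakk> \<Longrightarrow> f (x \<otimes>\<^bsub>A\<^esub> y) = f x \<otimes>\<^bsub>B\<^esub> f y"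
    and hom_one: "f \<one>\<^bsub>A\<^esub> = \<one>\<^bsub>B\<^esub>"
  using assms by (auto simp: unital_homs_def)

lemma unital_homsI:
  assumes "f \<in> linear_maps R A B"
    and "\<And>x y. \<lbrakk>x \<in> carrier A; y \<in> carrier A\<rbrakk> \<Longrightarrow> f (x \<otimes>\<^bsub>A\<^esub> y) = f x \<otimes>\<^bsub>B\<^esub> f y"
    and "f \<one>\<^bsub>A\<^esub> = \<one>\<^bsub>B\<^esub>"
  shows "f \<in> unital_homs R A B"
  using assms by (auto simp: unital_homs_def)

lemmas hom_closed = linear_closed[OF hom_linear]
lemmas hom_add = linear_add[OF hom_linear]
lemmas hom_smult = linear_smult[OF hom_linear]

lemma linear_zero:
  assumes "module R M" "module R N" "f \<in> linear_maps R M N"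
  shows "f \<zero>\<^bsub>M\<^esub> = \<zero>\<^bsub>N\<^esub>"
proof -
  interpret M: module R M by fact
  interpret N: module R N by fact
  have "f (\<zero>\<^bsub>R\<^esub> \<odot>\<^bsub>M\<^esub> \<zero>\<^bsub>M\<^esub>) = \<zero>\<^bsub>R\<^esub> \<odot>\<^bsub>N\<^esub> f \<zero>\<^bsub>M\<^esub>"
    by (rule linear_smult[OF assms(3)]) auto
  then show ?thesis using linear_closed[OF assms(3), of "\<zero>\<^bsub>M\<^esub>"] by simp
qed

lemma linear_finsum:
  assumes "module R M" "module R N" "f \<in> linear_maps R M N" "finite I" "c \<in> I \<rightarrow> carrier M"
  shows "f (finsum M c I) = finsum N (\<lambda>i. f (c i)) I"
proof -
  interpret M: module R M by fact
  interpret N: module R N by fact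
  show ?thesis using assms(4,5)
  proof (induction I rule: finite_induct)
    case empty
    show ?case using linear_zero[OF assms(1-3)] by simp
  next
    case (insert i I)
    then have c: "c i \<in> carrier M" "c \<in> I \<rightarrow> carrier M" by auto
    have "finsum M c (insert i I) = c i \<oplus>\<^bsub>M\<^esub> finsum M c I"
      using insert c by (intro M.finsum_insert) auto
    moreover have "finsum N (\<lambda>i. f (c i)) (insert i I) = f (c i) \<oplus>\<^bsub>N\<^esub> finsum N (\<lambda>i. f (c i)) I"
      using insert c by (intro N.finsum_insert) (auto intro: linear_closed[OF assms(3)])
    ultimately show ?case
      using insert c by (simp add: linear_add[OF assms(3)])
  qed
qed

lemma linear_comp:
  assumes "f \<in> linear_maps R M N" "g \<in> linear_maps R N P"
  shows "(\<lambda>x. g (f x)) \<in> linear_maps R M P"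
  by (rule linear_mapsI) (simp_all add: linear_mapsD[OF assms(1)] linear_mapsD[OF assms(2)])

lemma linear_plus:
  assumes "module R N" "f \<in> linear_maps R M N" "g \<in> linear_maps R M N"
  shows "(\<lambda>x. f x \<oplus>\<^bsub>N\<^esub> g x) \<in> linear_maps R M N"
proof -
  interpret N: module R N by fact
  note [simp] = linear_mapsD[OF assms(2)] linear_mapsD[OF assms(3)]
  show ?thesis by (rule linear_mapsI) (simp_all add: N.smult_r_distr N.add.m_ac)
qed

lemma linear_scale:
  assumes "module R N" "f \<in> linear_maps R M N" "r \<in> carrier R"
  shows "(\<lambda>x. r \<odot>\<^bsub>N\<^esub> f x) \<in> linear_maps R M N"
proof -
  interpret N: module R N by fact
  note [simp] = linear_mapsD[OF assms(2)] assms(3)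
  show ?thesis
    by (rule linear_mapsI) (simp_all add: N.smult_r_distr N.smult_assoc1[symmetric] N.R.m_comm)
qed

lemma linear_const_zero:
  assumes "module R N"
  shows "(\<lambda>x. \<zero>\<^bsub>N\<^esub>) \<in> linear_maps R M N"
proof -
  interpret N: module R N by fact
  show ?thesis by (rule linear_mapsI) simp_all
qed

lemma linear_sum:
  assumes "module R N" "finite I" "\<And>i. i \<in> I \<Longrightarrow> f i \<in> linear_maps R M N"
  shows "(\<lambda>x. finsum N (\<lambda>i. f i x) I) \<in> linear_maps R M N"
proof -
  interpret N: module R N by fact
  note f = linear_mapsD[OF assms(3)]
  show ?thesis
  proof (rule linear_mapsI)
    fix x assume x: "x \<in> carrier M"
    then show "finsum N (\<lambda>i. f i x) I \<in> carrier N" by (auto intro!: N.finsum_closed f)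
    fix y assume y: "y \<in> carrier M"
    have "finsum N (\<lambda>i. f i (x \<oplus>\<^bsub>M\<^esub> y)) I = finsum N (\<lambda>i. f i x \<oplus>\<^bsub>N\<^esub> f i y) I"
      using x y by (intro N.finsum_cong') (auto simp: f)
    then show "finsum N (\<lambda>i. f i (x \<oplus>\<^bsub>M\<^esub> y)) I =
        finsum N (\<lambda>i. f i x) I \<oplus>\<^bsub>N\<^esub> finsum N (\<lambda>i. f i y) I"
      using x y by (subst (asm) N.finsum_addf) (auto simp: f)
  next
    fix r x assume r: "r \<in> carrier R" and x: "x \<in> carrier M"
    have "finsum N (\<lambda>i. f i (r \<odot>\<^bsub>M\<^esub> x)) I = finsum N (\<lambda>i. r \<odot>\<^bsub>N\<^esub> f i x) I"
      using r x by (intro N.finsum_cong') (auto simp: f)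
    then show "finsum N (\<lambda>i. f i (r \<odot>\<^bsub>M\<^esub> x)) I = r \<odot>\<^bsub>N\<^esub> finsum N (\<lambda>i. f i x) I"
      using r x assms(2) by (subst N.finsum_smult_ldistr) (auto simp: f)
  qed
qed

lemma linear_cong:
  assumes "module R M" "f \<in> linear_maps R M N" "\<And>x. x \<in> carrier M \<Longrightarrow> g x = f x"
  shows "g \<in> linear_maps R M N"
proof -
  interpret M: module R M by fact
  show ?thesis
    by (rule linear_mapsI) (simp_all add: assms(3) linear_mapsD[OF assms(2)])
qed

text \<open>
  Linearity only ever involves finitely many arguments at a time. This serves for maps given by a
  finite sum whose index set depends on the argument, since on a finite set of arguments one index
  set will do.
\<close>

lemma linear_mapsI_local:
  assumes "module R M"
    and "\<And>S. \<lbrakk>finite S; S \<subseteq> carrier M\<rbrakk> \<Longrightarrow> \<exists>g \<in> linear_maps R M N. \<forall>x \<in> S. f x = g x"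
  shows "f \<in> linear_maps R M N"
proof -
  interpret M: module R M by fact
  show ?thesis
  proof (rule linear_mapsI)
    fix x assume x: "x \<in> carrier M"
    then show "f x \<in> carrier N" using assms(2)[of "{x}"] by (auto intro: linear_closed)
    fix y assume y: "y \<in> carrier M"
    then show "f (x \<oplus>\<^bsub>M\<^esub> y) = f x \<oplus>\<^bsub>N\<^esub> f y"
      using x assms(2)[of "{x, y, x \<oplus>\<^bsub>M\<^esub> y}"] by (auto simp: linear_add)
  next
    fix r x assume "r \<in> carrier R" "x \<in> carrier M"
    then show "f (r \<odot>\<^bsub>M\<^esub> x) = r \<odot>\<^bsub>N\<^esub> f x"
      using assms(2)[of "{x, r \<odot>\<^bsub>M\<^esub> x}"] by (auto simp: linear_smult)
  qed
qed

lemma bilinear_comp: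
  assumes "\<beta> \<in> bilinear_maps R M N P" "h \<in> linear_maps R P Q"
  shows "(\<lambda>x y. h (\<beta> x y)) \<in> bilinear_maps R M N Q"
  by (intro bilinear_mapsI linear_comp[OF _ assms(2)] bilinear_left[OF assms(1)]
      bilinear_right[OF assms(1)])

lemma bilinear_precomp:
  assumes "\<beta> \<in> bilinear_maps R M N P" "f \<in> linear_maps R M' M" "g \<in> linear_maps R N' N"
  shows "(\<lambda>x y. \<beta> (f x) (g y)) \<in> bilinear_maps R M' N' P"
  by (intro bilinear_mapsI linear_comp[OF assms(3) bilinear_right[OF assms(1)]]
      linear_comp[OF assms(2) bilinear_left[OF assms(1)]] linear_closed[OF assms(2)]
      linear_closed[OF assms(3)])

text \<open>
  The equalizer of two linear maps is a submodule.
\<close>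

lemma linear_eq_on_span:
  assumes M: "module R M" and N: "module R N"
    and f: "f \<in> linear_maps R M N" and g: "g \<in> linear_maps R M N" and S: "S \<subseteq> carrier M"
    and eq: "\<And>x. x \<in> S \<Longrightarrow> f x = g x" and x: "x \<in> span_of R M S"
  shows "f x = g x"
proof -
  interpret M: module R M by (rule M)
  interpret N: module R N by (rule N)
  have neg: "h (\<ominus>\<^bsub>M\<^esub> y) = \<ominus>\<^bsub>N\<^esub> h y" if h: "h \<in> linear_maps R M N" and y: "y \<in> carrier M" for h y
  proof -
    have "h (\<ominus>\<^bsub>M\<^esub> y) = h ((\<ominus>\<^bsub>R\<^esub> \<one>\<^bsub>R\<^esub>) \<odot>\<^bsub>M\<^esub> y)" using y by (simp add: M.smult_l_minus)
    also have "\<dots> = (\<ominus>\<^bsub>R\<^esub> \<one>\<^bsub>R\<^esub>) \<odot>\<^bsub>N\<^esub> h y" using y by (intro linear_smult[OF h]) simp_all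
    finally show ?thesis using linear_closed[OF h y] by (simp add: N.smult_l_minus)
  qed
  have "submodule {y \<in> carrier M. f y = g y} R M"
    by (rule M.submoduleI) (auto simp: neg[OF f] neg[OF g] linear_zero[OF M N f]
        linear_zero[OF M N g] linear_add[OF f] linear_add[OF g] linear_smult[OF f] linear_smult[OF g])
  then have "span_of R M S \<subseteq> {y \<in> carrier M. f y = g y}"
    unfolding span_of_def using S eq by blast
  then show ?thesis using x by blast
qed

lemma hom_comp:
  assumes "f \<in> unital_homs R A B" "g \<in> unital_homs R B C"
  shows "(\<lambda>x. g (f x)) \<in> unital_homs R A C"
  by (rule unital_homsI)
    (auto intro!: linear_comp[OF hom_linear[OF assms(1)] hom_linear[OF assms(2)]] simp: hom_mult[OF assms(1)] hom_mult[OF assms(2)]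
      hom_closed[OF assms(1)] hom_one[OF assms(1)] hom_one[OF assms(2)])

lemma hom_id: "id \<in> unital_homs R A A"
  by (auto simp: unital_homs_def linear_maps_def)

lemma alg_hom_unital_hom: "f \<in> alg_hom R A B \<Longrightarrow> f \<in> unital_homs R A B"
  by (auto simp: alg_hom_def unital_homs_def linear_maps_def ring_hom_def)

lemma alg_hom_grade: "\<lbrakk>f \<in> alg_hom R A B; x \<in> grade A n\<rbrakk> \<Longrightarrow> f x \<in> grade B n"
  unfolding alg_hom_def by blast

lemma alg_homI:
  assumes "f \<in> unital_homs R A B" "\<And>n x. x \<in> grade A n \<Longrightarrow> f x \<in> grade B n"
  shows "f \<in> alg_hom R A B"
  using assms unfolding alg_hom_def unital_homs_def linear_maps_def ring_hom_def
  by (simp add: image_subset_iff)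

context unital_algebra
begin

lemma module_axiom: "module R A" by unfold_locales

lemma mult_bilinear: "(\<lambda>x y. x \<otimes>\<^bsub>A\<^esub> y) \<in> bilinear_maps R A A A"
  by (intro bilinear_mapsI linear_mapsI)
    (simp_all add: smult_mult_left smult_mult_right ring.ring_simprules[OF ring_axioms])

end

lemma unital_algebra_module: "unital_algebra R A \<Longrightarrow> module R A"
  by (rule unital_algebra.module_axiom)


lemma UN_const_eq:
  assumes "a \<in> S" "\<And>x. x \<in> S \<Longrightarrow> F x = c"
  shows "(\<Union>x\<in>S. F x) = c"
  using assms by fast

section \<open>Free products of algebras\<close>

text \<open>
  Named so that equations between classes are treated as equations, not as inclusions of sets.
\<close>

definition fp_class ::
  "('r, 'l) ring_scheme \<Rightarrow> ('r, 'b, 'm) graded_alg_scheme \<Rightarrow> ('r, 'c, 'n) graded_alg_scheme \<Rightarrow>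
   ('r, 'b, 'c) fp_term \<Rightarrow> ('r, 'b, 'c) fp_term set" where
  "fp_class R B C t = fp_cong R B C `` {t}"

context
  fixes R :: "('r, 'l) ring_scheme"
    and B :: "('r, 'b, 'm) graded_alg_scheme"
    and C :: "('r, 'c, 'n) graded_alg_scheme"
  assumes B: "unital_algebra R B" and C: "unital_algebra R C"
begin

interpretation B: unital_algebra R B by (fact B)
interpretation C: unital_algebra R C by (fact C)

lemma fp_cong_terms: "(s, t) \<in> fp_cong R B C \<Longrightarrow> s \<in> fp_terms R B C \<and> t \<in> fp_terms R B C"
  by (induction rule: fp_cong.induct) (auto intro!: fp_terms.intros)

lemma fp_equiv: "equiv (fp_terms R B C) (fp_cong R B C)"
  by (rule equivI)
    (auto intro!: refl_onI symI transI intro: fp_cong.intros(1-3) dest: fp_cong_terms)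

lemma fp_class_eq: "(s, t) \<in> fp_cong R B C \<Longrightarrow> fp_class R B C s = fp_class R B C t"
  unfolding fp_class_def by (rule equiv_class_eq[OF fp_equiv])

lemma fp_carrier_cases:
  assumes "X \<in> carrier (free_product R B C)"
  obtains t where "t \<in> fp_terms R B C" "X = fp_class R B C t"
  using assms by (auto simp: free_product_def fp_class_def elim: quotientE)

lemma fp_class_closed:
  "t \<in> fp_terms R B C \<Longrightarrow> fp_class R B C t \<in> carrier (free_product R B C)"
  by (simp add: free_product_def fp_class_def quotientI)

lemma fp_class_self: "t \<in> fp_terms R B C \<Longrightarrow> t \<in> fp_class R B C t"
  by (simp add: fp_class_def fp_cong.refl)

lemma fp_class_memD: "s \<in> fp_class R B C t \<Longrightarrow> (t, s) \<in> fp_cong R B C"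
  by (simp add: fp_class_def)

lemma fp_class_add:
  assumes "s \<in> fp_terms R B C" "t \<in> fp_terms R B C"
  shows "fp_class R B C s \<oplus>\<^bsub>free_product R B C\<^esub> fp_class R B C t =
    fp_class R B C (FAdd s t)"
  unfolding free_product_def ring.simps fp_class_def[symmetric]
  by (rule UN_const_eq[of s], use assms fp_class_self in simp, rule UN_const_eq[of t],
      use assms fp_class_self in simp, rule fp_class_eq[symmetric],
      rule fp_cong.cong_add) (erule fp_class_memD)+

lemma fp_class_mult:
  assumes "s \<in> fp_terms R B C" "t \<in> fp_terms R B C"
  shows "fp_class R B C s \<otimes>\<^bsub>free_product R B C\<^esub> fp_class R B C t =
    fp_class R B C (FMul s t)"
  unfolding free_product_def monoid.simps fp_class_def[symmetric]
  by (rule UN_const_eq[of s], use assms fp_class_self in simp, rule UN_const_eq[of t],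
      use assms fp_class_self in simp, rule fp_class_eq[symmetric],
      rule fp_cong.cong_mul) (erule fp_class_memD)+

lemma fp_class_smult:
  assumes "r \<in> carrier R" "t \<in> fp_terms R B C"
  shows "r \<odot>\<^bsub>free_product R B C\<^esub> fp_class R B C t = fp_class R B C (FScale r t)"
  unfolding free_product_def module.simps fp_class_def[symmetric]
  by (rule UN_const_eq[of t], use assms fp_class_self in simp, rule fp_class_eq[symmetric],
      rule fp_cong.cong_scale) (use assms fp_class_memD in simp_all)

lemma fp_class_zero: "\<zero>\<^bsub>free_product R B C\<^esub> = fp_class R B C (FLeft \<zero>\<^bsub>B\<^esub>)"
  and fp_class_one: "\<one>\<^bsub>free_product R B C\<^esub> = fp_class R B C (FLeft \<one>\<^bsub>B\<^esub>)"
  by (simp_all add: free_product_def fp_class_def)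

lemmas fp_class_simps =
  fp_class_add fp_class_mult fp_class_smult fp_class_zero fp_class_one

lemma free_product_algebra: "unital_algebra R (free_product R B C)"
proof -
  let ?F = "free_product R B C"
  note I = fp_terms.intros
  note [simp] = fp_class_simps I fp_class_closed
  have ag: "abelian_group ?F"
  proof (rule abelian_groupI)
    fix x assume "x \<in> carrier ?F"
    then obtain t where t: "t \<in> fp_terms R B C" "x = fp_class R B C t"
      by (rule fp_carrier_cases)
    show "\<exists>y \<in> carrier ?F. y \<oplus>\<^bsub>?F\<^esub> x = \<zero>\<^bsub>?F\<^esub>"
    proof (rule bexI)
      show "fp_class R B C (FScale (\<ominus>\<^bsub>R\<^esub> \<one>\<^bsub>R\<^esub>) t) \<oplus>\<^bsub>?F\<^esub> x = \<zero>\<^bsub>?F\<^esub>"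
        using t by (auto del: equalityI intro!: I fp_class_eq fp_cong.add_neg)
      show "fp_class R B C (FScale (\<ominus>\<^bsub>R\<^esub> \<one>\<^bsub>R\<^esub>) t) \<in> carrier ?F"
        using t by (auto intro!: fp_class_closed I)
    qed
  qed (auto del: equalityI elim!: fp_carrier_cases intro!: fp_class_closed I fp_class_eq fp_cong.add_assoc
      fp_cong.add_comm fp_cong.add_zero)
  have mon: "monoid ?F"
    by (rule monoidI) (auto del: equalityI elim!: fp_carrier_cases intro!: fp_class_closed I fp_class_eq
      fp_cong.mul_assoc fp_cong.mul_one_left fp_cong.mul_one_right)
  have ring: "ring ?F"
    by (rule ringI[OF ag mon]) (auto del: equalityI elim!: fp_carrier_cases intro!: I fp_class_eq
        fp_cong.mul_add_left fp_cong.mul_add_right)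
  have "module R ?F"
    by (rule moduleI[OF B.is_cring ag]) (auto del: equalityI elim!: fp_carrier_cases intro!: fp_class_closed I
        fp_class_eq fp_cong.scale_add_left fp_cong.scale_add_right fp_cong.scale_scale
        fp_cong.scale_one)
  then show ?thesis
    by (intro unital_algebra.intro unital_algebra_axioms.intro ring)
      (auto del: equalityI elim!: fp_carrier_cases intro!: I fp_class_eq
        fp_cong.mul_scale_left fp_cong.mul_scale_right)
qed

lemma fp_left_hom: "fp_left R B C \<in> unital_homs R B (free_product R B C)"
  unfolding fp_left_def fp_class_def[symmetric]
  by (intro unital_homsI linear_mapsI)
    (auto del: equalityI simp: fp_class_simps fp_terms.intros fp_class_closed
      intro!: fp_class_eq fp_cong.left_add fp_cong.left_mul fp_cong.left_scale)

lemma fp_right_hom: "fp_right R B C \<in> unital_homs R C (free_product R B C)"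
  unfolding fp_right_def fp_class_def[symmetric]
  by (intro unital_homsI linear_mapsI)
    (auto del: equalityI simp: fp_class_simps fp_terms.intros fp_class_closed
      intro!: fp_class_eq fp_cong.right_add fp_cong.right_mul fp_cong.right_scale
        fp_cong.right_one)

text \<open>
  The two factors generate the free product as an algebra, so that a property closed under the
  operations, such as the agreement of two homomorphisms, need only be checked on the factors.
\<close>

lemma free_product_induct:
  assumes "X \<in> carrier (free_product R B C)"
    and "\<And>b. b \<in> carrier B \<Longrightarrow> P (fp_left R B C b)"
    and "\<And>c. c \<in> carrier C \<Longrightarrow> P (fp_right R B C c)"
    and "\<And>X Y. \<lbrakk>X \<in> carrier (free_product R B C); Y \<in> carrier (free_product R B C); P X; P Y\<rbrakk> \<Longrightarrow>
      P (X \<oplus>\<^bsub>free_product R B C\<^esub> Y)"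
    and "\<And>X Y. \<lbrakk>X \<in> carrier (free_product R B C); Y \<in> carrier (free_product R B C); P X; P Y\<rbrakk> \<Longrightarrow>
      P (X \<otimes>\<^bsub>free_product R B C\<^esub> Y)"
    and "\<And>r X. \<lbrakk>r \<in> carrier R; X \<in> carrier (free_product R B C); P X\<rbrakk> \<Longrightarrow>
      P (r \<odot>\<^bsub>free_product R B C\<^esub> X)"
  shows "P X"
proof -
  have "P (fp_class R B C t)" if "t \<in> fp_terms R B C" for t
    using that
  proof induction
    case (1 b) then show ?case using assms(2) by (simp add: fp_left_def fp_class_def)
  next
    case (2 c) then show ?case using assms(3) by (simp add: fp_right_def fp_class_def)
  next
    case (3 s t) then show ?case
      using assms(4)[OF fp_class_closed fp_class_closed] by (simp add: fp_class_simps)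
  next
    case (4 s t) then show ?case
      using assms(5)[OF fp_class_closed fp_class_closed] by (simp add: fp_class_simps)
  next
    case (5 r t) then show ?case
      using assms(6)[OF _ fp_class_closed] by (simp add: fp_class_simps)
  qed
  then show ?thesis using assms(1) by (auto elim!: fp_carrier_cases)
qed

context
  fixes D :: "('r, 'd, 'k) module_scheme" and f g
  assumes D: "unital_algebra R D"
    and f: "f \<in> unital_homs R B D" and g: "g \<in> unital_homs R C D"
begin

interpretation D: unital_algebra R D by (fact D)

lemma fp_eval_closed: "t \<in> fp_terms R B C \<Longrightarrow> fp_eval D f g t \<in> carrier D"
  by (induction rule: fp_terms.induct) (simp_all add: hom_closed[OF f] hom_closed[OF g])

text \<open>
  Each relation that presents the free product is an algebra axiom of the target or says that one
  of the two components is a homomorphism.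
\<close>

lemma fp_eval_cong: "(s, t) \<in> fp_cong R B C \<Longrightarrow> fp_eval D f g s = fp_eval D f g t"
proof (induction rule: fp_cong.induct)
  case (add_neg t)
  then show ?case
    using fp_eval_closed[OF add_neg]
    by (simp add: D.smult_l_minus D.l_neg
        linear_zero[OF unital_algebra_module[OF B] unital_algebra_module[OF D] hom_linear[OF f]])
qed (simp_all add: fp_eval_closed hom_closed[OF f] hom_closed[OF g] D.a_ac D.m_assoc
    D.smult_l_distr D.smult_r_distr D.smult_assoc1 D.l_distr D.r_distr
    D.smult_mult_left D.smult_mult_right hom_add[OF f] hom_add[OF g] hom_mult[OF f] hom_mult[OF g]
    hom_smult[OF f] hom_smult[OF g] hom_one[OF f] hom_one[OF g]
    linear_zero[OF unital_algebra_module[OF B] unital_algebra_module[OF D] hom_linear[OF f]])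

lemma copair_class:
  assumes "t \<in> fp_terms R B C"
  shows "copair D f g (fp_class R B C t) = fp_eval D f g t"
proof -
  have "(SOME s. s \<in> fp_class R B C t) \<in> fp_class R B C t"
    using fp_class_self[OF assms] by (rule someI)
  then show ?thesis unfolding copair_def using fp_eval_cong[OF fp_class_memD] by simp
qed

lemma copair_hom: "copair D f g \<in> unital_homs R (free_product R B C) D"
  by (intro unital_homsI linear_mapsI)
    (auto del: equalityI elim!: fp_carrier_cases simp: fp_class_simps copair_class fp_terms.intros
      fp_eval_closed hom_one[OF f])

lemma copair_left: "b \<in> carrier B \<Longrightarrow> copair D f g (fp_left R B C b) = f b"
  by (simp add: fp_left_def fp_class_def[symmetric] copair_class fp_terms.intros)

lemma copair_right: "c \<in> carrier C \<Longrightarrow> copair D f g (fp_right R B C c) = g c"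
  by (simp add: fp_right_def fp_class_def[symmetric] copair_class fp_terms.intros)

lemma copair_unique:
  assumes h: "h \<in> unital_homs R (free_product R B C) D"
    and "\<And>b. b \<in> carrier B \<Longrightarrow> h (fp_left R B C b) = f b"
    and "\<And>c. c \<in> carrier C \<Longrightarrow> h (fp_right R B C c) = g c"
    and "X \<in> carrier (free_product R B C)"
  shows "h X = copair D f g X"
  using assms(4)
  by (rule free_product_induct)
    (simp_all add: assms(2,3) copair_left copair_right hom_add[OF h] hom_mult[OF h] hom_smult[OF h]
      hom_add[OF copair_hom] hom_mult[OF copair_hom] hom_smult[OF copair_hom])

end

end


section \<open>Graded modules and algebras\<close>

locale graded_module = module R A
  for R :: "('r, 'l) ring_scheme" and A :: "('r, 'a, 'm) graded_alg_scheme" +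
  assumes grade_submodule: "submodule (grade A n) R A"
    and grade_direct_sum: "x \<in> carrier A \<Longrightarrow> \<exists>!c. homogeneous_decomp A x c"

lemma (in abelian_monoid) finsum_single: "f i \<in> carrier G \<Longrightarrow> finsum G f {i} = f i"
  using finsum_insert[of "{}" i f] by simp

lemma homogeneous_decompI:
  assumes "module R A"
    and "\<And>n. c n \<in> grade A n" "\<And>n. grade A n \<subseteq> carrier A" "finite S"
    and "\<And>n. n \<notin> S \<Longrightarrow> c n = \<zero>\<^bsub>A\<^esub>" "x = finsum A c S"
  shows "homogeneous_decomp A x c"
proof -
  interpret A: module R A by fact
  have sub: "{n. c n \<noteq> \<zero>\<^bsub>A\<^esub>} \<subseteq> S" using assms(5) by auto
  have "finsum A c {n. c n \<noteq> \<zero>\<^bsub>A\<^esub>} = finsum A c S"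
    by (rule A.add.finprod_mono_neutral_cong_left) (use assms sub in auto)
  then show ?thesis
    unfolding homogeneous_decomp_def using assms sub by (auto intro: finite_subset)
qed

text \<open>
  Linear projections onto the pieces recover the terms of any decomposition into homogeneous
  elements, which is therefore unique. Decompositions add up, so they exist as soon as the
  homogeneous elements generate the module additively.
\<close>

lemma graded_moduleI:
  fixes R :: "('r, 'l) ring_scheme" and M :: "('r, 'a, 'm) graded_alg_scheme"
  assumes "module R M"
    and sub: "\<And>n. submodule (grade M n) R M"
    and gen: "\<And>P x. \<lbrakk>x \<in> carrier M; \<And>n y. y \<in> grade M n \<Longrightarrow> P y;
      \<And>y z. \<lbrakk>y \<in> carrier M; z \<in> carrier M; P y; P z\<rbrakk> \<Longrightarrow> P (y \<oplus>\<^bsub>M\<^esub> z)\<rbrakk> \<Longrightarrow> P x"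
    and lin: "\<And>n. proj n \<in> linear_maps R M M"
    and proj: "\<And>m n x. x \<in> grade M m \<Longrightarrow> proj n x = (if m = n then x else \<zero>\<^bsub>M\<^esub>)"
  shows "graded_module R M"
proof -
  interpret M: module R M by fact
  have gc: "grade M n \<subseteq> carrier M" for n using M.submoduleE(1)[OF sub] .
  have g0: "\<zero>\<^bsub>M\<^esub> \<in> grade M n" for n
    using M.submoduleE(2,4)[OF sub[of n]] gc[of n] M.R.zero_closed
    by (metis M.smult_l_null ex_in_conv subsetD)
  have "\<exists>c. homogeneous_decomp M x c" if "x \<in> carrier M" for x
    using that
  proof (rule gen)
    fix n y assume y: "y \<in> grade M n"
    show "\<exists>c. homogeneous_decomp M y c"
    proof (rule exI)
      show "homogeneous_decomp M y (\<lambda>k. if k = n then y else \<zero>\<^bsub>M\<^esub>)"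
        by (rule homogeneous_decompI[where S = "{n}", OF \<open>module R M\<close>])
          (use y g0 gc subsetD[OF gc y] in \<open>auto simp: M.finsum_single\<close>)
    qed
  next
    fix y z assume yz: "y \<in> carrier M" "z \<in> carrier M"
      and "\<exists>c. homogeneous_decomp M y c" "\<exists>c. homogeneous_decomp M z c"
    then obtain c d where c: "homogeneous_decomp M y c" and d: "homogeneous_decomp M z d" by auto
    let ?S = "{n. c n \<noteq> \<zero>\<^bsub>M\<^esub>} \<union> {n. d n \<noteq> \<zero>\<^bsub>M\<^esub>}"
    have cM: "c n \<in> carrier M" "d n \<in> carrier M" for n
      using c d gc[of n] by (auto simp: homogeneous_decomp_def)
    have "y = finsum M c ?S"
      using c cM unfolding homogeneous_decomp_def
      by (auto intro!: M.add.finprod_mono_neutral_cong_left d[unfolded homogeneous_decomp_def, THEN conjunct2, THEN conjunct1])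
    moreover have "z = finsum M d ?S"
      using d cM unfolding homogeneous_decomp_def
      by (auto intro!: M.add.finprod_mono_neutral_cong_left c[unfolded homogeneous_decomp_def, THEN conjunct2, THEN conjunct1])
    ultimately have "y \<oplus>\<^bsub>M\<^esub> z = finsum M (\<lambda>n. c n \<oplus>\<^bsub>M\<^esub> d n) ?S"
      using cM by (simp add: M.finsum_addf)
    then have "homogeneous_decomp M (y \<oplus>\<^bsub>M\<^esub> z) (\<lambda>n. c n \<oplus>\<^bsub>M\<^esub> d n)"
      using c d gc M.submoduleE(5)[OF sub]
      by (intro homogeneous_decompI[where S = ?S, OF \<open>module R M\<close>])
        (auto simp: homogeneous_decomp_def)
    then show "\<exists>c. homogeneous_decomp M (y \<oplus>\<^bsub>M\<^esub> z) c" by blast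
  qed
  moreover have "c n = proj n x" if c: "homogeneous_decomp M x c" for x c n
  proof -
    let ?S = "{n. c n \<noteq> \<zero>\<^bsub>M\<^esub>}"
    have cg: "c k \<in> grade M k" for k using c by (auto simp: homogeneous_decomp_def)
    then have cM: "c k \<in> carrier M" for k using gc by blast
    have fin: "finite ?S" using c by (auto simp: homogeneous_decomp_def)
    have "x = finsum M c ?S" using c by (auto simp: homogeneous_decomp_def)
    then have "proj n x = finsum M (\<lambda>k. proj n (c k)) ?S"
      using linear_finsum[OF \<open>module R M\<close> \<open>module R M\<close> lin fin] cM by auto
    also have "\<dots> = finsum M (\<lambda>k. if n = k then c k else \<zero>\<^bsub>M\<^esub>) ?S"
      by (rule M.finsum_cong') (use cM proj[OF cg] in auto)
    also have "\<dots> = c n"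
    proof (cases "n \<in> ?S")
      case True
      then show ?thesis using M.add.finprod_singleton[OF True fin, of c] cM by auto
    next
      case False
      then have "finsum M (\<lambda>k. if n = k then c k else \<zero>\<^bsub>M\<^esub>) ?S = finsum M (\<lambda>k. \<zero>\<^bsub>M\<^esub>) ?S"
        by (intro M.finsum_cong') auto
      then show ?thesis using False by simp
    qed
    finally show ?thesis ..
  qed
  ultimately show ?thesis
    by (intro graded_module.intro graded_module_axioms.intro \<open>module R M\<close> sub) (metis ext)
qed

context graded_module
begin

lemma module_axiom: "module R A" by unfold_locales

lemma grade_closed: "x \<in> grade A n \<Longrightarrow> x \<in> carrier A"
  using submoduleE(1)[OF grade_submodule] by blast

lemma grade_zero: "\<zero>\<^bsub>A\<^esub> \<in> grade A n"
  using submoduleE(2,4)[OF grade_submodule[of n]] grade_closed R.zero_closed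
  by (metis smult_l_null ex_in_conv)

lemma grade_add: "\<lbrakk>x \<in> grade A n; y \<in> grade A n\<rbrakk> \<Longrightarrow> x \<oplus>\<^bsub>A\<^esub> y \<in> grade A n"
  using submoduleE(5)[OF grade_submodule] .

lemma grade_smult: "\<lbrakk>r \<in> carrier R; x \<in> grade A n\<rbrakk> \<Longrightarrow> r \<odot>\<^bsub>A\<^esub> x \<in> grade A n"
  using submoduleE(4)[OF grade_submodule] .

lemma component_decomp: "x \<in> carrier A \<Longrightarrow> homogeneous_decomp A x (component A x)"
  unfolding component_def by (rule theI'[OF grade_direct_sum])

lemma component_eq:
  assumes "x \<in> carrier A" "homogeneous_decomp A x c"
  shows "component A x = c"
  using grade_direct_sum[OF assms(1)] component_decomp[OF assms(1)] assms(2) by auto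

lemma component_grade: "x \<in> carrier A \<Longrightarrow> component A x n \<in> grade A n"
  using component_decomp by (auto simp: homogeneous_decomp_def)

lemma component_closed: "x \<in> carrier A \<Longrightarrow> component A x n \<in> carrier A"
  using component_grade grade_closed by blast

lemma component_finite: "x \<in> carrier A \<Longrightarrow> finite {n. component A x n \<noteq> \<zero>\<^bsub>A\<^esub>}"
  using component_decomp by (auto simp: homogeneous_decomp_def)

lemma component_sum:
  assumes "x \<in> carrier A" "finite S" "{n. component A x n \<noteq> \<zero>\<^bsub>A\<^esub>} \<subseteq> S"
  shows "x = finsum A (component A x) S"
proof -
  have "x = finsum A (component A x) {n. component A x n \<noteq> \<zero>\<^bsub>A\<^esub>}"
    using component_decomp[OF assms(1)] by (auto simp: homogeneous_decomp_def)
  also have "\<dots> = finsum A (component A x) S"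
    by (rule add.finprod_mono_neutral_cong_left) (use assms component_closed in auto)
  finally show ?thesis .
qed

lemma component_homogeneous:
  assumes "x \<in> grade A n"
  shows "component A x k = (if k = n then x else \<zero>\<^bsub>A\<^esub>)"
proof -
  have "homogeneous_decomp A x (\<lambda>k. if k = n then x else \<zero>\<^bsub>A\<^esub>)"
    by (rule homogeneous_decompI[where S = "{n}", OF module_axiom])
      (use assms grade_zero grade_closed in \<open>auto simp: finsum_single\<close>)
  then show ?thesis using component_eq[OF grade_closed[OF assms]] by simp
qed

lemma component_linear: "(\<lambda>x. component A x n) \<in> linear_maps R A A"
proof (rule linear_mapsI)
  fix x assume x: "x \<in> carrier A"
  then show "component A x n \<in> carrier A" by (rule component_closed)
  fix y assume y: "y \<in> carrier A"
  let ?S = "{n. component A x n \<noteq> \<zero>\<^bsub>A\<^esub>} \<union> {n. component A y n \<noteq> \<zero>\<^bsub>A\<^esub>}"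
  have S: "finite ?S" using component_finite x y by simp
  have "homogeneous_decomp A (x \<oplus>\<^bsub>A\<^esub> y) (\<lambda>n. component A x n \<oplus>\<^bsub>A\<^esub> component A y n)"
  proof (rule homogeneous_decompI[where S = ?S, OF module_axiom])
    have "x \<oplus>\<^bsub>A\<^esub> y = finsum A (component A x) ?S \<oplus>\<^bsub>A\<^esub> finsum A (component A y) ?S"
      using component_sum[OF x S] component_sum[OF y S] by auto
    also have "\<dots> = finsum A (\<lambda>n. component A x n \<oplus>\<^bsub>A\<^esub> component A y n) ?S"
      by (rule finsum_addf[symmetric]) (use x y component_closed in auto)
    finally show "x \<oplus>\<^bsub>A\<^esub> y = finsum A (\<lambda>n. component A x n \<oplus>\<^bsub>A\<^esub> component A y n) ?S" .
  qed (use S x y component_grade grade_add grade_closed in auto)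
  then show "component A (x \<oplus>\<^bsub>A\<^esub> y) n = component A x n \<oplus>\<^bsub>A\<^esub> component A y n"
    using x y by (subst component_eq) auto
next
  fix r x assume r: "r \<in> carrier R" and x: "x \<in> carrier A"
  let ?S = "{n. component A x n \<noteq> \<zero>\<^bsub>A\<^esub>}"
  have S: "finite ?S" using component_finite x by simp
  have "homogeneous_decomp A (r \<odot>\<^bsub>A\<^esub> x) (\<lambda>n. r \<odot>\<^bsub>A\<^esub> component A x n)"
  proof (rule homogeneous_decompI[where S = ?S, OF module_axiom])
    have "r \<odot>\<^bsub>A\<^esub> x = r \<odot>\<^bsub>A\<^esub> finsum A (component A x) ?S"
      using component_sum[OF x S] by auto
    also have "\<dots> = finsum A (\<lambda>n. r \<odot>\<^bsub>A\<^esub> component A x n) ?S"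
      by (rule finsum_smult_ldistr[OF S r]) (use x component_closed in auto)
    finally show "r \<odot>\<^bsub>A\<^esub> x = finsum A (\<lambda>n. r \<odot>\<^bsub>A\<^esub> component A x n) ?S" .
  qed (use S r x component_grade grade_smult grade_closed in auto)
  then show "component A (r \<odot>\<^bsub>A\<^esub> x) n = r \<odot>\<^bsub>A\<^esub> component A x n"
    using r x by (subst component_eq) auto
qed

text \<open>
  Additive statements need only be checked on homogeneous elements.
\<close>

lemma homogeneous_induct [consumes 1, case_names hom add]:
  assumes "x \<in> carrier A"
    and hom: "\<And>n x. x \<in> grade A n \<Longrightarrow> P x"
    and add: "\<And>x y. \<lbrakk>x \<in> carrier A; y \<in> carrier A; P x; P y\<rbrakk> \<Longrightarrow> P (x \<oplus>\<^bsub>A\<^esub> y)"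
  shows "P x"
proof -
  have "P (finsum A (component A x) S)" if "finite S" for S
    using that
  proof induction
    case empty
    then show ?case using hom[OF grade_zero] by simp
  next
    case (insert i S)
    have "finsum A (component A x) (insert i S) = component A x i \<oplus>\<^bsub>A\<^esub> finsum A (component A x) S"
      using insert component_closed[OF assms(1)] by (intro finsum_insert) auto
    moreover have "P (component A x i \<oplus>\<^bsub>A\<^esub> finsum A (component A x) S)"
    proof (rule add)
      show "finsum A (component A x) S \<in> carrier A"
        using component_closed[OF assms(1)] by (intro finsum_closed) simp
    qed (rule component_closed[OF assms(1)] hom[OF component_grade[OF assms(1)]] insert.IH)+
    ultimately show ?case by (simp only:)
  qed
  from back_subst[of P, OF this[OF component_finite[OF assms(1)]]
      component_sum[OF assms(1) component_finite[OF assms(1)] order_refl, symmetric]]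
  show ?thesis .
qed

end

locale graded_algebra = graded_module R A + unital_algebra R A
  for R :: "('r, 'l) ring_scheme" and A :: "('r, 'a, 'm) graded_alg_scheme" +
  assumes grade_mult:
      "\<lbrakk>x \<in> grade A m; y \<in> grade A n\<rbrakk> \<Longrightarrow> x \<otimes>\<^bsub>A\<^esub> y \<in> grade A (m + n)"
    and grade_one: "\<one>\<^bsub>A\<^esub> \<in> grade A 0"

sublocale connected_graded_algebra \<subseteq> graded_algebra
  by (intro graded_algebra.intro graded_module.intro graded_module_axioms.intro
      unital_algebra.intro unital_algebra_axioms.intro graded_algebra_axioms.intro
      module_axioms ring_axioms)
    (fact smult_mult_left smult_mult_right grade_submodule grade_direct_sum grade_mult
      grade_one)+

context connected_graded_algebra
begin

text \<open>
  Since \<open>A\<^sub>0 = R\<close>, the augmentation is the component of degree 0, read as a scalar. In this form the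
  trivial map is visibly compatible with the grading.
\<close>

lemma augmentation_closed: "x \<in> carrier A \<Longrightarrow> augmentation R A x \<in> carrier R"
  and augmentation_component:
    "x \<in> carrier A \<Longrightarrow> augmentation R A x \<odot>\<^bsub>A\<^esub> \<one>\<^bsub>A\<^esub> = component A x 0"
proof -
  have inj: "inj_on (\<lambda>r. r \<odot>\<^bsub>A\<^esub> \<one>\<^bsub>A\<^esub>) (carrier R)"
    and im: "(\<lambda>r. r \<odot>\<^bsub>A\<^esub> \<one>\<^bsub>A\<^esub>) ` carrier R = grade A 0"
    using connected by (auto simp: bij_betw_def)
  assume "x \<in> carrier A"
  then have "component A x 0 \<in> (\<lambda>r. r \<odot>\<^bsub>A\<^esub> \<one>\<^bsub>A\<^esub>) ` carrier R"
    using component_grade im by simp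
  then show "augmentation R A x \<in> carrier R"
    "augmentation R A x \<odot>\<^bsub>A\<^esub> \<one>\<^bsub>A\<^esub> = component A x 0"
    unfolding augmentation_def
    using the_inv_into_into[OF inj _ order_refl] f_the_inv_into_f[OF inj] by auto
qed

lemma trivial_map_component: "x \<in> carrier A \<Longrightarrow> trivial_map R A A x = component A x 0"
  by (simp add: trivial_map_def augmentation_component)

lemma trivial_map_linear: "trivial_map R A A \<in> linear_maps R A A"
  using component_linear[of 0]
  by (auto simp: linear_maps_def trivial_map_component)

lemma trivial_map_grade: "x \<in> grade A n \<Longrightarrow> trivial_map R A A x \<in> grade A n"
  by (cases "n = 0")
    (auto simp: trivial_map_component grade_closed component_homogeneous grade_zero)

lemma trivial_map_hom: "trivial_map R A A \<in> unital_homs R A A"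
proof (rule unital_homsI[OF trivial_map_linear])
  note lin = linear_mapsD[OF trivial_map_linear]
  fix x y assume "x \<in> carrier A" and y: "y \<in> carrier A"
  then show "trivial_map R A A (x \<otimes>\<^bsub>A\<^esub> y) = trivial_map R A A x \<otimes>\<^bsub>A\<^esub> trivial_map R A A y"
  proof (induction x rule: homogeneous_induct)
    case x1: (hom m x)
    have x: "x \<in> carrier A" using x1(1) by (rule grade_closed)
    show ?case using y
    proof (induction y rule: homogeneous_induct)
      case y1: (hom n y)
      then have "x \<otimes>\<^bsub>A\<^esub> y \<in> grade A (m + n)" using x1(1) y1(1) grade_mult by blast
      then show ?case
        using x1 y1 by (simp add: trivial_map_component grade_closed component_homogeneous)
    next
      case (add y z)
      then show ?case using x by (simp add: r_distr lin)
    qed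
  next
    case (add x z)
    then show ?case using y by (simp add: l_distr lin)
  qed
next
  show "trivial_map R A A \<one>\<^bsub>A\<^esub> = \<one>\<^bsub>A\<^esub>"
    using grade_one by (simp add: trivial_map_component component_homogeneous)
qed

end


section \<open>Signs and graded commutation\<close>

definition koszul_sign :: "('r, 'l) ring_scheme \<Rightarrow> nat \<Rightarrow> nat \<Rightarrow> 'r" where
  "koszul_sign R i j = (\<ominus>\<^bsub>R\<^esub> \<one>\<^bsub>R\<^esub>) [^]\<^bsub>R\<^esub> (i * j)"

context cring
begin

lemma koszul_sign_closed [simp]: "koszul_sign R i j \<in> carrier R"
  by (simp add: koszul_sign_def)

lemma koszul_sign_add_left:
  "koszul_sign R (i + j) k = koszul_sign R i k \<otimes>\<^bsub>R\<^esub> koszul_sign R j k"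
  by (simp add: koszul_sign_def nat_pow_mult distrib_right)

lemma koszul_sign_sym: "koszul_sign R i j = koszul_sign R j i"
  by (simp add: koszul_sign_def mult.commute)

lemma koszul_sign_square: "koszul_sign R i j \<otimes>\<^bsub>R\<^esub> koszul_sign R i j = \<one>\<^bsub>R\<^esub>"
  by (simp add: koszul_sign_def nat_pow_distrib[symmetric] l_minus r_minus)

lemma koszul_sign_zero [simp]: "koszul_sign R 0 j = \<one>\<^bsub>R\<^esub>" "koszul_sign R i 0 = \<one>\<^bsub>R\<^esub>"
  by (simp_all add: koszul_sign_def)

end

text \<open>
  This is the condition under which \<open>p\<close> and \<open>q\<close> together induce a homomorphism from the tensor
  product.
\<close>

definition graded_commute ::
  "('r, 'l) ring_scheme \<Rightarrow> ('r, 'a, 'm) graded_alg_scheme \<Rightarrow> ('r, 'b, 'n) graded_alg_scheme \<Rightarrow>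
   ('r, 'd, 'k) module_scheme \<Rightarrow> ('a \<Rightarrow> 'd) \<Rightarrow> ('b \<Rightarrow> 'd) \<Rightarrow> bool" where
  "graded_commute R A B D p q \<longleftrightarrow>
     (\<forall>m n. \<forall>x \<in> grade A m. \<forall>y \<in> grade B n.
        q y \<otimes>\<^bsub>D\<^esub> p x = koszul_sign R m n \<odot>\<^bsub>D\<^esub> (p x \<otimes>\<^bsub>D\<^esub> q y))"

lemma graded_commute_sym:
  assumes "graded_algebra R A" "graded_algebra R B" "unital_algebra R D"
    and p: "p \<in> linear_maps R A D" and q: "q \<in> linear_maps R B D"
    and "graded_commute R A B D p q"
  shows "graded_commute R B A D q p"
  unfolding graded_commute_def
proof (intro allI ballI)
  interpret A: graded_algebra R A by fact
  interpret B: graded_algebra R B by fact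
  interpret D: unital_algebra R D by fact
  fix m n y x assume y: "y \<in> grade B m" and x: "x \<in> grade A n"
  have cl: "p x \<in> carrier D" "q y \<in> carrier D"
    using x y linear_closed[OF p] linear_closed[OF q] A.grade_closed B.grade_closed by auto
  have "q y \<otimes>\<^bsub>D\<^esub> p x = koszul_sign R n m \<odot>\<^bsub>D\<^esub> (p x \<otimes>\<^bsub>D\<^esub> q y)"
    using assms(6) x y by (auto simp: graded_commute_def)
  then have "koszul_sign R m n \<odot>\<^bsub>D\<^esub> (q y \<otimes>\<^bsub>D\<^esub> p x) =
      (koszul_sign R m n \<otimes>\<^bsub>R\<^esub> koszul_sign R m n) \<odot>\<^bsub>D\<^esub> (p x \<otimes>\<^bsub>D\<^esub> q y)"
    using cl A.R.koszul_sign_sym[of n m] by (simp add: D.smult_assoc1)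
  then show "p x \<otimes>\<^bsub>D\<^esub> q y = koszul_sign R m n \<odot>\<^bsub>D\<^esub> (q y \<otimes>\<^bsub>D\<^esub> p x)"
    using cl by (simp add: A.R.koszul_sign_square)
qed


lemma graded_commute_precomp:
  assumes "graded_commute R B C D p q"
    and "\<And>n x. x \<in> grade B' n \<Longrightarrow> f x \<in> grade B n"
    and "\<And>n x. x \<in> grade C' n \<Longrightarrow> g x \<in> grade C n"
  shows "graded_commute R B' C' D (\<lambda>x. p (f x)) (\<lambda>x. q (g x))"
  using assms by (auto simp: graded_commute_def)

lemma graded_commute_hom:
  assumes "graded_algebra R B" "graded_algebra R C" "unital_algebra R D"
    and "graded_commute R B C D p q" and p: "p \<in> linear_maps R B D" and q: "q \<in> linear_maps R C D"
    and h: "h \<in> unital_homs R D E"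
  shows "graded_commute R B C E (\<lambda>x. h (p x)) (\<lambda>x. h (q x))"
  unfolding graded_commute_def
proof (intro allI ballI)
  interpret B: graded_algebra R B by fact
  interpret C: graded_algebra R C by fact
  interpret D: unital_algebra R D by fact
  fix m n x y assume x: "x \<in> grade B m" and y: "y \<in> grade C n"
  have cl: "p x \<in> carrier D" "q y \<in> carrier D"
    using linear_closed[OF p B.grade_closed[OF x]] linear_closed[OF q C.grade_closed[OF y]] by auto
  have "h (q y \<otimes>\<^bsub>D\<^esub> p x) = h (koszul_sign R m n \<odot>\<^bsub>D\<^esub> (p x \<otimes>\<^bsub>D\<^esub> q y))"
    using assms(4) x y by (auto simp: graded_commute_def)
  then show "h (q y) \<otimes>\<^bsub>E\<^esub> h (p x) = koszul_sign R m n \<odot>\<^bsub>E\<^esub> (h (p x) \<otimes>\<^bsub>E\<^esub> h (q y))"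
    using cl by (simp add: hom_mult[OF h] hom_smult[OF h])
qed


section \<open>The grading of a free product\<close>

context
  fixes R :: "('r, 'l) ring_scheme"
    and B :: "('r, 'b, 'm) graded_alg_scheme"
    and C :: "('r, 'c, 'n) graded_alg_scheme"
  assumes B: "graded_algebra R B" and C: "graded_algebra R C"
begin

interpretation B: graded_algebra R B by (fact B)
interpretation C: graded_algebra R C by (fact C)

lemmas BC_algebras = B.unital_algebra_axioms C.unital_algebra_axioms

lemma fp_homogeneous_term: "fp_homogeneous R B C n t \<Longrightarrow> t \<in> fp_terms R B C"
  by (induction rule: fp_homogeneous.induct)
    (auto intro: fp_terms.intros B.grade_closed C.grade_closed)

lemma fp_grade_cases:
  assumes "X \<in> grade (free_product R B C) n"
  obtains t where "fp_homogeneous R B C n t" "X = fp_class R B C t"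
  using assms by (auto simp: free_product_def fp_class_def)

lemma copair_grade:
  fixes D :: "('r, 'd, 'k) graded_alg_scheme"
  assumes "graded_algebra R D" and f: "f \<in> alg_hom R B D" and g: "g \<in> alg_hom R C D"
    and "X \<in> grade (free_product R B C) n"
  shows "copair D f g X \<in> grade D n"
proof -
  interpret D: graded_algebra R D by fact
  obtain t where t: "fp_homogeneous R B C n t" "X = fp_class R B C t"
    using fp_grade_cases[OF assms(4)] .
  have "fp_eval D f g t \<in> grade D n" using t(1)
    by induction (auto intro: alg_hom_grade[OF f] alg_hom_grade[OF g] D.grade_add D.grade_mult
        D.grade_smult)
  then show ?thesis
    using copair_class[OF BC_algebras D.unital_algebra_axioms alg_hom_unital_hom[OF f]
        alg_hom_unital_hom[OF g] fp_homogeneous_term[OF t(1)]] t(2) by simp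
qed

text \<open>
  A word in the images of \<open>u\<close> and \<open>v\<close> can be moved past \<open>w y\<close> one factor at a time; the signs
  multiply to the sign of the total degree, because the Koszul sign is multiplicative in each
  degree.
\<close>

lemma graded_commute_copair:
  fixes D :: "('r, 'd, 'k) module_scheme" and E :: "('r, 'e, 'j) graded_alg_scheme"
  assumes "graded_algebra R E" "unital_algebra R D"
    and u: "u \<in> unital_homs R B D" and v: "v \<in> unital_homs R C D"
    and w: "w \<in> linear_maps R E D"
    and uw: "graded_commute R B E D u w" and vw: "graded_commute R C E D v w"
  shows "graded_commute R (free_product R B C) E D (copair D u v) w"
  unfolding graded_commute_def
proof (intro allI ballI)
  interpret E: graded_algebra R E by fact
  interpret D: unital_algebra R D by fact
  fix m n X y assume X: "X \<in> grade (free_product R B C) m" and y: "y \<in> grade E n"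
  have wy: "w y \<in> carrier D" using linear_closed[OF w] E.grade_closed[OF y] .
  note ev = fp_eval_closed[OF BC_algebras D.unital_algebra_axioms u v]
  obtain t where t: "fp_homogeneous R B C m t" "X = fp_class R B C t"
    using fp_grade_cases[OF X] .
  have "w y \<otimes>\<^bsub>D\<^esub> fp_eval D u v t = koszul_sign R m n \<odot>\<^bsub>D\<^esub> (fp_eval D u v t \<otimes>\<^bsub>D\<^esub> w y)"
    using t(1)
  proof induction
    case (1 b n)
    then show ?case using uw y by (auto simp: graded_commute_def)
  next
    case (2 c n)
    then show ?case using vw y by (auto simp: graded_commute_def)
  next
    case (3 m s t)
    then show ?case
      using wy by (simp add: ev fp_homogeneous_term D.r_distr D.l_distr D.smult_r_distr)
  next
    case (4 m s k t)
    let ?s = "fp_eval D u v s" and ?t = "fp_eval D u v t"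
    have cl: "?s \<in> carrier D" "?t \<in> carrier D" using 4 ev fp_homogeneous_term by auto
    have "w y \<otimes>\<^bsub>D\<^esub> (?s \<otimes>\<^bsub>D\<^esub> ?t) = (w y \<otimes>\<^bsub>D\<^esub> ?s) \<otimes>\<^bsub>D\<^esub> ?t"
      using cl wy by (simp add: D.m_assoc)
    also have "\<dots> = koszul_sign R m n \<odot>\<^bsub>D\<^esub> (?s \<otimes>\<^bsub>D\<^esub> (w y \<otimes>\<^bsub>D\<^esub> ?t))"
      using cl wy 4 by (simp add: D.m_assoc D.smult_mult_left)
    also have "\<dots> = koszul_sign R (m + k) n \<odot>\<^bsub>D\<^esub> ((?s \<otimes>\<^bsub>D\<^esub> ?t) \<otimes>\<^bsub>D\<^esub> w y)"
      using cl wy 4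
      by (simp add: D.m_assoc D.smult_mult_right D.smult_assoc1[symmetric]
          B.R.koszul_sign_add_left)
    finally show ?case by simp
  next
    case (5 r m t)
    then have cl: "fp_eval D u v t \<in> carrier D" using ev fp_homogeneous_term by auto
    then show ?case
      using wy 5 by (simp add: D.smult_mult_left D.smult_mult_right D.smult_assoc1[symmetric]
          B.R.m_comm)
  qed
  then show "w y \<otimes>\<^bsub>D\<^esub> copair D u v X = koszul_sign R m n \<odot>\<^bsub>D\<^esub> (copair D u v X \<otimes>\<^bsub>D\<^esub> w y)"
    using copair_class[OF BC_algebras D.unital_algebra_axioms u v fp_homogeneous_term[OF t(1)]] t(2)
    by simp
qed

end


section \<open>Evaluating coassociativity\<close>

text \<open>
  Both sides are the morphism out of \<open>A * A * A\<close> with components \<open>u\<close>, \<open>v\<close> and \<open>w\<close>, evaluated at the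
  two iterated coproducts of \<open>x\<close>. All consequences of coassociativity below are obtained by choosing
  the target and the three components.
\<close>

lemma comonoid_coassoc_copair:
  fixes D :: "('r, 'd, 'k) module_scheme"
  assumes com: "comonoid R A \<Phi>" and D: "unital_algebra R D"
    and u: "u \<in> unital_homs R A D" and v: "v \<in> unital_homs R A D" and w: "w \<in> unital_homs R A D"
    and x: "x \<in> carrier A"
  shows "copair D (\<lambda>y. copair D u v (\<Phi> y)) w (\<Phi> x) = copair D u (\<lambda>y. copair D v w (\<Phi> y)) (\<Phi> x)"
proof -
  interpret A: connected_graded_algebra R A using com by (simp add: comonoid_def)
  let ?F = "free_product R A A"
  let ?G = "free_product R A ?F" and ?H = "free_product R ?F A"
  note A = A.unital_algebra_axioms
  note F = free_product_algebra[OF A A]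
  note G = free_product_algebra[OF A F] and H = free_product_algebra[OF F A]
  have \<Phi>: "\<Phi> \<in> unital_homs R A ?F" using com by (auto simp: comonoid_def intro: alg_hom_unital_hom)
  have \<Phi>x: "\<Phi> x \<in> carrier ?F" using hom_closed[OF \<Phi> x] .
  have uv: "copair D u v \<in> unital_homs R ?F D" and vw: "copair D v w \<in> unital_homs R ?F D"
    using copair_hom[OF A A D] u v w by auto
  \<comment> \<open>The morphism with components \<open>u\<close>, \<open>v\<close>, \<open>w\<close> on \<open>A * (A * A)\<close>. Composed with each of the two
    iterated coproducts it is again determined by its restrictions to the factors of \<open>A * A\<close>.\<close>
  let ?h = "copair D u (copair D v w)"
  have h: "?h \<in> unital_homs R ?G D" by (rule copair_hom[OF A F D u vw])
  have id: "id \<in> unital_homs R A A" by (rule hom_id)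
  have "?h (fp_map R A ?F id \<Phi> (\<Phi> x)) = copair D u (\<lambda>y. copair D v w (\<Phi> y)) (\<Phi> x)"
  proof (rule copair_unique[OF A A D u hom_comp[OF \<Phi> vw] _ _ _ \<Phi>x])
    have l: "fp_left R A ?F \<in> unital_homs R A ?G"
      by (rule fp_left_hom[OF A F])
    have r: "fp_right R A ?F \<circ> \<Phi> \<in> unital_homs R A ?G"
      using hom_comp[OF \<Phi> fp_right_hom[OF A F]] by (simp add: comp_def)
    show "(\<lambda>X. ?h (fp_map R A ?F id \<Phi> X)) \<in> unital_homs R ?F D"
      unfolding fp_map_def comp_id by (rule hom_comp[OF copair_hom[OF A A G l r] h])
    fix a assume a: "a \<in> carrier A"
    show "?h (fp_map R A ?F id \<Phi> (fp_left R A A a)) = u a"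
      using a by (simp add: fp_map_def copair_left[OF A A G l r] copair_left[OF A F D u vw])
    show "?h (fp_map R A ?F id \<Phi> (fp_right R A A a)) = copair D v w (\<Phi> a)"
      using a by (simp add: fp_map_def copair_right[OF A A G l r] copair_right[OF A F D u vw]
          hom_closed[OF \<Phi>])
  qed
  moreover have "?h (fp_assoc R A A A (fp_map R ?F A \<Phi> id (\<Phi> x))) =
      copair D (\<lambda>y. copair D u v (\<Phi> y)) w (\<Phi> x)"
  proof (rule copair_unique[OF A A D hom_comp[OF \<Phi> uv] w _ _ _ \<Phi>x])
    let ?l = "copair ?G (fp_left R A ?F) (fp_right R A ?F \<circ> fp_left R A A)"
    let ?r = "fp_right R A ?F \<circ> fp_right R A A"
    have rl: "fp_right R A ?F \<circ> fp_left R A A \<in> unital_homs R A ?G"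
      using hom_comp[OF fp_left_hom[OF A A] fp_right_hom[OF A F]] by (simp add: comp_def)
    have r: "?r \<in> unital_homs R A ?G"
      using hom_comp[OF fp_right_hom[OF A A] fp_right_hom[OF A F]] by (simp add: comp_def)
    have l: "?l \<in> unital_homs R ?F ?G"
      by (rule copair_hom[OF A A G fp_left_hom[OF A F] rl])
    have as: "fp_assoc R A A A = copair ?G ?l ?r" by (simp add: fp_assoc_def Let_def)
    have l': "fp_left R ?F A \<circ> \<Phi> \<in> unital_homs R A ?H"
      using hom_comp[OF \<Phi> fp_left_hom[OF F A]] by (simp add: comp_def)
    have r': "fp_right R ?F A \<in> unital_homs R A ?H"
      by (rule fp_right_hom[OF F A])
    show "(\<lambda>X. ?h (fp_assoc R A A A (fp_map R ?F A \<Phi> id X))) \<in> unital_homs R ?F D"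
      unfolding fp_map_def comp_id as
      by (rule hom_comp[OF hom_comp[OF copair_hom[OF A A H l' r'] copair_hom[OF F A G l r]] h])
    fix a assume a: "a \<in> carrier A"
    have "?h (?l X) = copair D u v X" if "X \<in> carrier ?F" for X
    proof (rule copair_unique[OF A A D u v _ _ _ that])
      show "(\<lambda>X. ?h (?l X)) \<in> unital_homs R ?F D" by (rule hom_comp[OF l h])
      fix b assume b: "b \<in> carrier A"
      show "?h (?l (fp_left R A A b)) = u b"
        using b by (simp add: copair_left[OF A A G fp_left_hom[OF A F] rl]
            copair_left[OF A F D u vw])
      show "?h (?l (fp_right R A A b)) = v b"
        using b by (simp add: copair_right[OF A A G fp_left_hom[OF A F] rl]
            copair_right[OF A F D u vw] hom_closed[OF fp_left_hom[OF A A]]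
            copair_left[OF A A D v w])
    qed
    then show "?h (fp_assoc R A A A (fp_map R ?F A \<Phi> id (fp_left R A A a))) = copair D u v (\<Phi> a)"
      using a by (simp add: fp_map_def as copair_left[OF A A H l' r'] copair_left[OF F A G l r]
          hom_closed[OF \<Phi>])
    show "?h (fp_assoc R A A A (fp_map R ?F A \<Phi> id (fp_right R A A a))) = w a"
      using a by (simp add: fp_map_def as copair_right[OF A A H l' r'] copair_right[OF F A G l r]
          copair_right[OF A F D u vw] hom_closed[OF fp_right_hom[OF A A]]
          copair_right[OF A A D v w])
  qed
  moreover have "fp_assoc R A A A (fp_map R ?F A \<Phi> id (\<Phi> x)) = fp_map R A ?F id \<Phi> (\<Phi> x)"
    using com x by (simp add: comonoid_def)
  ultimately show ?thesis by simp
qed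


section \<open>Tensor products of modules\<close>

text \<open>
  Named so that equations between classes are treated as equations, not as inclusions of sets.
\<close>

definition tensor_class ::
  "('r, 'l) ring_scheme \<Rightarrow> ('r, 'b, 'm) module_scheme \<Rightarrow> ('r, 'c, 'n) module_scheme \<Rightarrow>
   ('b, 'c) tensor_term \<Rightarrow> ('b, 'c) tensor_term set" where
  "tensor_class R B C t = tensor_cong R B C `` {t}"

definition tensor_scale ::
  "('r, 'b, 'm) module_scheme \<Rightarrow> 'r \<Rightarrow> ('b, 'c) tensor_term \<Rightarrow> ('b, 'c) tensor_term" where
  "tensor_scale B r = map_tensor_term (\<lambda>b. r \<odot>\<^bsub>B\<^esub> b) id"

text \<open>
  The module structure of the tensor product and its multiplication are given by two different
  records; they share the additive structure, hence sums and induced maps.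
\<close>

lemma tensor_product_finsum:
  "finsum (tensor_module R B C) = finsum (tensor_product R B C)"
  unfolding finsum_def by (simp add: tensor_product_def)

lemma tensor_product_eval:
  "tensor_eval (tensor_module R B C) f t = tensor_eval (tensor_product R B C) f t"
  by (induction t) (simp_all add: tensor_product_def)

lemma tensor_product_lift:
  "tensor_lift (tensor_module R B C) f X = tensor_lift (tensor_product R B C) f X"
  by (simp add: tensor_lift_def tensor_product_eval)

lemma tensor_product_smult: "smult (tensor_module R B C) = smult (tensor_product R B C)"
  by (simp add: tensor_product_def)

context
  fixes R :: "('r, 'l) ring_scheme"
    and B :: "('r, 'b, 'm) graded_alg_scheme"
    and C :: "('r, 'c, 'n) graded_alg_scheme"
  assumes B: "module R B" and C: "module R C"
begin

interpretation B: module R B by (fact B)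
interpretation C: module R C by (fact C)

lemma tensor_cong_terms:
  "(s, t) \<in> tensor_cong R B C \<Longrightarrow> s \<in> tensor_terms B C \<and> t \<in> tensor_terms B C"
  by (induction rule: tensor_cong.induct) (auto intro!: tensor_terms.intros)

lemma tensor_equiv: "equiv (tensor_terms B C) (tensor_cong R B C)"
  by (rule equivI)
    (auto intro!: refl_onI symI transI intro: tensor_cong.intros(1-3) dest: tensor_cong_terms)

lemma tensor_class_eq: "(s, t) \<in> tensor_cong R B C \<Longrightarrow> tensor_class R B C s = tensor_class R B C t"
  unfolding tensor_class_def by (rule equiv_class_eq[OF tensor_equiv])

lemma tensor_class_self: "t \<in> tensor_terms B C \<Longrightarrow> t \<in> tensor_class R B C t"
  by (simp add: tensor_class_def tensor_cong.refl)

lemma tensor_class_memD: "s \<in> tensor_class R B C t \<Longrightarrow> (t, s) \<in> tensor_cong R B C"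
  by (simp add: tensor_class_def)

lemma tensor_carrier_cases:
  assumes "X \<in> carrier (tensor_product R B C)"
  obtains t where "t \<in> tensor_terms B C" "X = tensor_class R B C t"
  using assms
  by (auto simp: tensor_product_def tensor_module_def tensor_class_def elim: quotientE)

lemma tensor_class_closed:
  "t \<in> tensor_terms B C \<Longrightarrow> tensor_class R B C t \<in> carrier (tensor_product R B C)"
  by (simp add: tensor_product_def tensor_module_def tensor_class_def quotientI)

lemma pure_tensor_class: "pure_tensor R B C b c = tensor_class R B C (TPure b c)"
  by (simp add: pure_tensor_def tensor_class_def)

lemma tensor_class_add:
  assumes "s \<in> tensor_terms B C" "t \<in> tensor_terms B C"
  shows "tensor_class R B C s \<oplus>\<^bsub>tensor_product R B C\<^esub> tensor_class R B C t =
    tensor_class R B C (TAdd s t)"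
  unfolding tensor_product_def tensor_module_def graded_alg.simps module.simps ring.simps
    monoid.simps tensor_class_def[symmetric]
  by (rule UN_const_eq[of s], use assms tensor_class_self in simp, rule UN_const_eq[of t],
      use assms tensor_class_self in simp, rule tensor_class_eq[symmetric],
      rule tensor_cong.cong_add) (erule tensor_class_memD)+

lemma tensor_scale_simps:
  "tensor_scale B r (TPure b c) = TPure (r \<odot>\<^bsub>B\<^esub> b) c"
  "tensor_scale B r (TAdd s t) = TAdd (tensor_scale B r s) (tensor_scale B r t)"
  by (simp_all add: tensor_scale_def)

lemma tensor_scale_term:
  assumes "t \<in> tensor_terms B C" "r \<in> carrier R"
  shows "tensor_scale B r t \<in> tensor_terms B C"
  using assms by induction (auto simp: tensor_scale_simps intro: tensor_terms.intros)

lemma tensor_cong_scale: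
  assumes "r \<in> carrier R"
  shows "(s, t) \<in> tensor_cong R B C \<Longrightarrow>
    (tensor_scale B r s, tensor_scale B r t) \<in> tensor_cong R B C"
proof (induction rule: tensor_cong.induct)
  case (pure_scale r' b c)
  then have "r \<odot>\<^bsub>B\<^esub> (r' \<odot>\<^bsub>B\<^esub> b) = r' \<odot>\<^bsub>B\<^esub> (r \<odot>\<^bsub>B\<^esub> b)"
    using assms by (simp add: B.smult_assoc1[symmetric] B.R.m_comm)
  then show ?case
    using assms pure_scale by (simp add: tensor_scale_simps tensor_cong.pure_scale)
next
  case (trans s t u)
  then show ?case by (blast intro: tensor_cong.trans)
next
  case (sym s t)
  then show ?case by (blast intro: tensor_cong.sym)
qed (simp_all add: tensor_scale_simps tensor_scale_term assms B.smult_r_distr tensor_cong.refl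
    tensor_cong.cong_add tensor_cong.add_assoc tensor_cong.add_comm tensor_cong.add_zero
    tensor_cong.pure_add_left tensor_cong.pure_add_right)

lemma tensor_class_smult:
  assumes "r \<in> carrier R" "t \<in> tensor_terms B C"
  shows "r \<odot>\<^bsub>tensor_product R B C\<^esub> tensor_class R B C t =
    tensor_class R B C (tensor_scale B r t)"
  unfolding tensor_product_def tensor_module_def graded_alg.simps module.simps ring.simps
    monoid.simps tensor_class_def[symmetric] tensor_scale_def[symmetric]
  by (rule UN_const_eq[of t], use assms tensor_class_self in simp,
      rule tensor_class_eq[symmetric], rule tensor_cong_scale)
    (use assms tensor_class_memD in simp_all)

lemma tensor_zero: "\<zero>\<^bsub>tensor_product R B C\<^esub> = pure_tensor R B C \<zero>\<^bsub>B\<^esub> \<zero>\<^bsub>C\<^esub>"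
  by (simp add: tensor_product_def tensor_module_def pure_tensor_def)

lemma tensor_one: "\<one>\<^bsub>tensor_product R B C\<^esub> = pure_tensor R B C \<one>\<^bsub>B\<^esub> \<one>\<^bsub>C\<^esub>"
  by (simp add: tensor_product_def)

lemma pure_tensor_closed:
  "\<lbrakk>b \<in> carrier B; c \<in> carrier C\<rbrakk> \<Longrightarrow> pure_tensor R B C b c \<in> carrier (tensor_product R B C)"
  by (simp add: pure_tensor_class tensor_class_closed tensor_terms.intros)

lemma tensor_induct [consumes 1, case_names pure add]:
  assumes "X \<in> carrier (tensor_product R B C)"
    and pure: "\<And>b c. \<lbrakk>b \<in> carrier B; c \<in> carrier C\<rbrakk> \<Longrightarrow> P (pure_tensor R B C b c)"
    and add: "\<And>X Y. \<lbrakk>X \<in> carrier (tensor_product R B C); Y \<in> carrier (tensor_product R B C);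
      P X; P Y\<rbrakk> \<Longrightarrow> P (X \<oplus>\<^bsub>tensor_product R B C\<^esub> Y)"
  shows "P X"
proof -
  have "P (tensor_class R B C t)" if "t \<in> tensor_terms B C" for t
    using that
  proof induction
    case (1 b c) then show ?case using pure by (simp add: pure_tensor_class)
  next
    case (2 s t) then show ?case
      using add[OF tensor_class_closed tensor_class_closed] by (simp add: tensor_class_add)
  qed
  then show ?thesis using assms(1) by (auto elim!: tensor_carrier_cases)
qed

lemma pure_tensor_add_left:
  "\<lbrakk>b \<in> carrier B; b' \<in> carrier B; c \<in> carrier C\<rbrakk> \<Longrightarrow>
    pure_tensor R B C (b \<oplus>\<^bsub>B\<^esub> b') c =
    pure_tensor R B C b c \<oplus>\<^bsub>tensor_product R B C\<^esub> pure_tensor R B C b' c"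
  by (simp add: pure_tensor_class tensor_class_add tensor_terms.intros tensor_class_eq
      tensor_cong.pure_add_left)

lemma pure_tensor_add_right:
  "\<lbrakk>b \<in> carrier B; c \<in> carrier C; c' \<in> carrier C\<rbrakk> \<Longrightarrow>
    pure_tensor R B C b (c \<oplus>\<^bsub>C\<^esub> c') =
    pure_tensor R B C b c \<oplus>\<^bsub>tensor_product R B C\<^esub> pure_tensor R B C b c'"
  by (simp add: pure_tensor_class tensor_class_add tensor_terms.intros tensor_class_eq
      tensor_cong.pure_add_right)

lemma pure_tensor_smult_left:
  "\<lbrakk>r \<in> carrier R; b \<in> carrier B; c \<in> carrier C\<rbrakk> \<Longrightarrow>
    pure_tensor R B C (r \<odot>\<^bsub>B\<^esub> b) c = r \<odot>\<^bsub>tensor_product R B C\<^esub> pure_tensor R B C b c"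
  by (simp add: pure_tensor_class tensor_class_smult tensor_scale_simps tensor_terms.intros)

lemma pure_tensor_smult_right:
  "\<lbrakk>r \<in> carrier R; b \<in> carrier B; c \<in> carrier C\<rbrakk> \<Longrightarrow>
    pure_tensor R B C b (r \<odot>\<^bsub>C\<^esub> c) = r \<odot>\<^bsub>tensor_product R B C\<^esub> pure_tensor R B C b c"
  by (simp add: pure_tensor_smult_left[symmetric])
    (simp add: pure_tensor_class tensor_class_eq tensor_cong.sym tensor_cong.pure_scale)

lemma pure_tensor_zero_left: "c \<in> carrier C \<Longrightarrow>
    pure_tensor R B C \<zero>\<^bsub>B\<^esub> c = \<zero>\<^bsub>tensor_product R B C\<^esub>"
  using pure_tensor_smult_left[of "\<zero>\<^bsub>R\<^esub>" "\<zero>\<^bsub>B\<^esub>" c] pure_tensor_smult_right[of "\<zero>\<^bsub>R\<^esub>" "\<zero>\<^bsub>B\<^esub>" c]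
  by (simp add: tensor_zero)

lemma tensor_product_module: "module R (tensor_product R B C)"
proof -
  let ?T = "tensor_product R B C"
  note I = tensor_terms.intros
  have am: "abelian_monoid ?T"
    by (rule abelian_monoidI) (auto del: equalityI elim!: tensor_carrier_cases
        simp: tensor_class_add tensor_class_closed I tensor_zero pure_tensor_class
        intro!: tensor_class_eq tensor_cong.add_assoc tensor_cong.add_comm tensor_cong.add_zero)
  interpret T: abelian_monoid ?T by (rule am)
  have sc: "r \<odot>\<^bsub>?T\<^esub> X \<in> carrier ?T" if "r \<in> carrier R" "X \<in> carrier ?T" for r X
    using that by (auto elim!: tensor_carrier_cases simp: tensor_class_smult tensor_class_closed
        tensor_scale_term)
  have srd: "r \<odot>\<^bsub>?T\<^esub> (X \<oplus>\<^bsub>?T\<^esub> Y) = r \<odot>\<^bsub>?T\<^esub> X \<oplus>\<^bsub>?T\<^esub> r \<odot>\<^bsub>?T\<^esub> Y"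
    if "r \<in> carrier R" "X \<in> carrier ?T" "Y \<in> carrier ?T" for r X Y
    using that by (auto elim!: tensor_carrier_cases simp: tensor_class_smult tensor_class_add
        tensor_scale_simps tensor_scale_term I)
  have sld: "(r \<oplus>\<^bsub>R\<^esub> r') \<odot>\<^bsub>?T\<^esub> X = r \<odot>\<^bsub>?T\<^esub> X \<oplus>\<^bsub>?T\<^esub> r' \<odot>\<^bsub>?T\<^esub> X"
    if "X \<in> carrier ?T" "r \<in> carrier R" "r' \<in> carrier R" for r r' X
    using that
  proof (induction X rule: tensor_induct)
    case (pure b c)
    then show ?case by (simp add: pure_tensor_smult_left[symmetric] B.smult_l_distr
          pure_tensor_add_left)
  next
    case (add X Y)
    then show ?case by (simp add: srd sc T.a_ac)
  qed
  have sas: "(r \<otimes>\<^bsub>R\<^esub> r') \<odot>\<^bsub>?T\<^esub> X = r \<odot>\<^bsub>?T\<^esub> (r' \<odot>\<^bsub>?T\<^esub> X)"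
    if "X \<in> carrier ?T" "r \<in> carrier R" "r' \<in> carrier R" for r r' X
    using that
  proof (induction X rule: tensor_induct)
    case (pure b c)
    then show ?case by (simp add: pure_tensor_smult_left[symmetric] B.smult_assoc1)
  next
    case (add X Y)
    then show ?case by (simp add: srd sc)
  qed
  have s1: "\<one>\<^bsub>R\<^esub> \<odot>\<^bsub>?T\<^esub> X = X" if "X \<in> carrier ?T" for X
    using that
  proof (induction X rule: tensor_induct)
    case (pure b c)
    then show ?case by (simp add: pure_tensor_smult_left[symmetric])
  next
    case (add X Y)
    then show ?case by (simp add: srd)
  qed
  \<comment> \<open>The relations of the tensor product contain no inverses; \<open>(-1) X\<close> is one, because
    \<open>(-1) X + X = 0 X\<close>.\<close>
  have s0: "\<zero>\<^bsub>R\<^esub> \<odot>\<^bsub>?T\<^esub> X = \<zero>\<^bsub>?T\<^esub>" if "X \<in> carrier ?T" for X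
    using that
  proof (induction X rule: tensor_induct)
    case (pure b c)
    then show ?case by (simp add: pure_tensor_smult_left[symmetric] pure_tensor_zero_left)
  next
    case (add X Y)
    then show ?case by (simp add: srd)
  qed
  have ag: "abelian_group ?T"
  proof (rule abelian_groupI)
    fix X assume X: "X \<in> carrier ?T"
    have "(\<ominus>\<^bsub>R\<^esub> \<one>\<^bsub>R\<^esub> \<oplus>\<^bsub>R\<^esub> \<one>\<^bsub>R\<^esub>) \<odot>\<^bsub>?T\<^esub> X = (\<ominus>\<^bsub>R\<^esub> \<one>\<^bsub>R\<^esub>) \<odot>\<^bsub>?T\<^esub> X \<oplus>\<^bsub>?T\<^esub> X"
      using X by (simp only: sld s1 B.R.a_inv_closed B.R.one_closed)
    then have "(\<ominus>\<^bsub>R\<^esub> \<one>\<^bsub>R\<^esub>) \<odot>\<^bsub>?T\<^esub> X \<oplus>\<^bsub>?T\<^esub> X = \<zero>\<^bsub>?T\<^esub>"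
      using s0[OF X] B.R.l_neg[OF B.R.one_closed] by simp
    then show "\<exists>Y \<in> carrier ?T. Y \<oplus>\<^bsub>?T\<^esub> X = \<zero>\<^bsub>?T\<^esub>"
      using sc[OF _ X] by blast
  qed (auto simp: T.a_ac)
  show ?thesis
    by (rule moduleI[OF B.is_cring ag]) (simp_all add: sc sld srd sas s1)
qed

lemma pure_tensor_bilinear:
  "pure_tensor R B C \<in> bilinear_maps R B C (tensor_product R B C)"
  by (intro bilinear_mapsI linear_mapsI)
    (simp_all add: pure_tensor_closed pure_tensor_add_left pure_tensor_add_right
      pure_tensor_smult_left pure_tensor_smult_right)

lemma pure_tensor_zero_right:
  assumes "b \<in> carrier B"
  shows "pure_tensor R B C b \<zero>\<^bsub>C\<^esub> = \<zero>\<^bsub>tensor_product R B C\<^esub>"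
  by (rule linear_zero[OF C tensor_product_module bilinear_right[OF pure_tensor_bilinear assms]])

lemma tensor_linear_eq:
  assumes f: "f \<in> linear_maps R (tensor_product R B C) M"
    and g: "g \<in> linear_maps R (tensor_product R B C) M"
    and eq: "\<And>b c. \<lbrakk>b \<in> carrier B; c \<in> carrier C\<rbrakk> \<Longrightarrow>
      f (pure_tensor R B C b c) = g (pure_tensor R B C b c)"
    and X: "X \<in> carrier (tensor_product R B C)"
  shows "f X = g X"
  using X by (induction X rule: tensor_induct) (simp_all add: eq linear_add[OF f] linear_add[OF g])

context
  fixes M :: "('r, 'd, 'k) module_scheme" and \<beta>
  assumes M: "module R M" and \<beta>: "\<beta> \<in> bilinear_maps R B C M"
begin

interpretation M: module R M by (fact M)

lemma tensor_eval_closed: "t \<in> tensor_terms B C \<Longrightarrow> tensor_eval M \<beta> t \<in> carrier M"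
  by (induction rule: tensor_terms.induct)
    (simp_all add: linear_closed[OF bilinear_right[OF \<beta>]])

lemma tensor_eval_cong: "(s, t) \<in> tensor_cong R B C \<Longrightarrow> tensor_eval M \<beta> s = tensor_eval M \<beta> t"
proof (induction rule: tensor_cong.induct)
  case (add_zero t)
  have "\<beta> \<zero>\<^bsub>B\<^esub> \<zero>\<^bsub>C\<^esub> = \<zero>\<^bsub>M\<^esub>"
    by (rule linear_zero[OF C M bilinear_right[OF \<beta>]]) simp
  then show ?case using tensor_eval_closed[OF add_zero] by simp
qed (simp_all add: tensor_eval_closed M.a_ac linear_add[OF bilinear_left[OF \<beta>]]
    linear_add[OF bilinear_right[OF \<beta>]] linear_smult[OF bilinear_left[OF \<beta>]]
    linear_smult[OF bilinear_right[OF \<beta>]])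

lemma tensor_lift_class:
  assumes "t \<in> tensor_terms B C"
  shows "tensor_lift M \<beta> (tensor_class R B C t) = tensor_eval M \<beta> t"
proof -
  have "(SOME s. s \<in> tensor_class R B C t) \<in> tensor_class R B C t"
    using tensor_class_self[OF assms] by (rule someI)
  then show ?thesis unfolding tensor_lift_def using tensor_eval_cong[OF tensor_class_memD] by simp
qed

lemma tensor_lift_pure:
  "\<lbrakk>b \<in> carrier B; c \<in> carrier C\<rbrakk> \<Longrightarrow> tensor_lift M \<beta> (pure_tensor R B C b c) = \<beta> b c"
  by (simp add: pure_tensor_class tensor_lift_class tensor_terms.intros)

lemma tensor_lift_linear: "tensor_lift M \<beta> \<in> linear_maps R (tensor_product R B C) M"
proof (rule linear_mapsI)
  interpret T: module R "tensor_product R B C" by (rule tensor_product_module)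
  let ?T = "tensor_product R B C"
  show plus: "tensor_lift M \<beta> (X \<oplus>\<^bsub>?T\<^esub> Y) = tensor_lift M \<beta> X \<oplus>\<^bsub>M\<^esub> tensor_lift M \<beta> Y"
    if "X \<in> carrier ?T" "Y \<in> carrier ?T" for X Y
    using that by (auto elim!: tensor_carrier_cases
        simp: tensor_class_add tensor_lift_class tensor_terms.intros)
  show cl: "tensor_lift M \<beta> X \<in> carrier M" if "X \<in> carrier ?T" for X
    using that by (auto elim!: tensor_carrier_cases simp: tensor_lift_class tensor_eval_closed)
  show "tensor_lift M \<beta> (r \<odot>\<^bsub>?T\<^esub> X) = r \<odot>\<^bsub>M\<^esub> tensor_lift M \<beta> X"
    if "r \<in> carrier R" "X \<in> carrier ?T" for r X
    using that(2)
  proof (induction X rule: tensor_induct)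
    case (pure b c)
    then show ?case
      using that(1) by (simp add: pure_tensor_smult_left[symmetric] tensor_lift_pure
          linear_smult[OF bilinear_left[OF \<beta>]])
  next
    case (add X Y)
    then show ?case
      using that(1) by (simp add: T.smult_r_distr M.smult_r_distr plus cl)
  qed
qed

end

text \<open>
  The multiplication of the tensor product is an iterated induced map, the inner one depending on
  the other argument as a parameter; this makes it bilinear.
\<close>

lemma tensor_lift_param_linear:
  assumes "module R L" "module R M"
    and \<beta>: "\<And>x. x \<in> carrier L \<Longrightarrow> \<beta> x \<in> bilinear_maps R B C M"
    and lin: "\<And>b c. \<lbrakk>b \<in> carrier B; c \<in> carrier C\<rbrakk> \<Longrightarrow> (\<lambda>x. \<beta> x b c) \<in> linear_maps R L M"
    and Y: "Y \<in> carrier (tensor_product R B C)"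
  shows "(\<lambda>x. tensor_lift M (\<beta> x) Y) \<in> linear_maps R L M"
  using Y
proof (induction Y rule: tensor_induct)
  case (pure b c)
  show ?case
    by (rule linear_cong[OF \<open>module R L\<close> lin[OF pure]])
      (simp add: tensor_lift_pure[OF \<open>module R M\<close> \<beta>] pure)
next
  case (add X Y)
  show ?case
    by (rule linear_cong[OF \<open>module R L\<close> linear_plus[OF \<open>module R M\<close> add(3,4)]])
      (simp add: linear_add[OF tensor_lift_linear[OF \<open>module R M\<close> \<beta>]] add)
qed

lemma linear_tensor_lift:
  assumes M: "module R M" and N: "module R N"
    and \<beta>: "\<beta> \<in> bilinear_maps R B C M" and h: "h \<in> linear_maps R M N"
    and X: "X \<in> carrier (tensor_product R B C)"
  shows "h (tensor_lift M \<beta> X) = tensor_lift N (\<lambda>b c. h (\<beta> b c)) X"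
proof -
  have h\<beta>: "(\<lambda>b c. h (\<beta> b c)) \<in> bilinear_maps R B C N"
    by (intro bilinear_mapsI linear_comp[OF _ h] bilinear_left[OF \<beta>] bilinear_right[OF \<beta>])
  show ?thesis
    by (rule tensor_linear_eq[OF linear_comp[OF tensor_lift_linear[OF M \<beta>] h]
          tensor_lift_linear[OF N h\<beta>] _ X])
      (simp add: tensor_lift_pure[OF M \<beta>] tensor_lift_pure[OF N h\<beta>])
qed

lemma tensor_lift_cong:
  assumes M: "module R M"
    and \<beta>: "\<beta> \<in> bilinear_maps R B C M" and \<gamma>: "\<gamma> \<in> bilinear_maps R B C M"
    and "\<And>b c. \<lbrakk>b \<in> carrier B; c \<in> carrier C\<rbrakk> \<Longrightarrow> \<beta> b c = \<gamma> b c"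
    and "X \<in> carrier (tensor_product R B C)"
  shows "tensor_lift M \<beta> X = tensor_lift M \<gamma> X"
  by (rule tensor_linear_eq[OF tensor_lift_linear[OF M \<beta>] tensor_lift_linear[OF M \<gamma>]])
    (simp_all add: tensor_lift_pure[OF M \<beta>] tensor_lift_pure[OF M \<gamma>] assms)

end


section \<open>Tensor products of graded algebras\<close>

context
  fixes R :: "('r, 'l) ring_scheme"
    and B :: "('r, 'b, 'm) graded_alg_scheme"
    and C :: "('r, 'c, 'n) graded_alg_scheme"
  assumes B: "graded_algebra R B" and C: "graded_algebra R C"
begin

interpretation B: graded_algebra R B by (fact B)
interpretation C: graded_algebra R C by (fact C)

lemmas BC_modules = B.module_axiom C.module_axiom

interpretation T: module R "tensor_product R B C" by (rule tensor_product_module[OF BC_modules])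

lemmas tensor_bilinear = pure_tensor_bilinear[OF BC_modules]
lemmas tensor_pure_closed = pure_tensor_closed[OF BC_modules]

lemma tensor_homogeneous_induct [consumes 1, case_names pure add]:
  assumes "X \<in> carrier (tensor_product R B C)"
    and pure: "\<And>m n b c. \<lbrakk>b \<in> grade B m; c \<in> grade C n\<rbrakk> \<Longrightarrow> P (pure_tensor R B C b c)"
    and add: "\<And>X Y. \<lbrakk>X \<in> carrier (tensor_product R B C); Y \<in> carrier (tensor_product R B C);
      P X; P Y\<rbrakk> \<Longrightarrow> P (X \<oplus>\<^bsub>tensor_product R B C\<^esub> Y)"
  shows "P X"
  using assms(1)
proof (induction X rule: tensor_induct[OF BC_modules, consumes 1, case_names pure add])
  case bc: (pure b c)
  show ?case using bc(1)
  proof (induction b rule: B.homogeneous_induct)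
    case b: (hom m b)
    then have bB: "b \<in> carrier B" by (auto intro: B.grade_closed)
    show ?case using bc(2)
    proof (induction c rule: C.homogeneous_induct)
      case (hom n c)
      then show ?case using b pure by blast
    next
      case (add c c')
      then show ?case using bB
        by (simp add: pure_tensor_add_right[OF BC_modules] assms(3) tensor_pure_closed)
    qed
  next
    case (add b b')
    then show ?case using bc
      by (simp add: pure_tensor_add_left[OF BC_modules] assms(3) tensor_pure_closed)
  qed
next
  case (add X Y)
  then show ?case by (rule assms(3))
qed

text \<open>
  Indices outside the supports contribute zero, so that one pair of index sets serves for finitely
  many arguments at once.
\<close>

lemma pure_tensor_mult_sum:
  assumes "b \<in> carrier B" "c \<in> carrier C" "b' \<in> carrier B" "c' \<in> carrier C"
    and "finite I" "{i. component C c i \<noteq> \<zero>\<^bsub>C\<^esub>} \<subseteq> I"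
    and "finite J" "{j. component B b' j \<noteq> \<zero>\<^bsub>B\<^esub>} \<subseteq> J"
  shows "pure_tensor_mult R B C b c b' c' =
    finsum (tensor_product R B C)
      (\<lambda>k. koszul_sign R (fst k) (snd k) \<odot>\<^bsub>tensor_product R B C\<^esub>
        pure_tensor R B C (b \<otimes>\<^bsub>B\<^esub> component B b' (snd k)) (component C c (fst k) \<otimes>\<^bsub>C\<^esub> c'))
      (I \<times> J)"
proof -
  have "component C c i \<otimes>\<^bsub>C\<^esub> c' = \<zero>\<^bsub>C\<^esub> \<or> b \<otimes>\<^bsub>B\<^esub> component B b' j = \<zero>\<^bsub>B\<^esub>"
    if "(i, j) \<notin> {i. component C c i \<noteq> \<zero>\<^bsub>C\<^esub>} \<times> {j. component B b' j \<noteq> \<zero>\<^bsub>B\<^esub>}" for i j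
    using that assms by auto
  moreover have cl: "b \<otimes>\<^bsub>B\<^esub> component B b' j \<in> carrier B" "component C c i \<otimes>\<^bsub>C\<^esub> c' \<in> carrier C" for i j
    using assms B.component_closed C.component_closed by auto
  ultimately have z: "koszul_sign R i j \<odot>\<^bsub>tensor_product R B C\<^esub>
      pure_tensor R B C (b \<otimes>\<^bsub>B\<^esub> component B b' j) (component C c i \<otimes>\<^bsub>C\<^esub> c') =
      \<zero>\<^bsub>tensor_product R B C\<^esub>"
    if "(i, j) \<notin> {i. component C c i \<noteq> \<zero>\<^bsub>C\<^esub>} \<times> {j. component B b' j \<noteq> \<zero>\<^bsub>B\<^esub>}" for i j
    using that by (metis pure_tensor_zero_left[OF BC_modules] pure_tensor_zero_right[OF BC_modules]
        T.smult_r_null B.R.koszul_sign_closed)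
  show ?thesis
    unfolding pure_tensor_mult_def tensor_product_finsum tensor_product_smult
      koszul_sign_def[symmetric] case_prod_unfold
  proof (rule T.add.finprod_mono_neutral_cong_left)
    let ?S = "{i. component C c i \<noteq> \<zero>\<^bsub>C\<^esub>} \<times> {j. component B b' j \<noteq> \<zero>\<^bsub>B\<^esub>}"
    show "finite (I \<times> J)" "?S \<subseteq> I \<times> J" using assms by auto
    fix k assume "k \<in> I \<times> J - ?S"
    then have "(fst k, snd k) \<notin> ?S" by auto
    then show "koszul_sign R (fst k) (snd k) \<odot>\<^bsub>tensor_product R B C\<^esub>
        pure_tensor R B C (b \<otimes>\<^bsub>B\<^esub> component B b' (snd k)) (component C c (fst k) \<otimes>\<^bsub>C\<^esub> c') =
        \<zero>\<^bsub>tensor_product R B C\<^esub>"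
      by (rule z)
  qed (use cl in \<open>auto intro!: tensor_pure_closed\<close>)
qed

lemma pure_tensor_mult_homogeneous:
  assumes "b \<in> carrier B" "c \<in> grade C i" "b' \<in> grade B j" "c' \<in> carrier C"
  shows "pure_tensor_mult R B C b c b' c' =
    koszul_sign R i j \<odot>\<^bsub>tensor_product R B C\<^esub> pure_tensor R B C (b \<otimes>\<^bsub>B\<^esub> b') (c \<otimes>\<^bsub>C\<^esub> c')"
proof -
  have cl: "c \<in> carrier C" "b' \<in> carrier B" using assms B.grade_closed C.grade_closed by auto
  have "pure_tensor_mult R B C b c b' c' = finsum (tensor_product R B C)
      (\<lambda>k. koszul_sign R (fst k) (snd k) \<odot>\<^bsub>tensor_product R B C\<^esub>
        pure_tensor R B C (b \<otimes>\<^bsub>B\<^esub> component B b' (snd k)) (component C c (fst k) \<otimes>\<^bsub>C\<^esub> c'))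
      ({i} \<times> {j})"
    by (rule pure_tensor_mult_sum)
      (use assms cl in \<open>auto simp: B.component_homogeneous C.component_homogeneous split: if_splits\<close>)
  then show ?thesis
    using assms cl T.finsum_single[of "\<lambda>k. koszul_sign R (fst k) (snd k) \<odot>\<^bsub>tensor_product R B C\<^esub>
        pure_tensor R B C (b \<otimes>\<^bsub>B\<^esub> component B b' (snd k)) (component C c (fst k) \<otimes>\<^bsub>C\<^esub> c')" "(i, j)"]
    by (simp add: B.component_homogeneous C.component_homogeneous tensor_pure_closed)
qed

text \<open>
  For fixed index sets every summand is linear in each argument. In \<open>b\<close> and \<open>c'\<close> the supports do
  not vary; in \<open>c\<close> and \<open>b'\<close> they do, and linearity is checked on finite sets of arguments.
\<close>

lemma pure_tensor_mult_linear:
  assumes "b \<in> carrier B" "c \<in> carrier C" "b' \<in> carrier B" "c' \<in> carrier C"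
  shows "(\<lambda>b. pure_tensor_mult R B C b c b' c') \<in> linear_maps R B (tensor_product R B C)"
    and "(\<lambda>c. pure_tensor_mult R B C b c b' c') \<in> linear_maps R C (tensor_product R B C)"
    and "(\<lambda>b'. pure_tensor_mult R B C b c b' c') \<in> linear_maps R B (tensor_product R B C)"
    and "(\<lambda>c'. pure_tensor_mult R B C b c b' c') \<in> linear_maps R C (tensor_product R B C)"
proof -
  let ?T = "tensor_product R B C"
  let ?f = "\<lambda>b c b' c' k. koszul_sign R (fst k) (snd k) \<odot>\<^bsub>?T\<^esub>
      pure_tensor R B C (b \<otimes>\<^bsub>B\<^esub> component B b' (snd k)) (component C c (fst k) \<otimes>\<^bsub>C\<^esub> c')"
  let ?sB = "\<lambda>b. {j. component B b j \<noteq> \<zero>\<^bsub>B\<^esub>}" and ?sC = "\<lambda>c. {i. component C c i \<noteq> \<zero>\<^bsub>C\<^esub>}"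
  note T = T.module_axioms
  note Bm = bilinear_left[OF B.mult_bilinear] bilinear_right[OF B.mult_bilinear]
  note Cm = bilinear_left[OF C.mult_bilinear] bilinear_right[OF C.mult_bilinear]
  have fin: "finite (?sB x)" "finite (?sC y)" if "x \<in> carrier B" "y \<in> carrier C" for x y
    using that B.component_finite C.component_finite by auto
  have cl: "component B b' k \<in> carrier B" "component C c k \<in> carrier C" for k
    using assms B.component_closed C.component_closed by auto
  have l1: "(\<lambda>b. finsum ?T (?f b c b' c') K) \<in> linear_maps R B ?T" if "finite K" for K
    by (rule linear_sum[OF T that], rule linear_scale[OF T],
        rule linear_comp[OF Bm(1) bilinear_left[OF tensor_bilinear]])
      (use cl assms in auto)
  have l2: "(\<lambda>c. finsum ?T (?f b c b' c') K) \<in> linear_maps R C ?T" if "finite K" for K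
    by (rule linear_sum[OF T that], rule linear_scale[OF T],
        rule linear_comp[OF linear_comp[OF C.component_linear Cm(1)]
          bilinear_right[OF tensor_bilinear]])
      (use cl assms in auto)
  have l3: "(\<lambda>b'. finsum ?T (?f b c b' c') K) \<in> linear_maps R B ?T" if "finite K" for K
    by (rule linear_sum[OF T that], rule linear_scale[OF T],
        rule linear_comp[OF linear_comp[OF B.component_linear Bm(2)]
          bilinear_left[OF tensor_bilinear]])
      (use cl assms in auto)
  have l4: "(\<lambda>c'. finsum ?T (?f b c b' c') K) \<in> linear_maps R C ?T" if "finite K" for K
    by (rule linear_sum[OF T that], rule linear_scale[OF T],
        rule linear_comp[OF Cm(2) bilinear_right[OF tensor_bilinear]])
      (use cl assms in auto)
  have finp: "finite (?sC c \<times> ?sB b')" using fin[OF assms(3,2)] by simp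
  show "(\<lambda>b. pure_tensor_mult R B C b c b' c') \<in> linear_maps R B ?T"
    by (rule linear_cong[OF B.module_axiom l1[OF finp]], rule pure_tensor_mult_sum)
      (use assms fin in auto)
  show "(\<lambda>c'. pure_tensor_mult R B C b c b' c') \<in> linear_maps R C ?T"
    by (rule linear_cong[OF C.module_axiom l4[OF finp]], rule pure_tensor_mult_sum)
      (use assms fin in auto)
  show "(\<lambda>c. pure_tensor_mult R B C b c b' c') \<in> linear_maps R C ?T"
  proof (rule linear_mapsI_local[OF C.module_axiom])
    fix S assume S: "finite S" "S \<subseteq> carrier C"
    have finS: "finite (\<Union>x\<in>S. ?sC x)" using S fin(2)[OF assms(1)] by blast
    show "\<exists>g \<in> linear_maps R C ?T. \<forall>x \<in> S. pure_tensor_mult R B C b x b' c' = g x"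
    proof (rule bexI[OF _ l2], rule ballI)
      show "finite ((\<Union>x\<in>S. ?sC x) \<times> ?sB b')" using finS fin[OF assms(3,2)] by simp
      fix x assume "x \<in> S"
      then show "pure_tensor_mult R B C b x b' c' =
          finsum ?T (?f b x b' c') ((\<Union>x\<in>S. ?sC x) \<times> ?sB b')"
        using S finS fin[OF assms(3,2)] assms by (intro pure_tensor_mult_sum) auto
    qed
  qed
  show "(\<lambda>b'. pure_tensor_mult R B C b c b' c') \<in> linear_maps R B ?T"
  proof (rule linear_mapsI_local[OF B.module_axiom])
    fix S assume S: "finite S" "S \<subseteq> carrier B"
    have finS: "finite (\<Union>x\<in>S. ?sB x)" using S fin(1)[OF _ assms(2)] by blast
    show "\<exists>g \<in> linear_maps R B ?T. \<forall>x \<in> S. pure_tensor_mult R B C b c x c' = g x"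
    proof (rule bexI[OF _ l3], rule ballI)
      show "finite (?sC c \<times> (\<Union>x\<in>S. ?sB x))" using finS fin[OF assms(3,2)] by simp
      fix x assume "x \<in> S"
      then show "pure_tensor_mult R B C b c x c' =
          finsum ?T (?f b c x c') (?sC c \<times> (\<Union>x\<in>S. ?sB x))"
        using S finS fin[OF assms(3,2)] assms by (intro pure_tensor_mult_sum) auto
    qed
  qed
qed

lemma pure_tensor_mult_bilinear:
  "\<lbrakk>b \<in> carrier B; c \<in> carrier C\<rbrakk> \<Longrightarrow>
    pure_tensor_mult R B C b c \<in> bilinear_maps R B C (tensor_product R B C)"
  by (intro bilinear_mapsI pure_tensor_mult_linear) auto

lemma tensor_mult_lift:
  "X \<otimes>\<^bsub>tensor_product R B C\<^esub> Y =
    tensor_lift (tensor_product R B C)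
      (\<lambda>b c. tensor_lift (tensor_product R B C) (pure_tensor_mult R B C b c) Y) X"
  by (simp add: tensor_product_lift[symmetric]) (simp add: tensor_product_def)

lemma tensor_mult_inner_bilinear:
  assumes "Y \<in> carrier (tensor_product R B C)"
  shows "(\<lambda>b c. tensor_lift (tensor_product R B C) (pure_tensor_mult R B C b c) Y)
    \<in> bilinear_maps R B C (tensor_product R B C)"
proof (rule bilinear_mapsI)
  fix b assume "b \<in> carrier B"
  then show "(\<lambda>c. tensor_lift (tensor_product R B C) (pure_tensor_mult R B C b c) Y)
      \<in> linear_maps R C (tensor_product R B C)"
    by (intro tensor_lift_param_linear[OF BC_modules C.module_axiom T.module_axioms _ _ assms]
        pure_tensor_mult_bilinear pure_tensor_mult_linear) auto
next
  fix c assume "c \<in> carrier C"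
  then show "(\<lambda>b. tensor_lift (tensor_product R B C) (pure_tensor_mult R B C b c) Y)
      \<in> linear_maps R B (tensor_product R B C)"
    by (intro tensor_lift_param_linear[OF BC_modules B.module_axiom T.module_axioms _ _ assms]
        pure_tensor_mult_bilinear pure_tensor_mult_linear) auto
qed

lemma tensor_mult_bilinear:
  "(\<lambda>X Y. X \<otimes>\<^bsub>tensor_product R B C\<^esub> Y) \<in>
    bilinear_maps R (tensor_product R B C) (tensor_product R B C) (tensor_product R B C)"
proof (rule bilinear_mapsI)
  let ?T = "tensor_product R B C"
  note T = T.module_axioms
  fix X assume X: "X \<in> carrier ?T"
  show "(\<lambda>Y. X \<otimes>\<^bsub>?T\<^esub> Y) \<in> linear_maps R ?T ?T"
    unfolding tensor_mult_lift
    by (rule tensor_lift_param_linear[OF BC_modules T T _ _ X])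
      (auto intro: tensor_mult_inner_bilinear
        tensor_lift_linear[OF BC_modules T pure_tensor_mult_bilinear])
  show "(\<lambda>Y. Y \<otimes>\<^bsub>?T\<^esub> X) \<in> linear_maps R ?T ?T"
    unfolding tensor_mult_lift
    by (rule tensor_lift_linear[OF BC_modules T tensor_mult_inner_bilinear[OF X]])
qed

lemma tensor_mult_pure:
  assumes "b \<in> carrier B" "c \<in> grade C i" "b' \<in> grade B j" "c' \<in> carrier C"
  shows "pure_tensor R B C b c \<otimes>\<^bsub>tensor_product R B C\<^esub> pure_tensor R B C b' c' =
    koszul_sign R i j \<odot>\<^bsub>tensor_product R B C\<^esub> pure_tensor R B C (b \<otimes>\<^bsub>B\<^esub> b') (c \<otimes>\<^bsub>C\<^esub> c')"
proof -
  have cl: "c \<in> carrier C" "b' \<in> carrier B" using assms B.grade_closed C.grade_closed by auto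
  note T = T.module_axioms
  have "pure_tensor R B C b c \<otimes>\<^bsub>tensor_product R B C\<^esub> pure_tensor R B C b' c' =
      pure_tensor_mult R B C b c b' c'"
    using assms cl unfolding tensor_mult_lift
    by (simp add: tensor_lift_pure[OF BC_modules T tensor_mult_inner_bilinear] tensor_pure_closed
        tensor_lift_pure[OF BC_modules T pure_tensor_mult_bilinear])
  then show ?thesis using pure_tensor_mult_homogeneous[OF assms] by simp
qed

lemmas tensor_mult_linear_left = bilinear_left[OF tensor_mult_bilinear]
lemmas tensor_mult_linear_right = bilinear_right[OF tensor_mult_bilinear]

text \<open>
  There is no sign, and so no homogeneity condition, when one of the two elements that are moved
  past each other is the unit, which has degree 0.
\<close>

lemma tensor_mult_left_factor:
  assumes "a \<in> carrier B" "b \<in> carrier B" "c \<in> carrier C"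
  shows "pure_tensor R B C a \<one>\<^bsub>C\<^esub> \<otimes>\<^bsub>tensor_product R B C\<^esub> pure_tensor R B C b c =
    pure_tensor R B C (a \<otimes>\<^bsub>B\<^esub> b) c"
  using assms(2)
proof (induction b rule: B.homogeneous_induct)
  case (hom n b)
  then show ?case
    using tensor_mult_pure[OF assms(1) C.grade_one hom assms(3)] assms
    by (simp add: B.grade_closed tensor_pure_closed)
next
  case (add x y)
  have lin: "(\<lambda>b. pure_tensor R B C a \<one>\<^bsub>C\<^esub> \<otimes>\<^bsub>tensor_product R B C\<^esub> pure_tensor R B C b c)
      \<in> linear_maps R B (tensor_product R B C)"
    by (rule linear_comp[OF bilinear_left[OF tensor_bilinear] tensor_mult_linear_right])
      (use assms tensor_pure_closed in auto)
  show ?case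
    using linear_add[OF lin add(1,2)] add assms
    by (simp add: B.r_distr pure_tensor_add_left[OF BC_modules])
qed

lemma tensor_mult_right_factor:
  assumes "b \<in> carrier B" "c \<in> carrier C" "d \<in> carrier C"
  shows "pure_tensor R B C b c \<otimes>\<^bsub>tensor_product R B C\<^esub> pure_tensor R B C \<one>\<^bsub>B\<^esub> d =
    pure_tensor R B C b (c \<otimes>\<^bsub>C\<^esub> d)"
  using assms(2)
proof (induction c rule: C.homogeneous_induct)
  case (hom n c)
  then show ?case
    using tensor_mult_pure[OF assms(1) hom B.grade_one assms(3)] assms
    by (simp add: C.grade_closed tensor_pure_closed)
next
  case (add x y)
  have lin: "(\<lambda>c. pure_tensor R B C b c \<otimes>\<^bsub>tensor_product R B C\<^esub> pure_tensor R B C \<one>\<^bsub>B\<^esub> d)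
      \<in> linear_maps R C (tensor_product R B C)"
    by (rule linear_comp[OF bilinear_right[OF tensor_bilinear] tensor_mult_linear_left])
      (use assms tensor_pure_closed in auto)
  show ?case
    using linear_add[OF lin add(1,2)] add assms
    by (simp add: C.l_distr pure_tensor_add_right[OF BC_modules])
qed

lemma tensor_mult_closed:
  "\<lbrakk>X \<in> carrier (tensor_product R B C); Y \<in> carrier (tensor_product R B C)\<rbrakk> \<Longrightarrow>
    X \<otimes>\<^bsub>tensor_product R B C\<^esub> Y \<in> carrier (tensor_product R B C)"
  using linear_closed[OF tensor_mult_linear_right] .

text \<open>
  Both products being bilinear, it suffices to compare them on pure tensors of homogeneous
  elements. For \<open>a \<otimes> b\<close>, \<open>c \<otimes> d\<close>, \<open>e \<otimes> f\<close> both signs have the exponent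
  \<open>|b||c| + |b||e| + |d||e|\<close>.
\<close>

lemma tensor_mult_assoc:
  assumes "X \<in> carrier (tensor_product R B C)" "Y \<in> carrier (tensor_product R B C)"
    and "Z \<in> carrier (tensor_product R B C)"
  shows "(X \<otimes>\<^bsub>tensor_product R B C\<^esub> Y) \<otimes>\<^bsub>tensor_product R B C\<^esub> Z =
    X \<otimes>\<^bsub>tensor_product R B C\<^esub> (Y \<otimes>\<^bsub>tensor_product R B C\<^esub> Z)"
proof -
  let ?T = "tensor_product R B C"
  note simps = linear_add[OF tensor_mult_linear_left] linear_add[OF tensor_mult_linear_right]
    tensor_mult_closed tensor_pure_closed B.grade_closed C.grade_closed
  show ?thesis using assms(1)
  proof (induction X rule: tensor_homogeneous_induct)
    case ab: (pure m n a b)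
    show ?case using assms(2)
    proof (induction Y rule: tensor_homogeneous_induct)
      case cd: (pure p q c d)
      show ?case using assms(3)
      proof (induction Z rule: tensor_homogeneous_induct)
        case ef: (pure r s e f)
        note hom = ab cd ef
        note cl = hom(1,3,5)[THEN B.grade_closed] hom(2,4,6)[THEN C.grade_closed]
        have bd: "b \<otimes>\<^bsub>C\<^esub> d \<in> grade C (n + q)" and ce: "c \<otimes>\<^bsub>B\<^esub> e \<in> grade B (p + r)"
          using hom B.grade_mult C.grade_mult by auto
        have "(pure_tensor R B C a b \<otimes>\<^bsub>?T\<^esub> pure_tensor R B C c d) \<otimes>\<^bsub>?T\<^esub> pure_tensor R B C e f =
            (koszul_sign R n p \<otimes>\<^bsub>R\<^esub> koszul_sign R (n + q) r) \<odot>\<^bsub>?T\<^esub>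
              pure_tensor R B C (a \<otimes>\<^bsub>B\<^esub> c \<otimes>\<^bsub>B\<^esub> e) (b \<otimes>\<^bsub>C\<^esub> d \<otimes>\<^bsub>C\<^esub> f)"
          using hom cl bd
          by (simp add: tensor_mult_pure linear_smult[OF tensor_mult_linear_left]
              tensor_pure_closed T.smult_assoc1)
        moreover have "pure_tensor R B C a b \<otimes>\<^bsub>?T\<^esub> (pure_tensor R B C c d \<otimes>\<^bsub>?T\<^esub> pure_tensor R B C e f) =
            (koszul_sign R q r \<otimes>\<^bsub>R\<^esub> koszul_sign R n (p + r)) \<odot>\<^bsub>?T\<^esub>
              pure_tensor R B C (a \<otimes>\<^bsub>B\<^esub> (c \<otimes>\<^bsub>B\<^esub> e)) (b \<otimes>\<^bsub>C\<^esub> (d \<otimes>\<^bsub>C\<^esub> f))"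
          using hom cl ce
          by (simp add: tensor_mult_pure linear_smult[OF tensor_mult_linear_right]
              tensor_pure_closed T.smult_assoc1)
        moreover have "koszul_sign R n p \<otimes>\<^bsub>R\<^esub> koszul_sign R (n + q) r =
            koszul_sign R q r \<otimes>\<^bsub>R\<^esub> koszul_sign R n (p + r)"
          by (simp add: koszul_sign_def B.R.nat_pow_mult algebra_simps)
        ultimately show ?case using cl by (simp add: B.m_assoc C.m_assoc)
      next
        case (add Z Z')
        then show ?case using ab cd by (simp add: simps)
      qed
    next
      case (add Y Y')
      then show ?case using ab assms(3) by (simp add: simps)
    qed
  next
    case (add X X')
    then show ?case using assms by (simp add: simps)
  qed
qed

lemma tensor_product_unital_algebra: "unital_algebra R (tensor_product R B C)"
proof -
  let ?T = "tensor_product R B C"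
  have one: "\<one>\<^bsub>?T\<^esub> \<in> carrier ?T" by (simp add: tensor_one[OF BC_modules] tensor_pure_closed)
  have mon: "monoid ?T"
  proof (rule monoidI[OF tensor_mult_closed one tensor_mult_assoc])
    fix X assume "X \<in> carrier ?T"
    then show "\<one>\<^bsub>?T\<^esub> \<otimes>\<^bsub>?T\<^esub> X = X"
    proof (induction X rule: tensor_induct[OF BC_modules, consumes 1, case_names pure add])
      case (pure b c)
      then show ?case by (simp add: tensor_one[OF BC_modules] tensor_mult_left_factor)
    next
      case (add X Y)
      then show ?case by (simp add: linear_add[OF tensor_mult_linear_right[OF one]])
    qed
  next
    fix X assume "X \<in> carrier ?T"
    then show "X \<otimes>\<^bsub>?T\<^esub> \<one>\<^bsub>?T\<^esub> = X"
    proof (induction X rule: tensor_induct[OF BC_modules, consumes 1, case_names pure add])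
      case (pure b c)
      then show ?case by (simp add: tensor_one[OF BC_modules] tensor_mult_right_factor)
    next
      case (add X Y)
      then show ?case by (simp add: linear_add[OF tensor_mult_linear_left[OF one]])
    qed
  qed
  have "ring ?T"
    by (rule ringI[OF T.abelian_group_axioms mon])
      (simp_all add: linear_add[OF tensor_mult_linear_left] linear_add[OF tensor_mult_linear_right])
  then show ?thesis
    by (intro unital_algebra.intro unital_algebra_axioms.intro T.module_axioms)
      (simp_all add: linear_smult[OF tensor_mult_linear_left]
        linear_smult[OF tensor_mult_linear_right])
qed

lemma tensor_grade_iff:
  "X \<in> grade (tensor_product R B C) n \<longleftrightarrow>
    (\<exists>t. tensor_homogeneous B C n t \<and> X = tensor_class R B C t)"
  by (auto simp: tensor_product_def tensor_module_def tensor_class_def)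

lemma tensor_homogeneous_term: "tensor_homogeneous B C n t \<Longrightarrow> t \<in> tensor_terms B C"
  by (induction rule: tensor_homogeneous.induct)
    (auto intro: tensor_terms.intros B.grade_closed C.grade_closed)

lemma pure_tensor_grade:
  "\<lbrakk>b \<in> grade B i; c \<in> grade C j\<rbrakk> \<Longrightarrow> pure_tensor R B C b c \<in> grade (tensor_product R B C) (i + j)"
  unfolding tensor_grade_iff pure_tensor_class[OF BC_modules]
  by (blast intro: tensor_homogeneous.intros)

lemma tensor_grade_closed: "X \<in> grade (tensor_product R B C) n \<Longrightarrow> X \<in> carrier (tensor_product R B C)"
  by (auto simp: tensor_grade_iff intro: tensor_class_closed[OF BC_modules] tensor_homogeneous_term)

lemma tensor_grade_add:
  assumes "X \<in> grade (tensor_product R B C) n" "Y \<in> grade (tensor_product R B C) n"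
  shows "X \<oplus>\<^bsub>tensor_product R B C\<^esub> Y \<in> grade (tensor_product R B C) n"
proof -
  obtain s t where "tensor_homogeneous B C n s" "X = tensor_class R B C s"
    "tensor_homogeneous B C n t" "Y = tensor_class R B C t"
    using assms by (auto simp: tensor_grade_iff)
  then show ?thesis
    unfolding tensor_grade_iff
    by (intro exI[of _ "TAdd s t"]) (simp add: tensor_class_add[OF BC_modules]
        tensor_homogeneous_term tensor_homogeneous.intros)
qed

lemma tensor_grade_induct [consumes 1, case_names pure add]:
  assumes "X \<in> grade (tensor_product R B C) n"
    and pure: "\<And>i j b c. \<lbrakk>b \<in> grade B i; c \<in> grade C j; i + j = n\<rbrakk> \<Longrightarrow> P (pure_tensor R B C b c)"
    and add: "\<And>X Y. \<lbrakk>X \<in> grade (tensor_product R B C) n; Y \<in> grade (tensor_product R B C) n;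
      P X; P Y\<rbrakk> \<Longrightarrow> P (X \<oplus>\<^bsub>tensor_product R B C\<^esub> Y)"
  shows "P X"
proof -
  obtain t where t: "tensor_homogeneous B C n t" and X: "X = tensor_class R B C t"
    using assms(1) by (auto simp: tensor_grade_iff)
  have "P (tensor_class R B C t)" using t pure add
  proof induction
    case (1 b i c j)
    then show ?case by (metis pure_tensor_class[OF BC_modules])
  next
    case (2 n s t)
    then have "tensor_class R B C s \<in> grade (tensor_product R B C) n"
      "tensor_class R B C t \<in> grade (tensor_product R B C) n"
      by (auto simp: tensor_grade_iff)
    moreover have "P (tensor_class R B C s)" "P (tensor_class R B C t)"
      using 2 by blast+
    ultimately show ?case
      using 2 tensor_class_add[OF BC_modules] tensor_homogeneous_term by metis
  qed
  then show ?thesis by (simp add: X)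
qed

lemma tensor_grade_smult:
  assumes r: "r \<in> carrier R" and X: "X \<in> grade (tensor_product R B C) n"
  shows "r \<odot>\<^bsub>tensor_product R B C\<^esub> X \<in> grade (tensor_product R B C) n"
  using X
proof (induction X rule: tensor_grade_induct)
  case (pure i j b c)
  then show ?case
    using r pure_tensor_grade[OF B.grade_smult[OF r pure(1)] pure(2)]
    by (simp add: pure_tensor_smult_left[OF BC_modules] B.grade_closed C.grade_closed)
next
  case (add X Y)
  then show ?case using r by (simp add: T.smult_r_distr tensor_grade_add tensor_grade_closed)
qed

lemma tensor_grade_submodule: "submodule (grade (tensor_product R B C) n) R (tensor_product R B C)"
proof (rule T.submoduleI)
  let ?T = "tensor_product R B C"
  show "grade ?T n \<subseteq> carrier ?T" using tensor_grade_closed by blast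
  show "\<zero>\<^bsub>?T\<^esub> \<in> grade ?T n"
    using pure_tensor_grade[OF B.grade_zero[of 0] C.grade_zero[of n]]
    by (simp add: tensor_zero[OF BC_modules])
  fix X assume X: "X \<in> grade ?T n"
  then have "\<ominus>\<^bsub>?T\<^esub> X = (\<ominus>\<^bsub>R\<^esub> \<one>\<^bsub>R\<^esub>) \<odot>\<^bsub>?T\<^esub> X"
    by (simp add: T.smult_l_minus tensor_grade_closed)
  then show "\<ominus>\<^bsub>?T\<^esub> X \<in> grade ?T n" using X by (simp add: tensor_grade_smult)
qed (rule tensor_grade_add tensor_grade_smult; assumption)+

text \<open>
  The part of \<open>b \<otimes> c\<close> of total degree \<open>n\<close>. These projections show that the pieces of the tensor
  product are independent.
\<close>

definition tensor_projection :: "nat \<Rightarrow> ('b, 'c) tensor_term set \<Rightarrow> ('b, 'c) tensor_term set" where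
  "tensor_projection n = tensor_lift (tensor_product R B C)
     (\<lambda>b c. finsum (tensor_product R B C)
        (\<lambda>i. pure_tensor R B C (component B b i) (component C c (n - i))) {..n})"

lemma tensor_projection_bilinear:
  "(\<lambda>b c. finsum (tensor_product R B C)
        (\<lambda>i. pure_tensor R B C (component B b i) (component C c (n - i))) {..n})
    \<in> bilinear_maps R B C (tensor_product R B C)"
  by (intro bilinear_mapsI linear_sum T.module_axioms
      linear_comp[OF C.component_linear bilinear_right[OF tensor_bilinear]]
      linear_comp[OF B.component_linear bilinear_left[OF tensor_bilinear]])
    (auto intro: B.component_closed C.component_closed)

lemma tensor_projection_linear:
  "tensor_projection n \<in> linear_maps R (tensor_product R B C) (tensor_product R B C)"
  unfolding tensor_projection_def
  by (rule tensor_lift_linear[OF BC_modules T.module_axioms tensor_projection_bilinear])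

lemma tensor_projection_grade:
  assumes "X \<in> grade (tensor_product R B C) m"
  shows "tensor_projection n X = (if m = n then X else \<zero>\<^bsub>tensor_product R B C\<^esub>)"
  using assms
proof (induction X rule: tensor_grade_induct)
  case (pure i j b c)
  let ?T = "tensor_product R B C"
  have cl: "b \<in> carrier B" "c \<in> carrier C" using pure B.grade_closed C.grade_closed by auto
  have "tensor_projection n (pure_tensor R B C b c) = finsum ?T
      (\<lambda>k. pure_tensor R B C (component B b k) (component C c (n - k))) {..n}"
    unfolding tensor_projection_def
    by (rule tensor_lift_pure[OF BC_modules T.module_axioms tensor_projection_bilinear cl])
  also have "\<dots> = finsum ?T (\<lambda>k. if i = k then (if m = n then pure_tensor R B C b c else \<zero>\<^bsub>?T\<^esub>)
      else \<zero>\<^bsub>?T\<^esub>) {..n}"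
    by (rule T.finsum_cong')
      (use pure cl in \<open>auto simp: B.component_homogeneous C.component_homogeneous tensor_pure_closed
        pure_tensor_zero_left[OF BC_modules] pure_tensor_zero_right[OF BC_modules]\<close>)
  also have "\<dots> = (if m = n then pure_tensor R B C b c else \<zero>\<^bsub>?T\<^esub>)"
  proof (cases "m = n")
    case True
    then have "i \<in> {..n}" using pure by simp
    then show ?thesis
      using True T.add.finprod_singleton[of i "{..n}" "\<lambda>_. pure_tensor R B C b c"] cl
      by (simp add: tensor_pure_closed)
  qed simp
  finally show ?case .
next
  case (add X Y)
  then show ?case
    by (auto simp: linear_add[OF tensor_projection_linear] tensor_grade_closed)
qed

lemma tensor_product_graded_algebra: "graded_algebra R (tensor_product R B C)"
proof -
  let ?T = "tensor_product R B C"
  have gm: "graded_module R ?T"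
  proof (rule graded_moduleI[OF T.module_axioms tensor_grade_submodule _ tensor_projection_linear
        tensor_projection_grade])
    fix P X
    assume "X \<in> carrier ?T" and "\<And>n Y. Y \<in> grade ?T n \<Longrightarrow> P Y"
      and "\<And>Y Z. \<lbrakk>Y \<in> carrier ?T; Z \<in> carrier ?T; P Y; P Z\<rbrakk> \<Longrightarrow> P (Y \<oplus>\<^bsub>?T\<^esub> Z)"
    then show "P X"
      by (induction X rule: tensor_homogeneous_induct) (use pure_tensor_grade in blast)+
  qed
  have mult: "X \<otimes>\<^bsub>?T\<^esub> Y \<in> grade ?T (m + n)" if X: "X \<in> grade ?T m" and Y: "Y \<in> grade ?T n" for X Y m n
    using X
  proof (induction X rule: tensor_grade_induct)
    case ab: (pure i j a b)
    then have ab': "a \<in> carrier B" "b \<in> carrier C" by (auto intro: B.grade_closed C.grade_closed)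
    show ?case using Y
    proof (induction Y rule: tensor_grade_induct)
      case (pure k l c d)
      have "pure_tensor R B C (a \<otimes>\<^bsub>B\<^esub> c) (b \<otimes>\<^bsub>C\<^esub> d) \<in> grade ?T ((i + k) + (j + l))"
        using ab pure by (intro pure_tensor_grade B.grade_mult C.grade_mult)
      moreover have "(i + k) + (j + l) = m + n" using ab(3) pure(3) by simp
      ultimately show ?case
        using tensor_mult_pure[OF ab'(1) ab(2) pure(1) C.grade_closed[OF pure(2)]]
        by (simp add: tensor_grade_smult)
    next
      case (add Y Z)
      then show ?case
        using ab' by (simp add: linear_add[OF tensor_mult_linear_right] tensor_pure_closed
            tensor_grade_closed tensor_grade_add)
    qed
  next
    case (add X Z)
    then show ?case
      using Y by (simp add: linear_add[OF tensor_mult_linear_left] tensor_grade_closed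
          tensor_grade_add)
  qed
  have "\<one>\<^bsub>?T\<^esub> \<in> grade ?T 0"
    using pure_tensor_grade[OF B.grade_one C.grade_one] by (simp add: tensor_one[OF BC_modules])
  then show ?thesis
    by (intro graded_algebra.intro graded_algebra_axioms.intro gm tensor_product_unital_algebra mult)
qed

lemma tensor_left_alg_hom: "(\<lambda>b. pure_tensor R B C b \<one>\<^bsub>C\<^esub>) \<in> alg_hom R B (tensor_product R B C)"
proof (rule alg_homI[OF unital_homsI])
  show "(\<lambda>b. pure_tensor R B C b \<one>\<^bsub>C\<^esub>) \<in> linear_maps R B (tensor_product R B C)"
    by (rule bilinear_left[OF tensor_bilinear]) simp
  show "pure_tensor R B C b \<one>\<^bsub>C\<^esub> \<in> grade (tensor_product R B C) n" if "b \<in> grade B n" for b n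
    using pure_tensor_grade[OF that C.grade_one] by simp
qed (simp_all add: tensor_mult_left_factor tensor_one[OF BC_modules])

lemma tensor_right_alg_hom: "(\<lambda>c. pure_tensor R B C \<one>\<^bsub>B\<^esub> c) \<in> alg_hom R C (tensor_product R B C)"
proof (rule alg_homI[OF unital_homsI])
  show "(\<lambda>c. pure_tensor R B C \<one>\<^bsub>B\<^esub> c) \<in> linear_maps R C (tensor_product R B C)"
    by (rule bilinear_right[OF tensor_bilinear]) simp
  show "pure_tensor R B C \<one>\<^bsub>B\<^esub> c \<in> grade (tensor_product R B C) n" if "c \<in> grade C n" for c n
    using pure_tensor_grade[OF B.grade_one that] by simp
qed (simp_all add: tensor_mult_right_factor tensor_one[OF BC_modules])

lemma tensor_factors_commute:
  "graded_commute R B C (tensor_product R B C)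
    (\<lambda>b. pure_tensor R B C b \<one>\<^bsub>C\<^esub>) (\<lambda>c. pure_tensor R B C \<one>\<^bsub>B\<^esub> c)"
  unfolding graded_commute_def
proof (intro allI ballI)
  fix m n b c assume "b \<in> grade B m" "c \<in> grade C n"
  then show "pure_tensor R B C \<one>\<^bsub>B\<^esub> c \<otimes>\<^bsub>tensor_product R B C\<^esub> pure_tensor R B C b \<one>\<^bsub>C\<^esub> =
      koszul_sign R m n \<odot>\<^bsub>tensor_product R B C\<^esub>
        (pure_tensor R B C b \<one>\<^bsub>C\<^esub> \<otimes>\<^bsub>tensor_product R B C\<^esub> pure_tensor R B C \<one>\<^bsub>B\<^esub> c)"
    by (simp add: tensor_mult_pure tensor_mult_right_factor B.grade_closed C.grade_closed
        B.R.koszul_sign_sym[of n m])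
qed

text \<open>
  The universal property of the graded tensor product. On pure tensors of homogeneous elements
  multiplicativity amounts to moving \<open>p c\<close> past \<open>q b\<close>, and the sign of the product absorbs the sign
  of the commutation.
\<close>

lemma tensor_lift_hom:
  assumes "unital_algebra R D"
    and p: "p \<in> unital_homs R B D" and q: "q \<in> unital_homs R C D"
    and comm: "graded_commute R B C D p q"
  shows "(\<lambda>b c. p b \<otimes>\<^bsub>D\<^esub> q c) \<in> bilinear_maps R B C D"
    and "tensor_lift D (\<lambda>b c. p b \<otimes>\<^bsub>D\<^esub> q c) \<in> unital_homs R (tensor_product R B C) D"
proof -
  interpret D: unital_algebra R D by fact
  let ?T = "tensor_product R B C"
  let ?\<beta> = "\<lambda>b c. p b \<otimes>\<^bsub>D\<^esub> q c"
  show \<beta>: "?\<beta> \<in> bilinear_maps R B C D"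
    by (intro bilinear_mapsI linear_comp[OF hom_linear[OF q] bilinear_right[OF D.mult_bilinear]]
        linear_comp[OF hom_linear[OF p] bilinear_left[OF D.mult_bilinear]]
        hom_closed[OF p] hom_closed[OF q])
  note pure = tensor_lift_pure[OF BC_modules D.module_axiom \<beta>]
  have lin: "tensor_lift D ?\<beta> \<in> linear_maps R ?T D"
    by (rule tensor_lift_linear[OF BC_modules D.module_axiom \<beta>])
  show "tensor_lift D ?\<beta> \<in> unital_homs R ?T D"
  proof (rule unital_homsI[OF lin])
    show "tensor_lift D ?\<beta> \<one>\<^bsub>?T\<^esub> = \<one>\<^bsub>D\<^esub>"
      by (simp add: tensor_one[OF BC_modules] pure hom_one[OF p] hom_one[OF q])
    fix X Y assume "X \<in> carrier ?T" and Y: "Y \<in> carrier ?T"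
    then show "tensor_lift D ?\<beta> (X \<otimes>\<^bsub>?T\<^esub> Y) = tensor_lift D ?\<beta> X \<otimes>\<^bsub>D\<^esub> tensor_lift D ?\<beta> Y"
    proof (induction X rule: tensor_homogeneous_induct)
      case ab: (pure m n a b)
      then have ab': "a \<in> carrier B" "b \<in> carrier C" by (auto intro: B.grade_closed C.grade_closed)
      show ?case using Y
      proof (induction Y rule: tensor_homogeneous_induct)
        case cd: (pure k l c d)
        then have cd': "c \<in> carrier B" "d \<in> carrier C" by (auto intro: B.grade_closed C.grade_closed)
        note cl = ab' cd' hom_closed[OF p ab'(1)] hom_closed[OF p cd'(1)]
          hom_closed[OF q ab'(2)] hom_closed[OF q cd'(2)]
        have "q b \<otimes>\<^bsub>D\<^esub> p c = koszul_sign R n k \<odot>\<^bsub>D\<^esub> (p c \<otimes>\<^bsub>D\<^esub> q b)"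
          using comm cd(1) ab(2) B.R.koszul_sign_sym[of n k] by (simp add: graded_commute_def)
        then have "p a \<otimes>\<^bsub>D\<^esub> q b \<otimes>\<^bsub>D\<^esub> (p c \<otimes>\<^bsub>D\<^esub> q d) =
            koszul_sign R n k \<odot>\<^bsub>D\<^esub> (p a \<otimes>\<^bsub>D\<^esub> (p c \<otimes>\<^bsub>D\<^esub> q b) \<otimes>\<^bsub>D\<^esub> q d)"
          using cl by (metis D.m_assoc D.m_closed D.smult_mult_left D.smult_mult_right
              B.R.koszul_sign_closed)
        then show ?case
          using cl ab cd
          by (simp add: tensor_mult_pure pure linear_smult[OF lin] tensor_pure_closed
              hom_mult[OF p] hom_mult[OF q] D.m_assoc)
      next
        case (add Y Z)
        then show ?case
          using ab' by (simp add: linear_add[OF tensor_mult_linear_right] tensor_pure_closed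
              linear_add[OF lin] linear_closed[OF lin] tensor_mult_closed D.r_distr)
      qed
    next
      case (add X Z)
      then show ?case
        using Y by (simp add: linear_add[OF tensor_mult_linear_left]
            linear_add[OF lin] linear_closed[OF lin] tensor_mult_closed D.l_distr)
    qed
  qed
qed

end


section \<open>The coproduct of the underlying Hopf algebra\<close>

locale graded_comonoid = connected_graded_algebra R A
  for R :: "('r, 'l) ring_scheme" and A :: "('r, 'a, 'm) graded_alg_scheme" +
  fixes \<Phi> :: "'a \<Rightarrow> ('r, 'a, 'a) fp_term set"
  assumes comonoid: "comonoid R A \<Phi>"
begin

abbreviation "AA \<equiv> tensor_product R A A"
abbreviation "inl \<equiv> \<lambda>a. pure_tensor R A A a \<one>\<^bsub>A\<^esub>"
abbreviation "inr \<equiv> \<lambda>a. pure_tensor R A A \<one>\<^bsub>A\<^esub> a"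
abbreviation "\<Delta> \<equiv> hopf_coproduct R A \<Phi>"

lemmas alg = unital_algebra_axioms
lemmas galg = graded_algebra_axioms
lemmas AA_galg = tensor_product_graded_algebra[OF galg galg]
lemmas AA_alg = tensor_product_unital_algebra[OF galg galg]
lemmas modules = module_axiom module_axiom
lemmas fp_alg = free_product_algebra[OF alg alg]
lemmas inl_alg_hom = tensor_left_alg_hom[OF galg galg]
lemmas inr_alg_hom = tensor_right_alg_hom[OF galg galg]
lemmas inl_hom = alg_hom_unital_hom[OF inl_alg_hom]
lemmas inr_hom = alg_hom_unital_hom[OF inr_alg_hom]
lemmas AA_bilinear = tensor_bilinear[OF galg galg]

lemma \<Phi>_alg_hom: "\<Phi> \<in> alg_hom R A (free_product R A A)"
  using comonoid by (simp add: comonoid_def)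

lemmas \<Phi>_hom = alg_hom_unital_hom[OF \<Phi>_alg_hom]

lemma AA_module: "module R AA"
  by (rule tensor_product_module[OF modules])

lemma coproduct_alg_hom: "\<Delta> \<in> alg_hom R A AA"
proof (rule alg_homI)
  show "\<Delta> \<in> unital_homs R A AA"
    using hom_comp[OF \<Phi>_hom copair_hom[OF alg alg AA_alg inl_hom inr_hom]]
    by (simp add: hopf_coproduct_def comp_def)
  show "\<Delta> x \<in> grade AA n" if "x \<in> grade A n" for x n
    using copair_grade[OF galg galg AA_galg inl_alg_hom inr_alg_hom alg_hom_grade[OF \<Phi>_alg_hom that]]
    by (simp add: hopf_coproduct_def)
qed

lemmas coproduct_hom = alg_hom_unital_hom[OF coproduct_alg_hom]
lemmas coproduct_linear = hom_linear[OF coproduct_hom]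
lemmas coproduct_closed = linear_closed[OF coproduct_linear]

text \<open>
  A morphism out of the free product whose components commute up to sign factors through the
  tensor product, so that on \<open>\<Phi> x\<close> it is computed by the coproduct \<open>\<Delta> x\<close>.
\<close>

lemma copair_coproduct:
  assumes D: "unital_algebra R D" and p: "p \<in> unital_homs R A D" and q: "q \<in> unital_homs R A D"
    and comm: "graded_commute R A A D p q" and x: "x \<in> carrier A"
  shows "copair D p q (\<Phi> x) = tensor_lift D (\<lambda>a b. p a \<otimes>\<^bsub>D\<^esub> q b) (\<Delta> x)"
proof -
  interpret D: unital_algebra R D by fact
  note lift = tensor_lift_hom[OF galg galg D p q comm]
  note pure = tensor_lift_pure[OF modules D.module_axiom lift(1)]
  note \<rho> = copair_hom[OF alg alg AA_alg inl_hom inr_hom]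
  have "tensor_lift D (\<lambda>a b. p a \<otimes>\<^bsub>D\<^esub> q b) (copair AA inl inr (\<Phi> x)) = copair D p q (\<Phi> x)"
    by (rule copair_unique[OF alg alg D p q hom_comp[OF \<rho> lift(2)] _ _ hom_closed[OF \<Phi>_hom x]])
      (simp_all add: copair_left[OF alg alg AA_alg inl_hom inr_hom]
        copair_right[OF alg alg AA_alg inl_hom inr_hom] pure hom_one[OF p] hom_one[OF q]
        hom_closed[OF p] hom_closed[OF q])
  then show ?thesis by (simp add: hopf_coproduct_def)
qed


section \<open>Convolution\<close>

definition convolution :: "('a \<Rightarrow> 'a) \<Rightarrow> ('a \<Rightarrow> 'a) \<Rightarrow> 'a \<Rightarrow> 'a" where
  "convolution f g x = tensor_lift A (\<lambda>a b. f a \<otimes>\<^bsub>A\<^esub> g b) (\<Delta> x)"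

lemma mult_comp_bilinear:
  assumes "f \<in> linear_maps R A A" "g \<in> linear_maps R A A"
  shows "(\<lambda>a b. f a \<otimes>\<^bsub>A\<^esub> g b) \<in> bilinear_maps R A A A"
  by (rule bilinear_precomp[OF mult_bilinear assms])

lemmas mult_lift_linear = tensor_lift_linear[OF modules module_axiom mult_comp_bilinear]
lemmas mult_lift_pure = tensor_lift_pure[OF modules module_axiom mult_comp_bilinear]

lemma convolution_linear:
  assumes "f \<in> linear_maps R A A" "g \<in> linear_maps R A A"
  shows "convolution f g \<in> linear_maps R A A"
  unfolding convolution_def by (rule linear_comp[OF coproduct_linear mult_lift_linear[OF assms]])

lemma convolution_one:
  assumes "f \<in> linear_maps R A A" "g \<in> linear_maps R A A"
  shows "convolution f g \<one>\<^bsub>A\<^esub> = f \<one>\<^bsub>A\<^esub> \<otimes>\<^bsub>A\<^esub> g \<one>\<^bsub>A\<^esub>"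
  using assms by (simp add: convolution_def hom_one[OF coproduct_hom] tensor_one[OF modules]
      mult_lift_pure)

lemma convolution_add_right:
  assumes f: "f \<in> linear_maps R A A" and g: "g \<in> linear_maps R A A" and h: "h \<in> linear_maps R A A"
    and x: "x \<in> carrier A"
  shows "convolution f (\<lambda>b. g b \<oplus>\<^bsub>A\<^esub> h b) x = convolution f g x \<oplus>\<^bsub>A\<^esub> convolution f h x"
proof -
  note gh = linear_plus[OF module_axiom g h]
  show ?thesis
    unfolding convolution_def
    by (rule tensor_linear_eq[OF modules mult_lift_linear[OF f gh]
          linear_plus[OF module_axiom mult_lift_linear[OF f g] mult_lift_linear[OF f h]] _
          coproduct_closed[OF x]])
      (simp add: mult_lift_pure f g h gh r_distr linear_closed[OF f] linear_closed[OF g]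
        linear_closed[OF h])
qed

text \<open>
  The coproduct of an element of degree \<open>n\<close> is a sum of \<open>a \<otimes> b\<close> whose degrees add up to \<open>n\<close>, so
  only the values of the two maps on such pairs matter. This is what makes recursion on the degree
  possible.
\<close>

lemma convolution_cong:
  assumes f: "f \<in> linear_maps R A A" and g: "g \<in> linear_maps R A A"
    and f': "f' \<in> linear_maps R A A" and g': "g' \<in> linear_maps R A A" and x: "x \<in> grade A n"
    and eq: "\<And>i j a b. \<lbrakk>a \<in> grade A i; b \<in> grade A j; i + j = n\<rbrakk> \<Longrightarrow>
      f a \<otimes>\<^bsub>A\<^esub> g b = f' a \<otimes>\<^bsub>A\<^esub> g' b"
  shows "convolution f g x = convolution f' g' x"
proof -
  have "\<Delta> x \<in> grade AA n" by (rule alg_hom_grade[OF coproduct_alg_hom x])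
  then show ?thesis
    unfolding convolution_def
  proof (induction rule: tensor_grade_induct[OF galg galg, consumes 1, case_names pure add])
    case (pure i j b c)
    then show ?case by (simp add: mult_lift_pure f g f' g' grade_closed eq)
  next
    case (add X Y)
    then show ?case
      by (simp add: tensor_grade_closed[OF galg galg] linear_add[OF mult_lift_linear[OF f g]]
          linear_add[OF mult_lift_linear[OF f' g']])
  qed
qed

lemma convolution_grade:
  assumes f: "f \<in> linear_maps R A A" and g: "g \<in> linear_maps R A A" and x: "x \<in> grade A n"
    and "\<And>i a. a \<in> grade A i \<Longrightarrow> f a \<in> grade A i" "\<And>i a. a \<in> grade A i \<Longrightarrow> g a \<in> grade A i"
  shows "convolution f g x \<in> grade A n"
proof -
  have "\<Delta> x \<in> grade AA n" by (rule alg_hom_grade[OF coproduct_alg_hom x])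
  then show ?thesis
    unfolding convolution_def
  proof (induction rule: tensor_grade_induct[OF galg galg, consumes 1, case_names pure add])
    case (pure i j b c)
    then show ?case using grade_mult[OF assms(4,5)] by (auto simp: mult_lift_pure f g grade_closed)
  next
    case (add X Y)
    then show ?case
      by (simp add: tensor_grade_closed[OF galg galg] linear_add[OF mult_lift_linear[OF f g]]
          grade_add)
  qed
qed

lemma trivial_map_central:
  assumes "a \<in> carrier A" "b \<in> carrier A"
  shows "trivial_map R A A a \<otimes>\<^bsub>A\<^esub> b = augmentation R A a \<odot>\<^bsub>A\<^esub> b"
    and "b \<otimes>\<^bsub>A\<^esub> trivial_map R A A a = augmentation R A a \<odot>\<^bsub>A\<^esub> b"
  using assms by (simp_all add: trivial_map_def smult_mult_left smult_mult_right augmentation_closed)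

text \<open>
  In degree 0 the trivial map takes scalar values, which are central and carry no sign; in positive
  degrees it vanishes.
\<close>

lemma trivial_map_commute:
  assumes q: "q \<in> linear_maps R A A"
  shows "graded_commute R A A A (trivial_map R A A) q"
  unfolding graded_commute_def
proof (intro allI ballI)
  fix m n x y assume x: "x \<in> grade A m" and y: "y \<in> grade A n"
  have cl: "q y \<in> carrier A" "x \<in> carrier A"
    using linear_closed[OF q grade_closed[OF y]] grade_closed[OF x] by auto
  show "q y \<otimes>\<^bsub>A\<^esub> trivial_map R A A x =
      koszul_sign R m n \<odot>\<^bsub>A\<^esub> (trivial_map R A A x \<otimes>\<^bsub>A\<^esub> q y)"
  proof (cases "m = 0")
    case True
    then show ?thesis using cl by (simp add: trivial_map_central augmentation_closed)
  next
    case False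
    then have "trivial_map R A A x = \<zero>\<^bsub>A\<^esub>"
      using cl x by (simp add: trivial_map_component component_homogeneous)
    then show ?thesis using cl by simp
  qed
qed

text \<open>
  The counit condition for \<open>\<Phi>\<close> is the case of the identity map; composing with \<open>f\<close> gives the
  general case, because \<open>f\<close> is \<open>R\<close>-linear and the values of \<open>\<eta>\<close> are scalars.
\<close>

lemma convolution_left_unit:
  assumes f: "f \<in> linear_maps R A A" and x: "x \<in> carrier A"
  shows "convolution (trivial_map R A A) f x = f x"
proof -
  note id = hom_id[of R A]
  have "x = copair A (trivial_map R A A) id (\<Phi> x)" using comonoid x by (simp add: comonoid_def)
  also have "\<dots> = convolution (trivial_map R A A) id x"
    unfolding convolution_def
    by (rule copair_coproduct[OF alg trivial_map_hom id trivial_map_commute[OF hom_linear[OF id]] x])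
  finally have "f x = f (convolution (trivial_map R A A) id x)" by simp
  also have "\<dots> = convolution (trivial_map R A A) f x"
    unfolding convolution_def
    by (rule tensor_linear_eq[OF modules
          linear_comp[OF mult_lift_linear[OF trivial_map_linear hom_linear[OF id]] f]
          mult_lift_linear[OF trivial_map_linear f] _ coproduct_closed[OF x]])
      (simp add: mult_lift_pure
        mult_lift_pure[OF trivial_map_linear hom_linear[OF id], unfolded id_apply] trivial_map_linear hom_linear[OF id] f trivial_map_central
        linear_smult[OF f] linear_closed[OF f] augmentation_closed)
  finally show ?thesis ..
qed

lemma convolution_right_unit:
  assumes f: "f \<in> linear_maps R A A" and x: "x \<in> carrier A"
  shows "convolution f (trivial_map R A A) x = f x"
proof -
  note id = hom_id[of R A]
  have comm: "graded_commute R A A A id (trivial_map R A A)"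
    by (rule graded_commute_sym[OF galg galg alg trivial_map_linear hom_linear[OF id]
          trivial_map_commute[OF hom_linear[OF id]]])
  have "x = copair A id (trivial_map R A A) (\<Phi> x)" using comonoid x by (simp add: comonoid_def)
  also have "\<dots> = convolution id (trivial_map R A A) x"
    unfolding convolution_def
    by (rule copair_coproduct[OF alg id trivial_map_hom comm x])
  finally have "f x = f (convolution id (trivial_map R A A) x)" by simp
  also have "\<dots> = convolution f (trivial_map R A A) x"
    unfolding convolution_def
    by (rule tensor_linear_eq[OF modules
          linear_comp[OF mult_lift_linear[OF hom_linear[OF id] trivial_map_linear] f]
          mult_lift_linear[OF f trivial_map_linear] _ coproduct_closed[OF x]])
      (simp add: mult_lift_pure
        mult_lift_pure[OF hom_linear[OF id] trivial_map_linear, unfolded id_apply] trivial_map_linear hom_linear[OF id] f trivial_map_central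
        linear_smult[OF f] linear_closed[OF f] augmentation_closed)
  finally show ?thesis ..
qed

text \<open>
  Let \<open>D = (A \<otimes> A) \<otimes> A\<close>, with the inclusions \<open>i\<^sub>1\<close>, \<open>i\<^sub>2\<close>, \<open>i\<^sub>3\<close> of the three factors. Coassociativity of
  \<open>\<Phi>\<close>, evaluated in \<open>D\<close> with these components, becomes coassociativity of \<open>\<Delta>\<close>, since the
  inclusions commute up to sign. The maps \<open>f\<close>, \<open>g\<close>, \<open>h\<close> are only linear, so they are applied
  afterwards, through the linear map \<open>(a \<otimes> b) \<otimes> c \<mapsto> f(a) g(b) h(c)\<close> from \<open>D\<close> to \<open>A\<close>.
\<close>

lemma convolution_assoc:
  assumes f: "f \<in> linear_maps R A A" and g: "g \<in> linear_maps R A A" and h: "h \<in> linear_maps R A A"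
    and x: "x \<in> carrier A"
  shows "convolution (convolution f g) h x = convolution f (convolution g h) x"
proof -
  let ?D = "tensor_product R AA A"
  let ?j = "\<lambda>X. pure_tensor R AA A X \<one>\<^bsub>A\<^esub>"
  let ?i1 = "\<lambda>a. ?j (inl a)" and ?i2 = "\<lambda>a. ?j (inr a)"
    and ?i3 = "\<lambda>a. pure_tensor R AA A \<one>\<^bsub>AA\<^esub> a"
  interpret AA: graded_algebra R AA by (rule AA_galg)
  interpret D: graded_algebra R ?D by (rule tensor_product_graded_algebra[OF AA_galg galg])
  note D = D.unital_algebra_axioms
  note jh = alg_hom_unital_hom[OF tensor_left_alg_hom[OF AA_galg galg]]
  note i1 = hom_comp[OF inl_hom jh] and i2 = hom_comp[OF inr_hom jh]
    and i3 = alg_hom_unital_hom[OF tensor_right_alg_hom[OF AA_galg galg]]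
  note m12 = hom_comp[OF \<Phi>_hom copair_hom[OF alg alg D i1 i2]]
  note m23 = hom_comp[OF \<Phi>_hom copair_hom[OF alg alg D i2 i3]]
  have c12: "graded_commute R A A ?D ?i1 ?i2"
    by (rule graded_commute_hom[OF galg galg AA_alg tensor_factors_commute[OF galg galg]
          hom_linear[OF inl_hom] hom_linear[OF inr_hom] jh])
  have c13: "graded_commute R A A ?D ?i1 ?i3"
    by (rule graded_commute_precomp[OF tensor_factors_commute[OF AA_galg galg]
          alg_hom_grade[OF inl_alg_hom]])
  have c23: "graded_commute R A A ?D ?i2 ?i3"
    by (rule graded_commute_precomp[OF tensor_factors_commute[OF AA_galg galg]
          alg_hom_grade[OF inr_alg_hom]])
  note c21 = graded_commute_sym[OF galg galg D hom_linear[OF i1] hom_linear[OF i2] c12]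
  note c31 = graded_commute_sym[OF galg galg D hom_linear[OF i1] hom_linear[OF i3] c13]
  \<comment> \<open>The two partial coproducts, with values in the first two and in the last two factors, still
    commute up to sign with the remaining inclusion, because \<open>\<Phi>\<close> preserves degrees.\<close>
  have c12_3: "graded_commute R A A ?D (\<lambda>y. copair ?D ?i1 ?i2 (\<Phi> y)) ?i3"
    by (rule graded_commute_precomp[OF graded_commute_copair[OF galg galg galg D i1 i2
            hom_linear[OF i3] c13 c23] alg_hom_grade[OF \<Phi>_alg_hom]])
  have "graded_commute R A A ?D (\<lambda>y. copair ?D ?i2 ?i3 (\<Phi> y)) ?i1"
    by (rule graded_commute_precomp[OF graded_commute_copair[OF galg galg galg D i2 i3
            hom_linear[OF i1] c21 c31] alg_hom_grade[OF \<Phi>_alg_hom]])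
  then have c1_23: "graded_commute R A A ?D ?i1 (\<lambda>y. copair ?D ?i2 ?i3 (\<Phi> y))"
    by (rule graded_commute_sym[OF galg galg D hom_linear[OF m23] hom_linear[OF i1]])
  have m12_eq: "copair ?D ?i1 ?i2 (\<Phi> y) = tensor_lift ?D (\<lambda>a b. ?i1 a \<otimes>\<^bsub>?D\<^esub> ?i2 b) (\<Delta> y)"
    and m23_eq: "copair ?D ?i2 ?i3 (\<Phi> y) = tensor_lift ?D (\<lambda>a b. ?i2 a \<otimes>\<^bsub>?D\<^esub> ?i3 b) (\<Delta> y)"
    if "y \<in> carrier A" for y
    using copair_coproduct[OF D i1 i2 c12 that] copair_coproduct[OF D i2 i3 c23 that] by auto
  let ?\<kappa> = "\<lambda>X c. tensor_lift A (\<lambda>a b. f a \<otimes>\<^bsub>A\<^esub> g b) X \<otimes>\<^bsub>A\<^esub> h c"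
  have \<kappa>: "?\<kappa> \<in> bilinear_maps R AA A A"
    by (rule bilinear_precomp[OF mult_bilinear mult_lift_linear[OF f g] h])
  let ?K = "tensor_lift A ?\<kappa>"
  have K: "?K \<in> linear_maps R ?D A"
    by (rule tensor_lift_linear[OF AA_module module_axiom module_axiom \<kappa>])
  have triple: "?i1 a \<otimes>\<^bsub>?D\<^esub> ?i2 b \<otimes>\<^bsub>?D\<^esub> ?i3 c = pure_tensor R AA A (pure_tensor R A A a b) c"
    if "a \<in> carrier A" "b \<in> carrier A" "c \<in> carrier A" for a b c
    using that
    by (simp add: hom_mult[OF jh, symmetric] hom_closed[OF inl_hom] hom_closed[OF inr_hom]
        tensor_mult_right_factor[OF galg galg] tensor_mult_right_factor[OF AA_galg galg]
        pure_tensor_closed[OF modules])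
  have K_triple: "?K (?i1 a \<otimes>\<^bsub>?D\<^esub> ?i2 b \<otimes>\<^bsub>?D\<^esub> ?i3 c) = f a \<otimes>\<^bsub>A\<^esub> g b \<otimes>\<^bsub>A\<^esub> h c"
    if "a \<in> carrier A" "b \<in> carrier A" "c \<in> carrier A" for a b c
    using that by (simp add: triple tensor_lift_pure[OF AA_module module_axiom module_axiom \<kappa>]
        pure_tensor_closed[OF modules] mult_lift_pure f g)
  note icl = hom_closed[OF i1] hom_closed[OF i2] hom_closed[OF i3]
  note fcl = linear_closed[OF f] linear_closed[OF g] linear_closed[OF h]
  have K_left: "?K (copair ?D ?i1 ?i2 (\<Phi> a) \<otimes>\<^bsub>?D\<^esub> ?i3 b) = convolution f g a \<otimes>\<^bsub>A\<^esub> h b"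
    if a: "a \<in> carrier A" and b: "b \<in> carrier A" for a b
  proof -
    note bil = tensor_lift_hom(1)[OF galg galg D i1 i2 c12]
    have l1: "(\<lambda>z. ?K (z \<otimes>\<^bsub>?D\<^esub> ?i3 b)) \<in> linear_maps R ?D A"
      by (rule linear_comp[OF bilinear_left[OF D.mult_bilinear icl(3)[OF b]] K])
    have l2: "(\<lambda>z. z \<otimes>\<^bsub>A\<^esub> h b) \<in> linear_maps R A A"
      by (rule bilinear_left[OF mult_bilinear fcl(3)[OF b]])
    show ?thesis
      unfolding m12_eq[OF a] convolution_def
        linear_tensor_lift[OF modules D.module_axiom module_axiom bil l1 coproduct_closed[OF a]]
        linear_tensor_lift[OF modules module_axiom module_axiom mult_comp_bilinear[OF f g] l2
          coproduct_closed[OF a]]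
      by (rule tensor_lift_cong[OF modules module_axiom bilinear_comp[OF bil l1]
            bilinear_comp[OF mult_comp_bilinear[OF f g] l2] _ coproduct_closed[OF a]])
        (rule K_triple[OF _ _ b])
  qed
  have K_right: "?K (?i1 a \<otimes>\<^bsub>?D\<^esub> copair ?D ?i2 ?i3 (\<Phi> b)) = f a \<otimes>\<^bsub>A\<^esub> convolution g h b"
    if a: "a \<in> carrier A" and b: "b \<in> carrier A" for a b
  proof -
    note bil = tensor_lift_hom(1)[OF galg galg D i2 i3 c23]
    have l1: "(\<lambda>z. ?K (?i1 a \<otimes>\<^bsub>?D\<^esub> z)) \<in> linear_maps R ?D A"
      by (rule linear_comp[OF bilinear_right[OF D.mult_bilinear icl(1)[OF a]] K])
    have l2: "(\<lambda>z. f a \<otimes>\<^bsub>A\<^esub> z) \<in> linear_maps R A A"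
      by (rule bilinear_right[OF mult_bilinear fcl(1)[OF a]])
    show ?thesis
      unfolding m23_eq[OF b] convolution_def
        linear_tensor_lift[OF modules D.module_axiom module_axiom bil l1 coproduct_closed[OF b]]
        linear_tensor_lift[OF modules module_axiom module_axiom mult_comp_bilinear[OF g h] l2
          coproduct_closed[OF b]]
    proof (rule tensor_lift_cong[OF modules module_axiom bilinear_comp[OF bil l1]
            bilinear_comp[OF mult_comp_bilinear[OF g h] l2] _ coproduct_closed[OF b]])
      fix p q assume "p \<in> carrier A" "q \<in> carrier A"
      then show "?K (?i1 a \<otimes>\<^bsub>?D\<^esub> (?i2 p \<otimes>\<^bsub>?D\<^esub> ?i3 q)) = f a \<otimes>\<^bsub>A\<^esub> (g p \<otimes>\<^bsub>A\<^esub> h q)"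
        using K_triple[OF a] a by (simp add: D.m_assoc m_assoc icl fcl)
    qed
  qed
  have "convolution (convolution f g) h x =
      ?K (copair ?D (\<lambda>y. copair ?D ?i1 ?i2 (\<Phi> y)) ?i3 (\<Phi> x))"
  proof -
    note bil = tensor_lift_hom(1)[OF galg galg D m12 i3 c12_3]
    note fg = convolution_linear[OF f g]
    show ?thesis
      unfolding copair_coproduct[OF D m12 i3 c12_3 x] convolution_def[of _ h]
        linear_tensor_lift[OF modules D.module_axiom module_axiom bil K coproduct_closed[OF x]]
      by (rule tensor_lift_cong[OF modules module_axiom mult_comp_bilinear[OF fg h]
            bilinear_comp[OF bil K] _ coproduct_closed[OF x]])
        (simp add: K_left)
  qed
  also have "\<dots> = ?K (copair ?D ?i1 (\<lambda>y. copair ?D ?i2 ?i3 (\<Phi> y)) (\<Phi> x))"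
    using comonoid_coassoc_copair[OF comonoid D i1 i2 i3 x] by simp
  also have "\<dots> = convolution f (convolution g h) x"
  proof -
    note bil = tensor_lift_hom(1)[OF galg galg D i1 m23 c1_23]
    note gh = convolution_linear[OF g h]
    show ?thesis
      unfolding copair_coproduct[OF D i1 m23 c1_23 x] convolution_def[of f]
        linear_tensor_lift[OF modules D.module_axiom module_axiom bil K coproduct_closed[OF x]]
      by (rule tensor_lift_cong[OF modules module_axiom bilinear_comp[OF bil K]
            mult_comp_bilinear[OF f gh] _ coproduct_closed[OF x]])
        (simp add: K_right)
  qed
  finally show ?thesis .
qed


section \<open>The convolution group\<close>

abbreviation "\<eta> \<equiv> trivial_map R A A"

lemma trivial_map_degree_zero: "x \<in> grade A 0 \<Longrightarrow> \<eta> x = x"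
  by (simp add: trivial_map_component grade_closed component_homogeneous)

text \<open>
  The map \<open>\<eta> - f\<close>. A left convolution inverse \<open>g\<close> of \<open>f\<close> is a solution of \<open>g = \<eta> + g \<star> (\<eta> - f)\<close>, and
  \<open>approx_inverse\<close> is the fixed point iteration for this equation.
\<close>

definition defect :: "('a \<Rightarrow> 'a) \<Rightarrow> 'a \<Rightarrow> 'a" where
  "defect f b = \<eta> b \<oplus>\<^bsub>A\<^esub> (\<ominus>\<^bsub>R\<^esub> \<one>\<^bsub>R\<^esub>) \<odot>\<^bsub>A\<^esub> f b"

primrec approx_inverse :: "('a \<Rightarrow> 'a) \<Rightarrow> nat \<Rightarrow> 'a \<Rightarrow> 'a" where
  "approx_inverse f 0 = \<eta>"
| "approx_inverse f (Suc k) = (\<lambda>x. \<eta> x \<oplus>\<^bsub>A\<^esub> convolution (approx_inverse f k) (defect f) x)"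

text \<open>
  If \<open>f\<close> is the identity in degree 0, then \<open>\<eta> - f\<close> vanishes there, so \<open>g \<star> (\<eta> - f)\<close> in degree \<open>n\<close>
  depends only on \<open>g\<close> in degrees below \<open>n\<close>. Hence the iteration is constant in degree \<open>n\<close> from
  step \<open>n + 1\<close> on, and its limit solves the fixed point equation.
\<close>

lemma convolution_left_inverse:
  assumes f: "f \<in> linear_maps R A A"
    and f_grade: "\<And>n x. x \<in> grade A n \<Longrightarrow> f x \<in> grade A n"
    and f_zero: "\<And>x. x \<in> grade A 0 \<Longrightarrow> f x = x"
  obtains g where "g \<in> linear_maps R A A" "\<And>n x. x \<in> grade A n \<Longrightarrow> g x \<in> grade A n"
    "\<And>x. x \<in> grade A 0 \<Longrightarrow> g x = x" "\<And>x. x \<in> carrier A \<Longrightarrow> convolution g f x = \<eta> x"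
proof -
  let ?d = "defect f" and ?g = "approx_inverse f"
  have d: "?d \<in> linear_maps R A A"
    unfolding defect_def
    by (intro linear_plus linear_scale module_axiom trivial_map_linear f) simp
  have d_grade: "?d x \<in> grade A n" if "x \<in> grade A n" for n x
    using that by (simp add: defect_def grade_add trivial_map_grade grade_smult f_grade)
  have d_zero: "?d x = \<zero>\<^bsub>A\<^esub>" if "x \<in> grade A 0" for x
    using that by (simp add: defect_def trivial_map_degree_zero f_zero grade_closed smult_l_minus r_neg)
  have g: "?g k \<in> linear_maps R A A" for k
    by (induction k)
      (auto intro!: trivial_map_linear linear_plus[OF module_axiom] convolution_linear d)
  have g_grade: "?g k x \<in> grade A n" if "x \<in> grade A n" for k n x
    using that
    by (induction k arbitrary: n x)
      (auto intro!: trivial_map_grade grade_add convolution_grade g d d_grade)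
  have step: "?g (Suc k) x = ?g k x" if "x \<in> grade A m" "m < k" for k m x
    using that
  proof (induction k arbitrary: m x)
    case (Suc k)
    have "convolution (?g (Suc k)) ?d x = convolution (?g k) ?d x"
    proof (rule convolution_cong[OF g d g d Suc.prems(1)])
      fix i j a b assume ab: "a \<in> grade A i" "b \<in> grade A j" "i + j = m"
      show "?g (Suc k) a \<otimes>\<^bsub>A\<^esub> ?d b = ?g k a \<otimes>\<^bsub>A\<^esub> ?d b"
      proof (cases "j = 0")
        case True
        then show ?thesis
          using d_zero ab linear_closed[OF g grade_closed[OF ab(1)]]
          by (simp del: approx_inverse.simps)
      next
        case False
        then show ?thesis using Suc.IH[OF ab(1)] Suc.prems ab(3)
          by (simp del: approx_inverse.simps)
      qed
    qed
    then show ?case by simp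
  qed simp
  have stable: "?g k x = ?g (Suc m) x" if "x \<in> grade A m" "m < k" for k m x
    using that(2)
  proof (induction k)
    case (Suc k)
    then show ?case using step[OF that(1), of k] by (cases "m = k") auto
  qed simp
  have bound: "\<exists>N. \<forall>n \<ge> N. component A x n = \<zero>\<^bsub>A\<^esub>" if x: "x \<in> carrier A" for x
  proof -
    obtain N where "\<forall>n \<in> {n. component A x n \<noteq> \<zero>\<^bsub>A\<^esub>}. n < N"
      using component_finite[OF x] unfolding finite_nat_set_iff_bounded by blast
    then show ?thesis by (intro exI[of _ N]) (auto simp: not_less[symmetric])
  qed
  \<comment> \<open>All components of \<open>x\<close> have degree below \<open>N x\<close>, so the iteration at \<open>x\<close> has become constant
    by step \<open>N x\<close>.\<close>
  define N where "N x = (SOME N. \<forall>n \<ge> N. component A x n = \<zero>\<^bsub>A\<^esub>)" for x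
  have N: "component A x n = \<zero>\<^bsub>A\<^esub>" if "x \<in> carrier A" "n \<ge> N x" for x n
    using someI_ex[OF bound[OF that(1)]] that(2) by (auto simp: N_def)
  have agree: "?g k x = ?g (N x) x" if x: "x \<in> carrier A" and k: "k \<ge> N x" for k x
  proof -
    have sum: "x = finsum A (component A x) {..<N x}"
      using N[OF x] by (intro component_sum[OF x]) (auto intro: leI)
    have gl: "?g l x = finsum A (\<lambda>n. ?g (Suc n) (component A x n)) {..<N x}" if l: "l \<ge> N x" for l
    proof -
      have "?g l x = ?g l (finsum A (component A x) {..<N x})" using sum by simp
      also have "\<dots> = finsum A (\<lambda>n. ?g l (component A x n)) {..<N x}"
        by (rule linear_finsum[OF module_axiom module_axiom g])
          (auto simp: component_closed x)
      also have "\<dots> = finsum A (\<lambda>n. ?g (Suc n) (component A x n)) {..<N x}"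
        using l by (intro finsum_cong')
          (auto intro!: stable component_grade linear_closed[OF g] component_closed x
            simp del: approx_inverse.simps)
      finally show ?thesis .
    qed
    show ?thesis using gl[OF k] gl[of "N x"] by simp
  qed
  \<comment> \<open>The limit of the iteration. On finitely many arguments it is a single member of the sequence,
    and therefore linear.\<close>
  define h where "h x = ?g (N x) x" for x
  have h_stage: "h x = ?g k x" if "x \<in> grade A n" "n < k" for x n k
  proof -
    have x: "x \<in> carrier A" using that grade_closed by blast
    have "h x = ?g (max k (N x)) x" unfolding h_def using agree[OF x, of "max k (N x)"] by simp
    also have "\<dots> = ?g k x"
      using stable[OF that(1), of "max k (N x)"] stable[OF that] that(2) by simp
    finally show ?thesis .
  qed
  have h: "h \<in> linear_maps R A A"
  proof (rule linear_mapsI_local[OF module_axiom])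
    fix S assume S: "finite S" "S \<subseteq> carrier A"
    have "h x = ?g (Max (insert 0 (N ` S))) x" if "x \<in> S" for x
      unfolding h_def by (rule agree[symmetric]) (use S that in auto)
    then show "\<exists>g \<in> linear_maps R A A. \<forall>x \<in> S. h x = g x" using g by blast
  qed
  have h_grade: "h x \<in> grade A n" if "x \<in> grade A n" for n x
    using h_stage[OF that lessI] g_grade[OF that] by (simp only:)
  have h_rec: "h x = \<eta> x \<oplus>\<^bsub>A\<^esub> convolution h ?d x" if x: "x \<in> grade A n" for n x
  proof -
    have "convolution (?g (Suc n)) ?d x = convolution h ?d x"
    proof (rule convolution_cong[OF g d h d x])
      fix i j a b assume "a \<in> grade A i" "i + j = n"
      then have "h a = ?g (Suc n) a" by (intro h_stage) auto
      then show "?g (Suc n) a \<otimes>\<^bsub>A\<^esub> ?d b = h a \<otimes>\<^bsub>A\<^esub> ?d b" by (simp only:)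
    qed
    then show ?thesis using h_stage[OF x, of "Suc (Suc n)"] by simp
  qed
  have inv_hom: "convolution h f x = \<eta> x" if x: "x \<in> grade A n" for n x
  proof -
    have xA: "x \<in> carrier A" using grade_closed[OF x] .
    \<comment> \<open>Add \<open>h \<star> (\<eta> - f)\<close> to both sides and use \<open>f + (\<eta> - f) = \<eta>\<close>.\<close>
    have "convolution h f x \<oplus>\<^bsub>A\<^esub> convolution h ?d x = convolution h (\<lambda>b. f b \<oplus>\<^bsub>A\<^esub> ?d b) x"
      by (rule convolution_add_right[symmetric, OF h f d xA])
    also have "\<dots> = convolution h \<eta> x"
    proof (rule convolution_cong[OF h linear_plus[OF module_axiom f d] h trivial_map_linear x])
      fix i j a b assume "a \<in> grade A i" "b \<in> grade A j"
      then have b: "f b \<in> carrier A" "\<eta> b \<in> carrier A"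
        using linear_closed[OF f] linear_closed[OF trivial_map_linear] grade_closed by blast+
      then have "f b \<oplus>\<^bsub>A\<^esub> ?d b = \<eta> b \<oplus>\<^bsub>A\<^esub> (f b \<oplus>\<^bsub>A\<^esub> \<ominus>\<^bsub>A\<^esub> f b)"
        by (simp add: defect_def smult_l_minus a_lcomm)
      then show "h a \<otimes>\<^bsub>A\<^esub> (f b \<oplus>\<^bsub>A\<^esub> ?d b) = h a \<otimes>\<^bsub>A\<^esub> \<eta> b" using b by (simp add: r_neg)
    qed
    also have "\<dots> = \<eta> x \<oplus>\<^bsub>A\<^esub> convolution h ?d x"
      using convolution_right_unit[OF h xA] h_rec[OF x] by simp
    finally show ?thesis
      using linear_closed[OF convolution_linear[OF h f] xA] linear_closed[OF trivial_map_linear xA]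
        linear_closed[OF convolution_linear[OF h d] xA] by simp
  qed
  have "convolution h f x = \<eta> x" if "x \<in> carrier A" for x
    using that
  proof (induction x rule: homogeneous_induct)
    case (hom n x)
    then show ?case by (rule inv_hom)
  next
    case (add x y)
    then show ?case
      by (simp add: linear_add[OF convolution_linear[OF h f]] linear_add[OF trivial_map_linear])
  qed
  moreover have "h x = x" if x: "x \<in> grade A 0" for x
  proof -
    have "convolution h ?d x = convolution h (\<lambda>b. \<zero>\<^bsub>A\<^esub>) x"
      by (rule convolution_cong[OF h d h linear_const_zero[OF module_axiom] x]) (simp add: d_zero)
    also have "\<dots> = \<zero>\<^bsub>A\<^esub>"
    proof -
      note zero = linear_const_zero[OF module_axiom, of A]
      have xA: "x \<in> carrier A" using grade_closed[OF x] .
      show ?thesis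
        using convolution_add_right[OF h zero zero xA]
          linear_closed[OF convolution_linear[OF h zero] xA] by simp
    qed
    finally show ?thesis using h_rec[OF x] x by (simp add: trivial_map_degree_zero grade_closed)
  qed
  ultimately show thesis using that h h_grade by blast
qed

lemma convolution_monoid_carrier:
  "f \<in> carrier (convolution_monoid R A \<Phi>) \<longleftrightarrow>
    f \<in> extensional (carrier A) \<and> f \<in> linear_maps R A A \<and>
    (\<forall>n. \<forall>x \<in> grade A n. f x \<in> grade A n) \<and> (\<forall>x \<in> grade A 0. f x = x)"
  unfolding convolution_monoid_def linear_maps_def PiE_def
  by (simp add: image_subset_iff) blast

lemma convolution_monoid_mult:
  assumes f: "f \<in> linear_maps R A A" and g: "g \<in> linear_maps R A A"
  shows "f \<otimes>\<^bsub>convolution_monoid R A \<Phi>\<^esub> g = (\<lambda>x \<in> carrier A. convolution f g x)"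
proof -
  have "tensor_lift A (\<lambda>a b. a \<otimes>\<^bsub>A\<^esub> b) (tensor_map R A A f g (\<Delta> x)) = convolution f g x"
    if x: "x \<in> carrier A" for x
  proof -
    note \<beta> = bilinear_precomp[OF AA_bilinear f g]
    note \<mu> = tensor_lift_linear[OF modules module_axiom mult_bilinear]
    have "tensor_lift A (\<lambda>a b. a \<otimes>\<^bsub>A\<^esub> b) (tensor_map R A A f g (\<Delta> x)) =
        tensor_lift A (\<lambda>b c. tensor_lift A (\<lambda>a b. a \<otimes>\<^bsub>A\<^esub> b) (pure_tensor R A A (f b) (g c))) (\<Delta> x)"
      unfolding tensor_map_def
      by (rule linear_tensor_lift[OF modules AA_module module_axiom \<beta> \<mu> coproduct_closed[OF x]])
    also have "\<dots> = convolution f g x"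
      unfolding convolution_def
      by (rule tensor_lift_cong[OF modules module_axiom bilinear_comp[OF \<beta> \<mu>]
            mult_comp_bilinear[OF f g] _ coproduct_closed[OF x]])
        (simp add: tensor_lift_pure[OF modules module_axiom mult_bilinear] linear_closed[OF f]
          linear_closed[OF g])
    finally show ?thesis .
  qed
  then show ?thesis by (simp add: convolution_monoid_def cong: restrict_cong)
qed

lemma restrict_linear:
  assumes "f \<in> linear_maps R A A"
  shows "(\<lambda>x \<in> carrier A. f x) \<in> linear_maps R A A"
  by (rule linear_cong[OF module_axiom assms]) simp

lemma restrict_convolution_monoid:
  assumes "f \<in> linear_maps R A A" "\<And>n x. x \<in> grade A n \<Longrightarrow> f x \<in> grade A n"
    and "\<And>x. x \<in> grade A 0 \<Longrightarrow> f x = x"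
  shows "(\<lambda>x \<in> carrier A. f x) \<in> carrier (convolution_monoid R A \<Phi>)"
  using assms by (simp add: convolution_monoid_carrier restrict_linear grade_closed)

text \<open>
  The convolution monoid consists of extensional functions, while linear maps are given by any
  function with the right values on the carrier; convolution does not see the difference.
\<close>

lemma convolution_restrict:
  assumes f: "f \<in> linear_maps R A A" and g: "g \<in> linear_maps R A A" and x: "x \<in> carrier A"
    and f': "f' \<in> linear_maps R A A" and g': "g' \<in> linear_maps R A A"
    and "\<And>a. a \<in> carrier A \<Longrightarrow> f' a = f a" "\<And>a. a \<in> carrier A \<Longrightarrow> g' a = g a"
  shows "convolution f' g' x = convolution f g x"
  unfolding convolution_def
  by (rule tensor_lift_cong[OF modules module_axiom mult_comp_bilinear[OF f' g']
        mult_comp_bilinear[OF f g] _ coproduct_closed[OF x]]) (simp add: assms)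

text \<open>
  Degree 0 consists of the multiples of the unit, and \<open>\<Delta> 1 = 1 \<otimes> 1\<close>.
\<close>

lemma convolution_degree_zero:
  assumes f: "f \<in> linear_maps R A A" and g: "g \<in> linear_maps R A A"
    and "\<And>x. x \<in> grade A 0 \<Longrightarrow> f x = x" "\<And>x. x \<in> grade A 0 \<Longrightarrow> g x = x"
    and x: "x \<in> grade A 0"
  shows "convolution f g x = x"
proof -
  have r: "augmentation R A x \<in> carrier R" using augmentation_closed grade_closed[OF x] .
  have "x = augmentation R A x \<odot>\<^bsub>A\<^esub> \<one>\<^bsub>A\<^esub>"
    using x by (simp add: augmentation_component grade_closed component_homogeneous)
  moreover have "convolution f g (augmentation R A x \<odot>\<^bsub>A\<^esub> \<one>\<^bsub>A\<^esub>) = augmentation R A x \<odot>\<^bsub>A\<^esub> \<one>\<^bsub>A\<^esub>"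
    using r assms(3,4)[OF grade_one]
    by (simp add: linear_smult[OF convolution_linear[OF f g]] convolution_one[OF f g])
  ultimately show ?thesis by simp
qed

text \<open>
  A monoid with left inverses is a group. This makes the antipode, a value of the inverse operation
  of the monoid, a genuine inverse of the identity map.
\<close>

lemma convolution_group: "group (convolution_monoid R A \<Phi>)"
proof (rule groupI)
  let ?G = "convolution_monoid R A \<Phi>"
  have one: "\<one>\<^bsub>?G\<^esub> = (\<lambda>x \<in> carrier A. \<eta> x)" by (simp add: convolution_monoid_def)
  note car = convolution_monoid_carrier
  show "\<one>\<^bsub>?G\<^esub> \<in> carrier ?G"
    unfolding one by (intro restrict_convolution_monoid trivial_map_linear trivial_map_grade
        trivial_map_degree_zero)
  have eqI: "f = g" if "f \<in> extensional (carrier A)" "g \<in> extensional (carrier A)"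
    "\<And>x. x \<in> carrier A \<Longrightarrow> f x = g x" for f g :: "'a \<Rightarrow> 'a"
    using that by (rule extensionalityI)
  fix f assume "f \<in> carrier ?G"
  then have f: "f \<in> extensional (carrier A)" "f \<in> linear_maps R A A"
    "\<And>n x. x \<in> grade A n \<Longrightarrow> f x \<in> grade A n" "\<And>x. x \<in> grade A 0 \<Longrightarrow> f x = x"
    by (auto simp: car)
  show "\<one>\<^bsub>?G\<^esub> \<otimes>\<^bsub>?G\<^esub> f = f"
    unfolding one convolution_monoid_mult[OF restrict_linear[OF trivial_map_linear] f(2)]
  proof (rule eqI[OF restrict_extensional f(1)])
    fix x assume x: "x \<in> carrier A"
    have "convolution (\<lambda>x \<in> carrier A. \<eta> x) f x = convolution \<eta> f x"
      by (rule convolution_restrict[OF trivial_map_linear f(2) x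
            restrict_linear[OF trivial_map_linear] f(2)]) simp_all
    then show "(\<lambda>x \<in> carrier A. convolution (\<lambda>x \<in> carrier A. \<eta> x) f x) x = f x"
      using convolution_left_unit[OF f(2) x] x by simp
  qed
  show "\<exists>g \<in> carrier ?G. g \<otimes>\<^bsub>?G\<^esub> f = \<one>\<^bsub>?G\<^esub>"
  proof -
    obtain g where g: "g \<in> linear_maps R A A" "\<And>n x. x \<in> grade A n \<Longrightarrow> g x \<in> grade A n"
      "\<And>x. x \<in> grade A 0 \<Longrightarrow> g x = x" "\<And>x. x \<in> carrier A \<Longrightarrow> convolution g f x = \<eta> x"
      using convolution_left_inverse[OF f(2-4)] by blast
    have "(\<lambda>x \<in> carrier A. g x) \<otimes>\<^bsub>?G\<^esub> f = \<one>\<^bsub>?G\<^esub>"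
      unfolding one convolution_monoid_mult[OF restrict_linear[OF g(1)] f(2)]
    proof (rule restrict_ext)
      fix x assume x: "x \<in> carrier A"
      have "convolution (\<lambda>x \<in> carrier A. g x) f x = convolution g f x"
        by (rule convolution_restrict[OF g(1) f(2) x restrict_linear[OF g(1)] f(2)]) simp_all
      then show "convolution (\<lambda>x \<in> carrier A. g x) f x = \<eta> x" using g(4)[OF x] by simp
    qed
    then show ?thesis using restrict_convolution_monoid[OF g(1-3)] by blast
  qed
  fix g assume "g \<in> carrier ?G"
  then have g: "g \<in> linear_maps R A A"
    "\<And>n x. x \<in> grade A n \<Longrightarrow> g x \<in> grade A n" "\<And>x. x \<in> grade A 0 \<Longrightarrow> g x = x"
    by (auto simp: car)
  show "f \<otimes>\<^bsub>?G\<^esub> g \<in> carrier ?G"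
    unfolding convolution_monoid_mult[OF f(2) g(1)]
    by (intro restrict_convolution_monoid convolution_linear f g convolution_grade
        convolution_degree_zero)
  fix h assume "h \<in> carrier ?G"
  then have h: "h \<in> linear_maps R A A" by (auto simp: car)
  note fg = convolution_linear[OF f(2) g(1)] and gh = convolution_linear[OF g(1) h]
  show "f \<otimes>\<^bsub>?G\<^esub> g \<otimes>\<^bsub>?G\<^esub> h = f \<otimes>\<^bsub>?G\<^esub> (g \<otimes>\<^bsub>?G\<^esub> h)"
    unfolding convolution_monoid_mult[OF f(2) g(1)] convolution_monoid_mult[OF g(1) h]
      convolution_monoid_mult[OF restrict_linear[OF fg] h]
      convolution_monoid_mult[OF f(2) restrict_linear[OF gh]]
  proof (rule restrict_ext)
    fix x assume x: "x \<in> carrier A"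
    have "convolution (\<lambda>x \<in> carrier A. convolution f g x) h x = convolution (convolution f g) h x"
      by (rule convolution_restrict[OF fg h x restrict_linear[OF fg] h]) simp_all
    moreover have "convolution f (\<lambda>x \<in> carrier A. convolution g h x) x =
        convolution f (convolution g h) x"
      by (rule convolution_restrict[OF f(2) gh x f(2) restrict_linear[OF gh]]) simp_all
    ultimately show "convolution (\<lambda>x \<in> carrier A. convolution f g x) h x =
        convolution f (\<lambda>x \<in> carrier A. convolution g h x) x"
      using convolution_assoc[OF f(2) g(1) h x] by simp
  qed
qed

lemma antipode_linear: "antipode R A \<Phi> \<in> linear_maps R A A"
  and antipode_left_inverse:
    "x \<in> carrier A \<Longrightarrow> convolution (antipode R A \<Phi>) id x = \<eta> x"
proof -
  let ?G = "convolution_monoid R A \<Phi>"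
  interpret G: group ?G by (rule convolution_group)
  note id = hom_linear[OF hom_id[of R A]]
  have idG: "(\<lambda>x \<in> carrier A. x) \<in> carrier ?G"
    using restrict_convolution_monoid[OF id] by simp
  then have "antipode R A \<Phi> \<in> carrier ?G" unfolding antipode_def by (rule G.inv_closed)
  then show lin: "antipode R A \<Phi> \<in> linear_maps R A A" by (simp add: convolution_monoid_carrier)
  have rid: "(\<lambda>x \<in> carrier A. x) \<in> linear_maps R A A" using restrict_linear[OF id] by simp
  assume x: "x \<in> carrier A"
  have "antipode R A \<Phi> \<otimes>\<^bsub>?G\<^esub> (\<lambda>x \<in> carrier A. x) = \<one>\<^bsub>?G\<^esub>"
    unfolding antipode_def by (rule G.l_inv[OF idG])
  then have "(\<lambda>x \<in> carrier A. convolution (antipode R A \<Phi>) (\<lambda>x \<in> carrier A. x) x) x = \<one>\<^bsub>?G\<^esub> x"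
    by (simp add: convolution_monoid_mult[OF lin rid])
  then have "convolution (antipode R A \<Phi>) (\<lambda>x \<in> carrier A. x) x = \<eta> x"
    using x by (simp add: convolution_monoid_def)
  moreover have "convolution (antipode R A \<Phi>) (\<lambda>x \<in> carrier A. x) x =
      convolution (antipode R A \<Phi>) id x"
    by (rule convolution_restrict[OF lin id x lin rid]) simp_all
  ultimately show "convolution (antipode R A \<Phi>) id x = \<eta> x" by simp
qed


section \<open>The inverse of a cogroup and the antipode\<close>

text \<open>
  Coassociativity evaluated in \<open>A \<otimes> A\<close> with the components \<open>a \<otimes> 1\<close>, \<open>1 \<otimes> a\<close> and \<open>1 \<otimes> \<nu> a\<close>. The
  first two combine to \<open>\<Delta>\<close>. The last two combine to \<open>\<epsilon>(a) (1 \<otimes> 1)\<close>, because \<open>\<nu>\<close> is an inverse, and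
  the counit then leaves \<open>x \<otimes> 1\<close>.
\<close>

lemma cogroup_inverse_coproduct:
  assumes inv: "comonoid_inverse R A \<Phi> \<nu>" and x: "x \<in> carrier A"
  shows "copair AA \<Delta> (\<lambda>a. inr (\<nu> a)) (\<Phi> x) = inl x"
proof -
  have \<nu>: "\<nu> \<in> unital_homs R A A"
    using inv by (auto simp: comonoid_inverse_def intro: alg_hom_unital_hom)
  note inr\<nu> = hom_comp[OF \<nu> inr_hom] and inl_\<eta> = hom_comp[OF trivial_map_hom inl_hom]
  note fp_cl = hom_closed[OF \<Phi>_hom]
  note id = hom_id[of R A]
  have \<Delta>: "\<Delta> = (\<lambda>y. copair AA inl inr (\<Phi> y))" by (simp add: hopf_coproduct_def comp_def)
  \<comment> \<open>The scalar \<open>\<epsilon>(y)\<close> moves from the second to the first tensor factor.\<close>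
  have unit: "copair AA inr (\<lambda>a. inr (\<nu> a)) (\<Phi> y) = inl (\<eta> y)" if y: "y \<in> carrier A" for y
  proof -
    have "inr (copair A id \<nu> (\<Phi> y)) = copair AA inr (\<lambda>a. inr (\<nu> a)) (\<Phi> y)"
      by (rule copair_unique[OF alg alg AA_alg inr_hom inr\<nu>
            hom_comp[OF copair_hom[OF alg alg alg id \<nu>] inr_hom] _ _ fp_cl[OF y]])
        (simp_all add: copair_left[OF alg alg alg id \<nu>] copair_right[OF alg alg alg id \<nu>])
    moreover have "copair A id \<nu> (\<Phi> y) = \<eta> y"
      using inv y by (simp add: comonoid_inverse_def)
    ultimately show ?thesis
      using y by (simp add: trivial_map_def augmentation_closed
          pure_tensor_smult_left[OF modules] pure_tensor_smult_right[OF modules])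
  qed
  have "copair AA \<Delta> (\<lambda>a. inr (\<nu> a)) (\<Phi> x) =
      copair AA inl (\<lambda>y. copair AA inr (\<lambda>a. inr (\<nu> a)) (\<Phi> y)) (\<Phi> x)"
    unfolding \<Delta> by (rule comonoid_coassoc_copair[OF comonoid AA_alg inl_hom inr_hom inr\<nu> x])
  also have "\<dots> = inl (copair A id \<eta> (\<Phi> x))"
  proof (rule copair_unique[symmetric, OF alg alg AA_alg inl_hom
        hom_comp[OF \<Phi>_hom copair_hom[OF alg alg AA_alg inr_hom inr\<nu>]]
        hom_comp[OF copair_hom[OF alg alg alg id trivial_map_hom] inl_hom] _ _ fp_cl[OF x]])
    fix a assume a: "a \<in> carrier A"
    show "inl (copair A id \<eta> (fp_left R A A a)) = inl a"
      using a by (simp add: copair_left[OF alg alg alg id trivial_map_hom])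
    show "inl (copair A id \<eta> (fp_right R A A a)) = copair AA inr (\<lambda>a. inr (\<nu> a)) (\<Phi> a)"
      using a by (simp add: copair_right[OF alg alg alg id trivial_map_hom] unit)
  qed
  also have "copair A id \<eta> (\<Phi> x) = x" using comonoid x by (simp add: comonoid_def)
  finally show ?thesis .
qed

text \<open>
  Apply \<open>\<kappa> : a \<otimes> b \<mapsto> \<chi>(a) b\<close> to the identity of \<open>cogroup_inverse_coproduct\<close>. It sends \<open>x \<otimes> 1\<close> to
  \<open>\<chi>(x)\<close>. On a product \<open>a' b''\<close> the other side becomes \<open>(\<chi> \<star> id)(a) \<nu>(b) = \<eta>(a) \<nu>(b)\<close>, which is also
  the value there of the morphism with components \<open>\<eta>\<close> and \<open>\<nu>\<close>; that morphism sends \<open>\<Phi> x\<close> to \<open>\<nu>(x)\<close>.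
  The two linear maps agree on the span of these products, and this is where the condition on \<open>x\<close>
  enters.
\<close>

lemma inverse_eq_antipode:
  assumes inv: "comonoid_inverse R A \<Phi> \<nu>" and x: "x \<in> berstein_subcoalgebra R A \<Phi>"
  shows "\<nu> x = antipode R A \<Phi> x"
proof -
  let ?F = "free_product R A A"
  let ?\<chi> = "antipode R A \<Phi>"
  let ?\<kappa> = "tensor_lift A (\<lambda>a b. ?\<chi> a \<otimes>\<^bsub>A\<^esub> id b)"
  have xA: "x \<in> carrier A" and span: "\<Phi> x \<in> span_of R ?F
      {fp_left R A A a \<otimes>\<^bsub>?F\<^esub> fp_right R A A b |a b. a \<in> carrier A \<and> b \<in> carrier A}"
    using x by (auto simp: berstein_subcoalgebra_def)
  have \<nu>: "\<nu> \<in> unital_homs R A A"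
    using inv by (auto simp: comonoid_inverse_def intro: alg_hom_unital_hom)
  note id = hom_id[of R A]
  note inr\<nu> = hom_comp[OF \<nu> inr_hom]
  note fl = hom_closed[OF fp_left_hom[OF alg alg]] and fr = hom_closed[OF fp_right_hom[OF alg alg]]
  interpret F: unital_algebra R ?F by (rule fp_alg)
  interpret AA: unital_algebra R AA by (rule AA_alg)
  have \<kappa>: "?\<kappa> \<in> linear_maps R AA A" by (rule mult_lift_linear[OF antipode_linear hom_linear[OF id]])
  note \<kappa>_pure = mult_lift_pure[OF antipode_linear hom_linear[OF id]]
  \<comment> \<open>Although \<open>\<kappa>\<close> is not multiplicative, it is linear over the second factor acting from the
    right.\<close>
  have \<kappa>_right: "?\<kappa> (X \<otimes>\<^bsub>AA\<^esub> inr c) = ?\<kappa> X \<otimes>\<^bsub>A\<^esub> c" if X: "X \<in> carrier AA" and c: "c \<in> carrier A" for X c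
  proof (rule tensor_linear_eq[OF modules _ _ _ X])
    show "(\<lambda>X. ?\<kappa> (X \<otimes>\<^bsub>AA\<^esub> inr c)) \<in> linear_maps R AA A"
      by (rule linear_comp[OF bilinear_left[OF AA.mult_bilinear hom_closed[OF inr_hom c]] \<kappa>])
    show "(\<lambda>X. ?\<kappa> X \<otimes>\<^bsub>A\<^esub> c) \<in> linear_maps R AA A"
      by (rule linear_comp[OF \<kappa> bilinear_left[OF mult_bilinear c]])
    fix a b assume ab: "a \<in> carrier A" "b \<in> carrier A"
    show "?\<kappa> (pure_tensor R A A a b \<otimes>\<^bsub>AA\<^esub> inr c) = ?\<kappa> (pure_tensor R A A a b) \<otimes>\<^bsub>A\<^esub> c"
      unfolding tensor_mult_right_factor[OF galg galg ab c] \<kappa>_pure[OF ab]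
        \<kappa>_pure[OF ab(1) m_closed[OF ab(2) c]]
      using ab c linear_closed[OF antipode_linear] by (simp add: m_assoc)
  qed
  let ?L = "copair AA \<Delta> (\<lambda>a. inr (\<nu> a))" and ?E = "copair A \<eta> \<nu>"
  note L = copair_hom[OF alg alg AA_alg coproduct_hom inr\<nu>]
  note E = copair_hom[OF alg alg alg trivial_map_hom \<nu>]
  have "?\<kappa> (?L (\<Phi> x)) = ?E (\<Phi> x)"
  proof (rule linear_eq_on_span[OF F.module_axiom module_axiom linear_comp[OF hom_linear[OF L] \<kappa>]
        hom_linear[OF E] _ _ span])
    show "{fp_left R A A a \<otimes>\<^bsub>?F\<^esub> fp_right R A A b |a b. a \<in> carrier A \<and> b \<in> carrier A}
        \<subseteq> carrier ?F"
      using fl fr by blast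
    fix X assume "X \<in> {fp_left R A A a \<otimes>\<^bsub>?F\<^esub> fp_right R A A b |a b. a \<in> carrier A \<and> b \<in> carrier A}"
    then obtain a b where X: "X = fp_left R A A a \<otimes>\<^bsub>?F\<^esub> fp_right R A A b"
      and ab: "a \<in> carrier A" "b \<in> carrier A" by blast
    have "?\<kappa> (?L X) = ?\<kappa> (\<Delta> a \<otimes>\<^bsub>AA\<^esub> inr (\<nu> b))"
      using ab by (simp add: X hom_mult[OF L] fl fr copair_left[OF alg alg AA_alg coproduct_hom inr\<nu>]
          copair_right[OF alg alg AA_alg coproduct_hom inr\<nu>])
    also have "\<dots> = convolution ?\<chi> id a \<otimes>\<^bsub>A\<^esub> \<nu> b"
      using \<kappa>_right[OF coproduct_closed[OF ab(1)] hom_closed[OF \<nu> ab(2)]]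
      by (simp add: convolution_def)
    also have "\<dots> = \<eta> a \<otimes>\<^bsub>A\<^esub> \<nu> b" using antipode_left_inverse[OF ab(1)] by simp
    also have "\<dots> = ?E X"
      using ab by (simp add: X hom_mult[OF E] fl fr copair_left[OF alg alg alg trivial_map_hom \<nu>]
          copair_right[OF alg alg alg trivial_map_hom \<nu>])
    finally show "?\<kappa> (?L X) = ?E X" .
  qed
  moreover have "?\<kappa> (?L (\<Phi> x)) = ?\<chi> x"
    using \<kappa>_pure[OF xA one_closed] xA linear_closed[OF antipode_linear xA]
    by (simp add: cogroup_inverse_coproduct[OF inv xA])
  moreover have "?E (\<Phi> x) = \<nu> x"
  proof -
    have \<nu>\<eta>: "\<nu> (\<eta> a) = \<eta> a" if "a \<in> carrier A" for a
      using that by (simp add: trivial_map_def hom_smult[OF \<nu>] hom_one[OF \<nu>] augmentation_closed)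
    have "\<nu> (copair A \<eta> id (\<Phi> x)) = ?E (\<Phi> x)"
      by (rule copair_unique[OF alg alg alg trivial_map_hom \<nu>
            hom_comp[OF copair_hom[OF alg alg alg trivial_map_hom id] \<nu>] _ _ hom_closed[OF \<Phi>_hom xA]])
        (simp_all add: copair_left[OF alg alg alg trivial_map_hom id]
          copair_right[OF alg alg alg trivial_map_hom id] \<nu>\<eta>)
    then show ?thesis using comonoid xA by (simp add: comonoid_def)
  qed
  ultimately show ?thesis by simp
qed

end

theorem theorem1p2:
  fixes R :: "('r, 'l) ring_scheme"
    and A :: "('r, 'a, 'm) graded_alg_scheme"
    and \<Phi> :: "'a \<Rightarrow> ('r, 'a, 'a) fp_term set"
    and \<nu> :: "'a \<Rightarrow> 'a"
  assumes "cring R"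
    and "cogroup R A \<Phi>"
    and "comonoid_inverse R A \<Phi> \<nu>"
  shows "\<forall>x \<in> berstein_subcoalgebra R A \<Phi>. \<nu> x = antipode R A \<Phi> x"
proof -
  have com: "comonoid R A \<Phi>" using assms(2) by (simp add: cogroup_def)
  then interpret graded_comonoid R A \<Phi>
    by (intro graded_comonoid.intro graded_comonoid_axioms.intro) (simp_all add: comonoid_def)
  show ?thesis using inverse_eq_antipode[OF assms(3)] by blast
qed

end
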